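(* For $q=e^{2\pi i\tau}$ with $\operatorname{Im}(\tau)>0$, the following identities hold: \begin{align*} 2\phi_{R}(q)-2A_{2}(-q^2)&=2q\,\frac{\Theta_{2}^7\Theta_{8}^4}{\Theta_{1}^4\Theta_{4}^6},\\ 2\phi_{R}(q)+\frac12\mu_{2}(q^2)&=\frac12\frac{\Theta_{2}^3\Theta_{4}^6}{\Theta_{1}^4\Theta_{8}^4},\\ 2\phi_{R}(q)+\frac14\mu_{2}(q^2)-A_{2}(-q^2)&=\frac14\frac{\Theta_{2}^{17}}{\Theta_{1}^8\Theta_{4}^8}. \end{align*}
   Context: Here $q=e^{2\pi i\tau}$, $\operatorname{Im}(\tau)>0$ (so $0<|q|<1$). Notation: $(x;q)_n=\prod_{i=0}^{n-1}(1-q^ix)$, $(x)_n=(x;q)_n$, and $\Theta_m=\prod_{i\ge1}(1-q^{mi})$ for positive integers $m$. The function $\phi_R$ is $$\phi_R(q)=\sum_{n\ge0}\frac{q^{n+1}(-q)_{2n}}{(q;q^2)_{n+1}^2},$$ and the second-order mock theta functions $A_2,\mu_2$ are $$A_2(q)=\sum_{n\ge0}\frac{q^{n+1}(-q^2;q^2)_n}{(q;q^2)_{n+1}}=\sum_{n\ge0}\frac{q^{(n+1)^2}(-q;q^2)_n}{(q;q^2)_{n+1}^2},\qquad \mu_2(q)=\sum_{n\ge0}\frac{(-1)^nq^{n^2}(q;q^2)_n}{(-q^2;q^2)_n^2}.$$ *)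

theory Defs
  imports "HOL-Analysis.Analysis"
begin

text \<open>\<open>qpoch x q n\<close> is $(x;q)_n$; the one-parameter symbol $(x)_n$ is \<open>qpoch x q n\<close>
  with \<open>q\<close> the nome.\<close>

definition qpoch :: "complex \<Rightarrow> complex \<Rightarrow> nat \<Rightarrow> complex" where
  "qpoch x q n = (\<Prod>i<n. 1 - q ^ i * x)"

text \<open>The product defining $\Theta_m$ starts at exponent $m$, whence the shift of the index.\<close>

definition Theta :: "complex \<Rightarrow> nat \<Rightarrow> complex" where
  "Theta q m = (\<Prod>i. 1 - q ^ (m * Suc i))"

definition phi_R :: "complex \<Rightarrow> complex" where
  "phi_R q = (\<Sum>n. q ^ (n + 1) * qpoch (- q) q (2 * n) / (qpoch q (q ^ 2) (n + 1)) ^ 2)"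

text \<open>The Eulerian series below is one of two classical equal forms of $A_2$; the other is
  $\sum_{n\ge0} q^{(n+1)^2}(-q;q^2)_n/(q;q^2)_{n+1}^2$.\<close>

definition A2 :: "complex \<Rightarrow> complex" where
  "A2 q = (\<Sum>n. q ^ (n + 1) * qpoch (- (q ^ 2)) (q ^ 2) n / qpoch q (q ^ 2) (n + 1))"

definition mu2 :: "complex \<Rightarrow> complex" where
  "mu2 q = (\<Sum>n. (- 1) ^ n * q ^ (n ^ 2) * qpoch q (q ^ 2) n / (qpoch (- (q ^ 2)) (q ^ 2) n) ^ 2)"

end

theory Submission
  imports Defs
begin

text \<open>
  Write $p=q^2$, $J=(p;p)_\infty$ and
  $j(z)=\sum_r(-1)^rq^{r(r-1)}z^r=J\,(z;p)_\infty(p/z;p)_\infty$ (Jacobi's triple product), and let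
  \[ M(z)=\sum_{t\in\mathbb{Z}}\frac{(-1)^tq^{t(t+1)}z^{t+1}}{1-q^{2t}z},\qquad
     P(z)=\sum_{t\in\mathbb{Z}}\frac{q^{2t}z}{(1-q^{2t}z)^2}. \]

  Bailey's lemma, fed with two Bailey pairs that are finite partial fraction expansions, turns the
  Eulerian series into Appell series (\<open>phi_R_eq\<close>, \<open>A2_eq\<close>, \<open>mu2_eq\<close>; for $A_2$ the series is first
  brought to its second form by Fine's transformation).  In terms of the nome of $\phi_R$,
  \[ 2\phi_R(q)=\frac{M(q)}{j(q)},\qquad \frac14\mu_2(q^2)-A_2(-q^2)=-\frac{M(-1)}{j(-1)},\qquad
     \frac14\mu_2(q^2)+A_2(-q^2)=\frac{J^3}{j(-1)^2}, \]
  the last one because its left hand side is $1/j(-1)$ times the partial fraction expansion of $J^3/j(z)$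
  at $z=-1$.

  The function $M(z)/j(z)$ is elliptic with a double pole.  Explicitly, $J^3M(z)/j(z)=P(z)-c$ with \<open>c\<close>
  independent of \<open>z\<close> (\<open>appell_mult_E\<close>): expand $z^{t+1}J^3/j(z)$ into partial fractions for each \<open>t\<close>, and sum
  the double series along the diagonals, where it telescopes.  Hence the left hand side of the third
  identity is $(P(q)-P(-1))/J^3$.  The same telescoping applied to the square of
  $S=\sum_nq^n/(1+q^{2n})$ gives $P(q)-P(-1)=S^2$ (\<open>double_pole_sum0_q\<close>), and
  $S=j(-q)J^3/(j(q)j(-1))$ is a product by \<open>lambert_product\<close>.  This proves the third identity.

  The other two follow by subtracting and adding $J^3/j(-1)^2$, because
  $\left(\sum_nq^{n^2}\right)^2=\left(\sum_nq^{2n^2}\right)^2+q\left(\sum_nq^{2n^2+2n}\right)^2$, together with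
  the same relation for $-q$.
\<close>

section \<open>Pochhammer symbols\<close>

lemma qpoch_0 [simp]: "qpoch x q 0 = 1"
  by (simp add: qpoch_def)

lemma qpoch_Suc: "qpoch x q (Suc n) = qpoch x q n * (1 - q ^ n * x)"
  by (simp add: qpoch_def)

lemma qpoch_Suc_shift: "qpoch x q (Suc n) = (1 - x) * qpoch (q * x) q n"
  unfolding qpoch_def prod.lessThan_Suc_shift by (simp add: algebra_simps)

lemma qpoch_add: "qpoch x q (m + n) = qpoch x q m * qpoch (q ^ m * x) q n"
  by (induction n) (simp_all add: qpoch_Suc power_add algebra_simps)

lemma qpoch_zero [simp]: "qpoch 0 q n = 1"
  by (simp add: qpoch_def)

lemma qpoch_eq_0_iff: "qpoch x q n = 0 \<longleftrightarrow> (\<exists>i<n. q ^ i * x = 1)"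
  by (auto simp: qpoch_def)

text \<open>The infinite symbol $(x;q)_\infty$.\<close>

definition qpinf :: "complex \<Rightarrow> complex \<Rightarrow> complex" where
  "qpinf x q = (\<Prod>i. 1 - q ^ i * x)"

lemma Theta_eq_qpinf: "Theta q m = qpinf (q ^ m) (q ^ m)"
  unfolding Theta_def qpinf_def
  by (simp add: power_mult[symmetric] power_add mult.commute)

lemma convergent_prod_qpinf:
  fixes q x :: complex
  assumes "norm q < 1"
  shows "convergent_prod (\<lambda>i. 1 - q ^ i * x)"
proof -
  have "summable (\<lambda>i. norm (1 - q ^ i * x - 1))"
    using summable_mult2[OF summable_geometric[of "norm q"], of "norm x"] assms
    by (simp add: norm_mult norm_power)
  thus ?thesis
    using abs_convergent_prod_conv_summable abs_convergent_prod_imp_convergent_prod by blast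
qed

lemma qpoch_tendsto:
  assumes "norm q < 1"
  shows "(\<lambda>n. qpoch x q n) \<longlonglongrightarrow> qpinf x q"
proof -
  have "(\<lambda>n. \<Prod>i\<le>n. 1 - q ^ i * x) \<longlonglongrightarrow> qpinf x q"
    unfolding qpinf_def by (rule convergent_prod_LIMSEQ[OF convergent_prod_qpinf[OF assms]])
  hence "(\<lambda>n. qpoch x q (Suc n)) \<longlonglongrightarrow> qpinf x q"
    unfolding qpoch_def lessThan_Suc_atMost .
  thus ?thesis by (rule LIMSEQ_imp_Suc)
qed

lemma qpinf_eqI:
  assumes "norm q < 1" "(\<lambda>n. qpoch x q n) \<longlonglongrightarrow> L"
  shows "qpinf x q = L"
  using LIMSEQ_unique[OF qpoch_tendsto[OF assms(1)] assms(2)] .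

lemma qpinf_nonzero:
  assumes "norm q < 1" "\<And>i. q ^ i * x \<noteq> 1"
  shows "qpinf x q \<noteq> 0"
  unfolding qpinf_def
  by (rule prodinf_nonzero[OF convergent_prod_qpinf[OF assms(1)]]) (use assms(2) in auto)

lemma qpinf_zero [simp]: "qpinf 0 q = 1"
  by (simp add: qpinf_def)

lemma qpoch_mult_qpinf:
  assumes "norm q < 1"
  shows "qpoch x q n * qpinf (q ^ n * x) q = qpinf x q"
proof -
  have "(\<lambda>k. qpoch x q (k + n)) \<longlonglongrightarrow> qpinf x q"
    by (rule LIMSEQ_ignore_initial_segment[OF qpoch_tendsto[OF assms]])
  moreover have "(\<lambda>k. qpoch x q n * qpoch (q ^ n * x) q k)
      \<longlonglongrightarrow> qpoch x q n * qpinf (q ^ n * x) q"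
    by (intro tendsto_mult tendsto_const qpoch_tendsto assms)
  ultimately show ?thesis
    by (simp add: qpoch_add[symmetric] add.commute LIMSEQ_unique)
qed

lemma qpinf_Suc:
  assumes "norm q < 1"
  shows "qpinf x q = (1 - x) * qpinf (q * x) q"
  using qpoch_mult_qpinf[OF assms, of x 1] by (simp add: qpoch_def)

lemma qpinf_mult_minus:
  assumes "norm q < 1"
  shows "qpinf x q * qpinf (- x) q = qpinf (x ^ 2) (q ^ 2)"
proof -
  have q2: "norm (q ^ 2) < 1"
    using assms by (simp add: norm_power power_less_one_iff)
  have eq: "qpoch (x ^ 2) (q ^ 2) n = qpoch x q n * qpoch (- x) q n" for n
    by (induction n)
       (simp_all add: qpoch_Suc power2_eq_square power_mult_distrib algebra_simps)
  have "(\<lambda>n. qpoch (x ^ 2) (q ^ 2) n) \<longlonglongrightarrow> qpinf x q * qpinf (- x) q"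
    unfolding eq by (intro tendsto_mult qpoch_tendsto assms)
  from qpinf_eqI[OF q2 this] show ?thesis by simp
qed

lemma qpoch_double: "qpoch x q (2 * n) = qpoch x (q ^ 2) n * qpoch (q * x) (q ^ 2) n"
  by (induction n) (simp_all add: qpoch_Suc power_mult[symmetric] algebra_simps)

lemma qpinf_even_odd:
  assumes "norm q < 1"
  shows "qpinf x (q ^ 2) * qpinf (q * x) (q ^ 2) = qpinf x q"
proof -
  have q2: "norm (q ^ 2) < 1"
    using assms by (simp add: norm_power power_less_one_iff)
  have "strict_mono (\<lambda>n::nat. 2 * n)" by (auto simp: strict_mono_def)
  from LIMSEQ_subseq_LIMSEQ[OF qpoch_tendsto[OF assms, of x] this]
  have "(\<lambda>n. qpoch x q (2 * n)) \<longlonglongrightarrow> qpinf x q" by (simp add: o_def)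
  moreover have "(\<lambda>n. qpoch x q (2 * n)) \<longlonglongrightarrow> qpinf x (q ^ 2) * qpinf (q * x) (q ^ 2)"
    unfolding qpoch_double by (intro tendsto_mult qpoch_tendsto q2)
  ultimately show ?thesis by (rule LIMSEQ_unique[symmetric])
qed

lemma qpoch_bounded:
  assumes "norm q < 1"
  shows "\<exists>B>0. \<forall>n. norm (qpoch x q n) \<le> B"
  using convergent_imp_Bseq[OF convergentI[OF qpoch_tendsto[OF assms, of x]]]
  by (auto simp: Bseq_def)

lemma qpoch_inverse_bounded:
  assumes "norm q < 1" "\<And>i. q ^ i * x \<noteq> 1"
  shows "\<exists>B>0. \<forall>n. norm (1 / qpoch x q n) \<le> B"
proof -
  have "(\<lambda>n. 1 / qpoch x q n) \<longlonglongrightarrow> 1 / qpinf x q"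
    by (intro tendsto_divide tendsto_const qpoch_tendsto qpinf_nonzero assms)
  from convergent_imp_Bseq[OF convergentI[OF this]] show ?thesis
    by (auto simp: Bseq_def)
qed

lemma power_mult_neq_1:
  fixes q :: complex
  assumes "norm q < 1" "norm x < 1"
  shows "q ^ i * x \<noteq> 1"
proof
  assume "q ^ i * x = 1"
  hence "norm q ^ i * norm x = 1" by (metis norm_mult norm_one norm_power)
  moreover have "norm q ^ i * norm x \<le> 1 * norm x"
    using assms by (intro mult_right_mono power_le_one) auto
  ultimately show False using assms by simp
qed

section \<open>A symmetric form of the q-Gauss sum\<close>

text \<open>For $s\ne0$ this is $s^n(1/s;p)_n$.  Written as a polynomial in $s$ it also covers the
  confluent case $s=0$, where it is $(-1)^np^{n(n-1)/2}$.\<close>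

definition rpoch :: "complex \<Rightarrow> complex \<Rightarrow> nat \<Rightarrow> complex" where
  "rpoch s p n = (\<Prod>i<n. s - p ^ i)"

lemma rpoch_0 [simp]: "rpoch s p 0 = 1"
  by (simp add: rpoch_def)

lemma rpoch_Suc: "rpoch s p (Suc n) = rpoch s p n * (s - p ^ n)"
  by (simp add: rpoch_def)

lemma rpoch_add:
  assumes "p \<noteq> 0"
  shows "rpoch s p (r + k) = rpoch s p r * (p ^ (r * k) * rpoch (s / p ^ r) p k)"
  using assms by (induction k) (simp_all add: rpoch_Suc power_add field_simps)

lemma summable_norm_ratio:
  fixes w x :: "nat \<Rightarrow> complex"
  assumes w: "\<And>n. w (Suc n) = x n * w n" and x: "x \<longlonglongrightarrow> l" and l: "norm l < 1"
  shows "summable (\<lambda>n. norm (w n))"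
proof -
  obtain b where b: "norm l < b" "b < 1"
    using l dense by blast
  have "eventually (\<lambda>n. norm (x n) < b) sequentially"
    using tendsto_norm[OF x] b by (auto dest: order_tendstoD(2))
  then obtain N where N: "\<And>n. n \<ge> N \<Longrightarrow> norm (x n) < b"
    by (auto simp: eventually_sequentially)
  show ?thesis
  proof (rule summable_ratio_test[where c = b and N = N])
    fix n assume "n \<ge> N"
    thus "norm (norm (w (Suc n))) \<le> b * norm (norm (w n))"
      using N[of n] by (simp add: w norm_mult mult_right_mono)
  qed (use b in auto)
qed

lemma rpoch_summable:
  assumes p: "norm p < 1" and c: "norm (c * s * t) < 1"
  shows "summable (\<lambda>n. norm (rpoch s p n * rpoch t p n * c ^ n))"
proof (rule summable_norm_ratio)
  show "(\<lambda>n. (s - p ^ n) * (t - p ^ n) * c) \<longlonglongrightarrow> (s - 0) * (t - 0) * c"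
    by (intro tendsto_intros LIMSEQ_power_zero p)
  show "norm ((s - 0) * (t - 0) * c) < 1"
    using c by (simp add: mult_ac)
qed (simp add: rpoch_Suc mult_ac)

text \<open>The terms of ${}_2\phi_1(1/s,1/t;c;p,cst)$.\<close>

definition gauss_term :: "complex \<Rightarrow> complex \<Rightarrow> complex \<Rightarrow> complex \<Rightarrow> nat \<Rightarrow> complex" where
  "gauss_term p s t c k = rpoch s p k * rpoch t p k * c ^ k / (qpoch p p k * qpoch c p k)"

lemma gauss_term_summable:
  assumes p: "norm p < 1" and c: "norm (c * s * t) < 1" and nz: "\<And>i. p ^ i * c \<noteq> 1"
  shows "summable (\<lambda>k. norm (gauss_term p s t c k))"
proof -
  obtain B1 where B1: "B1 > 0" "\<And>n. norm (1 / qpoch p p n) \<le> B1"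
    using qpoch_inverse_bounded[OF p power_mult_neq_1[OF p p]] by blast
  obtain B2 where B2: "B2 > 0" "\<And>n. norm (1 / qpoch c p n) \<le> B2"
    using qpoch_inverse_bounded[OF p nz] by blast
  have "summable (\<lambda>k. (B1 * B2) * norm (rpoch s p k * rpoch t p k * c ^ k))"
    by (intro summable_mult rpoch_summable p c)
  thus ?thesis
  proof (rule summable_comparison_test')
    fix k assume "k \<ge> (0::nat)"
    have "norm (gauss_term p s t c k) = norm (1 / qpoch p p k) * norm (1 / qpoch c p k)
        * norm (rpoch s p k * rpoch t p k * c ^ k)"
      by (simp add: gauss_term_def norm_mult norm_divide)
    also have "\<dots> \<le> (B1 * B2) * norm (rpoch s p k * rpoch t p k * c ^ k)"
      by (intro mult_right_mono mult_mono B1 B2) (use B1 in auto)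
    finally show "norm (norm (gauss_term p s t c k))
        \<le> (B1 * B2) * norm (rpoch s p k * rpoch t p k * c ^ k)" by simp
  qed
qed

text \<open>The contiguous relation between \<open>c\<close> and \<open>p * c\<close>: with $t_k$ the terms of the series on the
  left, the difference of the two sides, divided by $1-c$, telescopes along $-t_k(1-p^k)$.\<close>

lemma gauss_contiguous:
  assumes p: "norm p < 1" and c: "norm (c * s * t) < 1" and nz: "\<And>i. p ^ i * c \<noteq> 1"
  shows "(1 - c) * (1 - c * s * t) * (\<Sum>k. gauss_term p s t c k)
       = (1 - c * s) * (1 - c * t) * (\<Sum>k. gauss_term p s t (p * c) k)"
proof -
  have nz': "p ^ i * (p * c) \<noteq> 1" for i
    using nz[of "Suc i"] by (simp add: algebra_simps)
  have c': "norm (p * c * s * t) < 1"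
  proof -
    have "norm (p * c * s * t) = norm p * norm (c * s * t)" by (simp add: norm_mult algebra_simps)
    also have "\<dots> \<le> 1 * norm (c * s * t)" using p by (intro mult_right_mono) auto
    finally show ?thesis using c by simp
  qed
  define T where "T = gauss_term p s t c"
  define T' where "T' = gauss_term p s t (p * c)"
  have sT: "summable T" "summable T'"
    unfolding T_def T'_def
    using gauss_term_summable[OF p c nz] gauss_term_summable[OF p c' nz'] summable_norm_cancel
    by blast+
  have c1: "1 - c \<noteq> 0" using nz[of 0] by simp
  have ck: "1 - p ^ k * c \<noteq> 0" for k using nz[of k] by simp
  have pk: "1 - p ^ Suc k \<noteq> 0" for k using power_mult_neq_1[OF p p, of k] by (simp add: mult.commute)
  have T'T: "(1 - p ^ k * c) * T' k = p ^ k * (1 - c) * T k" for k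
  proof -
    have "(1 - p ^ k * c) * qpoch c p k = (1 - c) * qpoch (p * c) p k"
      using qpoch_Suc[of c p k] qpoch_Suc_shift[of c p k] by (simp add: mult.commute)
    moreover have "qpoch c p k \<noteq> 0" "qpoch (p * c) p k \<noteq> 0"
      using nz nz' by (auto simp: qpoch_eq_0_iff)
    ultimately have "(1 - p ^ k * c) / qpoch (p * c) p k = (1 - c) / qpoch c p k"
      by (simp add: frac_eq_eq)
    hence "p ^ k * (rpoch s p k * rpoch t p k * c ^ k / qpoch p p k) * ((1 - p ^ k * c) / qpoch (p * c) p k)
        = p ^ k * (rpoch s p k * rpoch t p k * c ^ k / qpoch p p k) * ((1 - c) / qpoch c p k)"
      by simp
    thus ?thesis
      unfolding T_def T'_def gauss_term_def by (simp add: power_mult_distrib mult_ac)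
  qed
  define g where "g k = - (T k * (1 - p ^ k))" for k
  have step: "(1 - c * s * t) * T k - (1 - c * s) * (1 - c * t) / (1 - c) * T' k = g (Suc k) - g k" for k
  proof -
    have "T (Suc k) = T k * (s - p ^ k) * (t - p ^ k) * c / (1 - p ^ k * c) / (1 - p ^ Suc k)"
      unfolding T_def gauss_term_def rpoch_Suc qpoch_Suc by (simp add: mult_ac)
    hence 2: "T (Suc k) * (1 - p ^ Suc k) = T k * (s - p ^ k) * (t - p ^ k) * c / (1 - p ^ k * c)"
      using pk[of k] by simp
    have 3: "T' k / (1 - c) = p ^ k * T k / (1 - p ^ k * c)"
      using T'T[of k] ck[of k] c1 by (simp add: field_simps)
    have "(1 - c * s) * (1 - c * t) / (1 - c) * T' k = (1 - c * s) * (1 - c * t) * (T' k / (1 - c))"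
      by simp
    hence "(1 - p ^ k * c) * ((1 - c * s * t) * T k - (1 - c * s) * (1 - c * t) / (1 - c) * T' k)
        = (1 - p ^ k * c) * (1 - c * s * t) * T k - (1 - c * s) * (1 - c * t) * p ^ k * T k"
      unfolding 3 using ck[of k] by (simp add: field_simps)
    also have "\<dots> = (1 - p ^ k * c) * T k * (1 - p ^ k) - T k * (s - p ^ k) * (t - p ^ k) * c"
      by (simp add: algebra_simps)
    also have "\<dots> = (1 - p ^ k * c) * (g (Suc k) - g k)"
      unfolding g_def 2 using ck[of k] by (simp add: field_simps)
    finally show ?thesis using ck[of k] by simp
  qed
  have "g \<longlonglongrightarrow> - (0 * (1 - 0))"
    unfolding g_def
    by (intro tendsto_intros LIMSEQ_power_zero p summable_LIMSEQ_zero sT)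
  hence "(\<lambda>k. g (Suc k) - g k) sums (0 - g 0)"
    using telescope_sums[of g 0] by simp
  moreover have "g 0 = 0" by (simp add: g_def)
  moreover have "(\<lambda>k. (1 - c * s * t) * T k - (1 - c * s) * (1 - c * t) / (1 - c) * T' k)
      sums ((1 - c * s * t) * suminf T - (1 - c * s) * (1 - c * t) / (1 - c) * suminf T')"
    by (intro sums_diff sums_mult summable_sums sT)
  ultimately have "(1 - c * s * t) * suminf T - (1 - c * s) * (1 - c * t) / (1 - c) * suminf T' = 0"
    unfolding step using sums_unique2 by fastforce
  thus ?thesis using c1 unfolding T_def T'_def by (simp add: field_simps)
qed

text \<open>Iterate the contiguous relation.  The term with index \<open>k\<close> of the series at $p^Nc$ is
  $O(p^{Nk})$, hence the series tends to its first term 1.\<close>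

theorem q_gauss:
  assumes p: "norm p < 1" and c: "norm (c * s * t) < 1" and nz: "\<And>i. p ^ i * c \<noteq> 1"
  shows "(\<Sum>k. gauss_term p s t c k)
       = qpinf (c * s) p * qpinf (c * t) p / (qpinf c p * qpinf (c * s * t) p)"
proof -
  define G where "G N = (\<Sum>k. gauss_term p s t (p ^ N * c) k)" for N
  have nzN: "p ^ i * (p ^ N * c) \<noteq> 1" for i N
    using nz[of "i + N"] by (simp add: power_add mult.assoc)
  have cN: "norm (p ^ N * c * s * t) < 1" for N
  proof -
    have "norm (p ^ N * c * s * t) = norm p ^ N * norm (c * s * t)"
      by (simp add: norm_mult norm_power algebra_simps)
    also have "\<dots> \<le> 1 * norm (c * s * t)" using p by (intro mult_right_mono power_le_one) auto
    finally show ?thesis using c by simp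
  qed
  have iter: "qpoch c p N * qpoch (c * s * t) p N * G 0 = qpoch (c * s) p N * qpoch (c * t) p N * G N" for N
  proof (induction N)
    case (Suc N)
    have "(1 - p ^ N * c) * (1 - p ^ N * (c * s * t)) * G N
        = (1 - p ^ N * (c * s)) * (1 - p ^ N * (c * t)) * G (Suc N)"
      using gauss_contiguous[OF p cN[of N] nzN] unfolding G_def by (simp add: mult.assoc)
    hence *: "qpoch (c * s) p N * qpoch (c * t) p N * ((1 - p ^ N * c) * (1 - p ^ N * (c * s * t)) * G N)
        = qpoch (c * s) p (Suc N) * qpoch (c * t) p (Suc N) * G (Suc N)"
      by (simp add: qpoch_Suc mult_ac)
    have "qpoch c p (Suc N) * qpoch (c * s * t) p (Suc N) * G 0
        = (1 - p ^ N * c) * (1 - p ^ N * (c * s * t)) * (qpoch c p N * qpoch (c * s * t) p N * G 0)"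
      unfolding qpoch_Suc by (simp only: mult_ac)
    also have "\<dots> = qpoch (c * s) p (Suc N) * qpoch (c * t) p (Suc N) * G (Suc N)"
      unfolding Suc *[symmetric] by (simp only: mult_ac)
    finally show ?case .
  qed simp
  have "(\<lambda>N. G N) \<longlonglongrightarrow> (\<Sum>k. if k = 0 then 1 else (0::complex))"
  proof -
    obtain B1 where B1: "B1 > 0" "\<And>n. norm (1 / qpoch p p n) \<le> B1"
      using qpoch_inverse_bounded[OF p power_mult_neq_1[OF p p]] by blast
    obtain B2 where B2: "B2 > 0" "\<And>n. norm (1 / qpoch c p n) \<le> B2"
      using qpoch_inverse_bounded[OF p nz] by blast
    obtain B3 where B3: "B3 > 0" "\<And>n. norm (qpoch c p n) \<le> B3"
      using qpoch_bounded[OF p] by blast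
    have key: "norm (gauss_term p s t (p ^ N * c) k)
        \<le> (norm p ^ N) ^ k * (B1 * (B2 * B3) * norm (rpoch s p k * rpoch t p k * c ^ k))" for N k
    proof -
      have "1 / qpoch (p ^ N * c) p k = 1 / qpoch c p (N + k) * qpoch c p N"
        using nz by (auto simp: qpoch_add qpoch_eq_0_iff)
      hence "norm (1 / qpoch (p ^ N * c) p k) = norm (1 / qpoch c p (N + k)) * norm (qpoch c p N)"
        by (metis norm_mult)
      also have "\<dots> \<le> B2 * B3" by (intro mult_mono B2 B3) (use B2 in auto)
      finally have b: "norm (1 / qpoch (p ^ N * c) p k) \<le> B2 * B3" .
      have "norm (gauss_term p s t (p ^ N * c) k)
          = (norm p ^ N) ^ k * (norm (1 / qpoch p p k) * norm (1 / qpoch (p ^ N * c) p k)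
            * norm (rpoch s p k * rpoch t p k * c ^ k))"
        by (simp add: gauss_term_def norm_mult norm_divide norm_power power_mult_distrib)
      also have "\<dots> \<le> (norm p ^ N) ^ k * (B1 * (B2 * B3) * norm (rpoch s p k * rpoch t p k * c ^ k))"
        by (intro mult_left_mono mult_right_mono mult_mono B1 b) (use B1 in auto)
      finally show ?thesis .
    qed
    have "eventually (\<lambda>N. summable (\<lambda>k. norm (gauss_term p s t (p ^ N * c) k))) sequentially \<and>
        summable (\<lambda>k. norm (if k = 0 then 1 else (0::complex))) \<and>
        (\<lambda>N. \<Sum>k. gauss_term p s t (p ^ N * c) k) \<longlonglongrightarrow> (\<Sum>k. if k = 0 then 1 else 0)"
    proof (rule tannerys_theorem[where M = "\<lambda>k. B1 * (B2 * B3) * norm (rpoch s p k * rpoch t p k * c ^ k)"])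
      show "(\<lambda>N. gauss_term p s t (p ^ N * c) k) \<longlonglongrightarrow> (if k = 0 then 1 else 0)" for k
      proof (cases k)
        case (Suc m)
        have pk: "norm (p ^ k) < 1"
          using p Suc power_Suc_less_one[of "norm p" m]
          by (cases "p = 0") (simp_all add: norm_mult norm_power)
        have "(\<lambda>N. gauss_term p s t (p ^ N * c) k) \<longlonglongrightarrow> 0"
        proof (rule Lim_null_comparison)
          show "eventually (\<lambda>N. norm (gauss_term p s t (p ^ N * c) k) \<le>
            norm (p ^ k) ^ N * (B1 * (B2 * B3) * norm (rpoch s p k * rpoch t p k * c ^ k))) sequentially"
            using key by (simp add: norm_power power_mult[symmetric] mult.commute)
          show "(\<lambda>N. norm (p ^ k) ^ N * (B1 * (B2 * B3) * norm (rpoch s p k * rpoch t p k * c ^ k))) \<longlonglongrightarrow> 0"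
            by (intro tendsto_mult_left_zero LIMSEQ_power_zero) (use pk in simp)
        qed
        thus ?thesis using Suc by simp
      qed (simp add: gauss_term_def)
      show "summable (\<lambda>k. B1 * (B2 * B3) * norm (rpoch s p k * rpoch t p k * c ^ k))"
        by (intro summable_mult rpoch_summable p c)
      have "norm (gauss_term p s t (p ^ N * c) k)
          \<le> B1 * (B2 * B3) * norm (rpoch s p k * rpoch t p k * c ^ k)" for k N
      proof -
        have "(norm p ^ N) ^ k * (B1 * (B2 * B3) * norm (rpoch s p k * rpoch t p k * c ^ k))
           \<le> 1 * (B1 * (B2 * B3) * norm (rpoch s p k * rpoch t p k * c ^ k))"
          using p B1 B2 B3 by (intro mult_right_mono power_le_one) auto
        thus ?thesis using key[of N k] by simp
      qed
      thus "eventually (\<lambda>(k, N). norm (gauss_term p s t (p ^ N * c) k)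
          \<le> B1 * (B2 * B3) * norm (rpoch s p k * rpoch t p k * c ^ k)) (sequentially \<times>\<^sub>F sequentially)"
        by (auto intro: always_eventually)
    qed simp
    thus ?thesis unfolding G_def by blast
  qed
  moreover have "(\<Sum>k. if k = 0 then 1 else (0::complex)) = 1"
    using sums_unique[OF sums_single[of 0 "\<lambda>_. 1 :: complex"]] by simp
  ultimately have "G \<longlonglongrightarrow> 1" by simp
  hence "(\<lambda>N. qpoch (c * s) p N * qpoch (c * t) p N * G N) \<longlonglongrightarrow> qpinf (c * s) p * qpinf (c * t) p * 1"
    by (intro tendsto_mult qpoch_tendsto p)
  moreover have "(\<lambda>N. qpoch c p N * qpoch (c * s * t) p N * G 0) \<longlonglongrightarrow> qpinf c p * qpinf (c * s * t) p * G 0"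
    by (intro tendsto_mult qpoch_tendsto p tendsto_const)
  ultimately have "qpinf c p * qpinf (c * s * t) p * G 0 = qpinf (c * s) p * qpinf (c * t) p"
    unfolding iter using LIMSEQ_unique by fastforce
  moreover have "qpinf c p \<noteq> 0" "qpinf (c * s * t) p \<noteq> 0"
    using qpinf_nonzero[OF p nz] qpinf_nonzero[OF p power_mult_neq_1[OF p c]] by auto
  ultimately show ?thesis
    unfolding G_def by (simp add: field_simps)
qed

section \<open>Double series\<close>

lemma summable_on_Times_bound:
  fixes f :: "'a \<times> 'b \<Rightarrow> complex" and g :: "'a \<Rightarrow> real" and h :: "'b \<Rightarrow> real"
  assumes g: "g summable_on UNIV" and h: "h summable_on UNIV"
    and nonneg: "\<And>x. g x \<ge> 0" "\<And>y. h y \<ge> 0"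
    and le: "\<And>x y. norm (f (x, y)) \<le> g x * h y"
  shows "f summable_on UNIV"
proof -
  have "(\<lambda>(x, y). g x * h y) summable_on Sigma UNIV (\<lambda>_. UNIV)"
  proof (rule summable_on_SigmaI)
    show "((\<lambda>y. case (x, y) of (x, y) \<Rightarrow> g x * h y) has_sum g x * infsum h UNIV) UNIV" for x
      using has_sum_cmult_right[OF has_sum_infsum[OF h]] by simp
    show "(\<lambda>x. g x * infsum h UNIV) summable_on UNIV"
      by (rule summable_on_cmult_left[OF g])
  qed (use nonneg in auto)
  hence "(\<lambda>xy. g (fst xy) * h (snd xy)) summable_on UNIV"
    by (simp add: case_prod_unfold)
  hence "(\<lambda>x. norm (f x)) summable_on UNIV"
    by (rule Infinite_Sum.abs_summable_on_comparison_test') (use le in auto)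
  thus ?thesis by (simp add: summable_on_iff_abs_summable_on_complex)
qed

lemma double_has_sum:
  fixes f :: "'a \<times> 'b \<Rightarrow> complex"
  assumes f: "f summable_on UNIV"
    and g: "\<And>x. ((\<lambda>y. f (x, y)) has_sum g x) UNIV"
    and h: "\<And>y. ((\<lambda>x. f (x, y)) has_sum h y) UNIV"
  obtains S where "(g has_sum S) UNIV" "(h has_sum S) UNIV"
proof -
  have S: "(f has_sum infsum f UNIV) (UNIV \<times> UNIV)"
    using has_sum_infsum[OF f] by simp
  have "(g has_sum infsum f UNIV) UNIV"
    by (rule has_sum_SigmaD[OF S]) (use g in simp)
  moreover have "(h has_sum infsum f UNIV) UNIV"
    by (rule has_sum_SigmaD[OF has_sum_swap[THEN iffD1, OF S]]) (use h in simp)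
  ultimately show ?thesis by (rule that)
qed

lemma summable_on_row:
  fixes f :: "'a \<times> 'b \<Rightarrow> complex"
  assumes "f summable_on UNIV"
  shows "(\<lambda>y. f (x, y)) summable_on UNIV"
  using summable_on_SigmaD1[of "\<lambda>x y. f (x, y)" UNIV "\<lambda>_. UNIV" x] assms by simp

lemma summable_on_column:
  fixes f :: "'a \<times> 'b \<Rightarrow> complex"
  assumes "f summable_on UNIV"
  shows "(\<lambda>x. f (x, y)) summable_on UNIV"
proof -
  have "(\<lambda>(y, x). f (x, y)) summable_on UNIV"
    using summable_on_swap[of f UNIV UNIV] assms by simp
  from summable_on_row[OF this, of y] show ?thesis by simp
qed

lemma sums_imp_has_sum:
  fixes f :: "nat \<Rightarrow> complex"
  assumes "f summable_on UNIV" "f sums S"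
  shows "(f has_sum S) UNIV"
proof -
  have "(f has_sum infsum f UNIV) UNIV" by (rule has_sum_infsum[OF assms(1)])
  moreover from has_sum_imp_sums[OF this] have "infsum f UNIV = S"
    using assms(2) by (rule sums_unique2)
  ultimately show ?thesis by simp
qed

section \<open>The Bailey lemma\<close>

text \<open>Bailey's lemma for a pair relative to $a=c/p$: the double series is summed first over \<open>n\<close>
  by the q-Gauss sum.  The two parameters $1/s$, $1/t$ of the lemma enter through \<open>s\<close> and \<open>t\<close>,
  so that the confluent cases are $s=0$ and $t=0$.\<close>

theorem bailey_lemma:
  fixes \<alpha> \<beta> :: "nat \<Rightarrow> complex"
  assumes p0: "p \<noteq> 0" and p: "norm p < 1" and cst: "norm (c * s * t) < 1"
    and nzc: "\<And>i. p ^ i * c \<noteq> 1" and nzs: "\<And>i. p ^ i * (c * s) \<noteq> 1" and nzt: "\<And>i. p ^ i * (c * t) \<noteq> 1"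
    and pair: "\<And>n. \<beta> n = (\<Sum>r\<le>n. \<alpha> r / (qpoch p p (n - r) * qpoch c p (n + r)))"
    and \<alpha>: "summable (\<lambda>r. norm (\<alpha> r))"
  shows "(\<lambda>n. rpoch s p n * rpoch t p n * c ^ n * \<beta> n) sums
     (qpinf (c * s) p * qpinf (c * t) p / (qpinf c p * qpinf (c * s * t) p) *
     (\<Sum>r. rpoch s p r * rpoch t p r * c ^ r / (qpoch (c * s) p r * qpoch (c * t) p r) * \<alpha> r))"
    and "summable (\<lambda>r. rpoch s p r * rpoch t p r * c ^ r / (qpoch (c * s) p r * qpoch (c * t) p r) * \<alpha> r)"
proof -
  define K where "K = qpinf (c * s) p * qpinf (c * t) p / (qpinf c p * qpinf (c * s * t) p)"
  define \<delta> where "\<delta> n = rpoch s p n * rpoch t p n * c ^ n" for n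
  define f where "f = (\<lambda>(n, r). if r \<le> n
     then \<delta> n * (\<alpha> r / (qpoch p p (n - r) * qpoch c p (n + r))) else 0)"
  define \<gamma> where "\<gamma> r = K * (\<delta> r / (qpoch (c * s) p r * qpoch (c * t) p r) * \<alpha> r)" for r
  obtain B1 where B1: "B1 > 0" "\<And>n. norm (1 / qpoch p p n) \<le> B1"
    using qpoch_inverse_bounded[OF p power_mult_neq_1[OF p p]] by blast
  obtain B2 where B2: "B2 > 0" "\<And>n. norm (1 / qpoch c p n) \<le> B2"
    using qpoch_inverse_bounded[OF p nzc] by blast
  have f: "f summable_on UNIV"
  proof (rule summable_on_Times_bound)
    show "(\<lambda>n. norm (\<delta> n)) summable_on UNIV"
      unfolding \<delta>_def using rpoch_summable[OF p cst] by (intro norm_summable_imp_summable_on) simp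
    show "(\<lambda>r. B1 * B2 * norm (\<alpha> r)) summable_on UNIV"
      using \<alpha> by (intro summable_on_cmult_right norm_summable_imp_summable_on) simp
    show "norm (f (n, r)) \<le> norm (\<delta> n) * (B1 * B2 * norm (\<alpha> r))" for n r
    proof (cases "r \<le> n")
      case True
      have "norm (f (n, r)) = norm (\<delta> n) *
          (norm (1 / qpoch p p (n - r)) * norm (1 / qpoch c p (n + r)) * norm (\<alpha> r))"
        using True by (simp add: f_def norm_mult norm_divide)
      also have "\<dots> \<le> norm (\<delta> n) * (B1 * B2 * norm (\<alpha> r))"
        by (intro mult_left_mono mult_right_mono mult_mono B1 B2) (use B1 in auto)
      finally show ?thesis .
    qed (use B1 B2 in \<open>simp add: f_def\<close>)
  qed (use B1 B2 in auto)
  have row: "((\<lambda>r. f (n, r)) has_sum \<delta> n * \<beta> n) UNIV" for n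
  proof -
    have "((\<lambda>r. f (n, r)) has_sum (\<Sum>r\<le>n. f (n, r))) UNIV"
      by (rule has_sum_finite_neutralI[where B = "{..n}"]) (auto simp: f_def)
    also have "(\<Sum>r\<le>n. f (n, r)) = \<delta> n * \<beta> n"
      unfolding pair sum_distrib_left by (intro sum.cong) (auto simp: f_def)
    finally show ?thesis .
  qed
  have col: "((\<lambda>n. f (n, r)) has_sum \<gamma> r) UNIV" for r
  proof (rule sums_imp_has_sum[OF summable_on_column[OF f]])
    define c' s' t' where "c' = p ^ (2 * r) * c" and "s' = s / p ^ r" and "t' = t / p ^ r"
    have cs': "c' * s' = p ^ r * (c * s)" and ct': "c' * t' = p ^ r * (c * t)"
      and cst': "c' * s' * t' = c * s * t"
      using p0 by (simp_all add: c'_def s'_def t'_def mult_2 power_add)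
    have nzc': "p ^ i * c' \<noteq> 1" for i
      using nzc[of "i + 2 * r"] by (simp add: c'_def power_add mult.assoc)
    have cst1: "norm (c' * s' * t') < 1" using cst cst' by simp
    have nz: "qpoch c p (2 * r) \<noteq> 0" "qpoch (c * s) p r \<noteq> 0" "qpoch (c * t) p r \<noteq> 0"
      using nzc nzs nzt by (auto simp: qpoch_eq_0_iff)
    have shift: "f (k + r, r) = \<delta> r / qpoch c p (2 * r) * \<alpha> r * gauss_term p s' t' c' k" for k
    proof -
      have a: "qpoch c p (r + k + r) = qpoch c p (2 * r) * qpoch c' p k"
        using qpoch_add[of c p "2 * r" k] by (simp add: c'_def mult_2 add_ac)
      have b: "c ^ (r + k) = c ^ r * c ^ k" "c' ^ k = (p ^ (r * k)) ^ 2 * c ^ k"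
        by (simp_all add: power_add c'_def power_mult_distrib power_mult[symmetric] mult_ac)
      have "f (r + k, r) = \<delta> r / qpoch c p (2 * r) * \<alpha> r * gauss_term p s' t' c' k"
        unfolding f_def gauss_term_def \<delta>_def using b a
        by (simp add: rpoch_add[OF p0] s'_def[symmetric] t'_def[symmetric] power2_eq_square mult_ac)
      thus ?thesis by (simp add: add.commute)
    qed
    have "gauss_term p s' t' c' sums
        (qpinf (c' * s') p * qpinf (c' * t') p / (qpinf c' p * qpinf (c' * s' * t') p))"
      using q_gauss[OF p cst1 nzc'] summable_norm_cancel[OF gauss_term_summable[OF p cst1 nzc']]
      by (metis summable_sums)
    hence "(\<lambda>k. f (k + r, r)) sums (\<delta> r / qpoch c p (2 * r) * \<alpha> r *
        (qpinf (c' * s') p * qpinf (c' * t') p / (qpinf c' p * qpinf (c' * s' * t') p)))"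
      unfolding shift by (intro sums_mult)
    also have "\<delta> r / qpoch c p (2 * r) * \<alpha> r *
        (qpinf (c' * s') p * qpinf (c' * t') p / (qpinf c' p * qpinf (c' * s' * t') p)) = \<gamma> r"
    proof -
      have e: "qpinf (c * s) p = qpoch (c * s) p r * qpinf (c' * s') p"
        "qpinf (c * t) p = qpoch (c * t) p r * qpinf (c' * t') p"
        "qpinf c p = qpoch c p (2 * r) * qpinf c' p"
        unfolding cs' ct' unfolding c'_def by (rule qpoch_mult_qpinf[OF p, symmetric])+
      show ?thesis
        unfolding \<gamma>_def K_def e cst' using nz by simp
    qed
    finally have "(\<lambda>k. f (k + r, r)) sums \<gamma> r" .
    thus "(\<lambda>n. f (n, r)) sums \<gamma> r"
      by (subst (asm) sums_zero_iff_shift) (auto simp: f_def)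
  qed
  obtain S where S: "((\<lambda>n. \<delta> n * \<beta> n) has_sum S) UNIV" "(\<gamma> has_sum S) UNIV"
    using double_has_sum[OF f row col] .
  have K: "K \<noteq> 0"
    unfolding K_def using qpinf_nonzero[OF p nzc] qpinf_nonzero[OF p nzs] qpinf_nonzero[OF p nzt]
      qpinf_nonzero[OF p power_mult_neq_1[OF p cst]] by simp
  have \<gamma>: "\<gamma> sums S" using S(2) by (rule has_sum_imp_sums)
  define A where "A r = \<delta> r / (qpoch (c * s) p r * qpoch (c * t) p r) * \<alpha> r" for r
  have \<gamma>A: "\<gamma> = (\<lambda>r. K * A r)" by (simp add: \<gamma>_def A_def fun_eq_iff)
  have sm: "summable A"
    using sums_summable[OF \<gamma>] unfolding \<gamma>A by (rule summable_mult_D[OF _ K])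
  thus "summable (\<lambda>r. rpoch s p r * rpoch t p r * c ^ r / (qpoch (c * s) p r * qpoch (c * t) p r) * \<alpha> r)"
    unfolding A_def \<delta>_def .
  have "S = K * suminf A"
    using sums_unique[OF \<gamma>] suminf_mult[OF sm, of K] unfolding \<gamma>A by simp
  with has_sum_imp_sums[OF S(1)] have "(\<lambda>n. \<delta> n * \<beta> n) sums (K * suminf A)" by simp
  thus "(\<lambda>n. rpoch s p n * rpoch t p n * c ^ n * \<beta> n) sums
     (qpinf (c * s) p * qpinf (c * t) p / (qpinf c p * qpinf (c * s * t) p) *
     (\<Sum>r. rpoch s p r * rpoch t p r * c ^ r / (qpoch (c * s) p r * qpoch (c * t) p r) * \<alpha> r))"
    unfolding \<delta>_def K_def A_def .
qed

section \<open>Finite partial fractions\<close>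

lemma partial_fractions_coeff:
  fixes X v A B u w :: complex
  assumes "1 - u \<noteq> 0" "1 - v \<noteq> 0"
  shows "- X * v / (A * (1 - v) * B) - u * v * (X / (A * (B * (1 - u))))
            = (1 - u * v) * (- X * v / (A * (1 - v) * (B * (1 - u))))"
    and "- X * v / w / (A * (1 - v) * B) - 1 / w * (X / (A * (B * (1 - u))))
            = (1 - u * v) * (- X / w / (A * (1 - v) * (B * (1 - u))))"
proof -
  have 1: "1 / (1 - v) + u / (1 - u) = (1 - u * v) / ((1 - v) * (1 - u))"
    using assms by (simp add: add_frac_eq algebra_simps)
  have 2: "v / (1 - v) + 1 / (1 - u) = (1 - u * v) / ((1 - v) * (1 - u))"
    using assms by (simp add: add_frac_eq algebra_simps)
  have "- X * v / (A * (1 - v) * B) - u * v * (X / (A * (B * (1 - u))))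
      = - (X * v / (A * B)) * (1 / (1 - v) + u / (1 - u))"
    by (simp add: distrib_left mult_ac)
  thus "- X * v / (A * (1 - v) * B) - u * v * (X / (A * (B * (1 - u))))
            = (1 - u * v) * (- X * v / (A * (1 - v) * (B * (1 - u))))"
    unfolding 1 by (simp add: mult_ac)
  have "- X * v / w / (A * (1 - v) * B) - 1 / w * (X / (A * (B * (1 - u))))
      = - (X / (A * B * w)) * (v / (1 - v) + 1 / (1 - u))"
    by (simp add: distrib_left mult_ac)
  thus "- X * v / w / (A * (1 - v) * B) - 1 / w * (X / (A * (B * (1 - u))))
            = (1 - u * v) * (- X / w / (A * (1 - v) * (B * (1 - u))))"
    unfolding 2 by (simp add: mult_ac)
qed

text \<open>Put $p=q^2$, so that $q^{r(r+1)-2jr}=p^{r(r+1)/2-jr}$.  The induction on \<open>N\<close> rests on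
  $(1-p^{N+1})/(x;p)_{N+2}=1/(x;p)_{N+1}-p^{N+1}/(px;p)_{N+1}$ for $j=0$ and on
  $(1-p^{N+1})x/(x;p)_{N+2}=1/(x;p)_{N+1}-1/(px;p)_{N+1}$ for $j>0$.\<close>

lemma partial_fractions_finite:
  fixes q x :: complex
  assumes q0: "q \<noteq> 0" and q: "norm q < 1" and nz: "\<And>i. q ^ (2 * i) * x \<noteq> 1" and j: "j \<le> N"
  shows "x ^ j / qpoch x (q\<^sup>2) (Suc N) = (\<Sum>r\<le>N. (- 1) ^ r * q powi (int r * (int r + 1) - 2 * int j * int r) /
     ((1 - q ^ (2 * r) * x) * (qpoch (q\<^sup>2) (q\<^sup>2) r * qpoch (q\<^sup>2) (q\<^sup>2) (N - r))))"
  using nz j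
proof (induction N arbitrary: x j)
  case 0
  thus ?case by (simp add: qpoch_Suc)
next
  case (Suc N x j)
  define P where "P = qpoch (q\<^sup>2) (q\<^sup>2)"
  define a where "a N j r = (if r \<le> N then (- 1) ^ r * q powi (int r * (int r + 1) - 2 * int j * int r)
      / (P r * P (N - r)) else 0)" for N j r
  have q2: "norm (q\<^sup>2) < 1" using q by (simp add: norm_power power_less_one_iff)
  have pnz: "1 - (q\<^sup>2) ^ i * q\<^sup>2 \<noteq> 0" for i using power_mult_neq_1[OF q2 q2, of i] by simp
  have Pnz: "P r \<noteq> 0" for r using power_mult_neq_1[OF q2 q2] by (auto simp: P_def qpoch_eq_0_iff)
  have PSuc: "P (Suc r) = P r * (1 - q ^ (2 * Suc r))" for r
    by (simp add: P_def qpoch_Suc power_mult[symmetric] power_add[symmetric])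
  have xnz: "1 - q ^ (2 * i) * x \<noteq> 0" for i using Suc.prems(1)[of i] by simp
  have nz': "q ^ (2 * i) * (q\<^sup>2 * x) \<noteq> 1" for i
    using Suc.prems(1)[of "Suc i"] by (simp add: power2_eq_square mult_ac)
  have IH1: "x ^ j / qpoch x (q\<^sup>2) (Suc N) = (\<Sum>r\<le>Suc N. a N j r / (1 - q ^ (2 * r) * x))" if "j \<le> N" for j
    unfolding Suc.IH[OF Suc.prems(1) that] by (simp add: a_def P_def mult_ac)
  have IH2: "(q\<^sup>2 * x) ^ j / qpoch (q\<^sup>2 * x) (q\<^sup>2) (Suc N)
      = (\<Sum>r\<le>Suc N. (if r = 0 then 0 else a N j (r - 1)) / (1 - q ^ (2 * r) * x))" if "j \<le> N" for j
    unfolding Suc.IH[OF nz' that] sum.atMost_Suc_shift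
    by (simp add: a_def P_def mult_ac power2_eq_square)
  define E where "E r j = q powi (int r * (int r + 1) - 2 * int j * int r)" for r j :: nat
  have a_E: "a N j r = (if r \<le> N then (- 1) ^ r * E r j / (P r * P (N - r)) else 0)" for N j r
    by (simp add: a_def E_def)
  have E0: "E 0 i = 1" for i by (simp add: E_def)
  have E1: "E (Suc s) i = E s i * q ^ (2 * Suc s) / q ^ (2 * i)" for s i
  proof -
    have "E (Suc s) i = q powi ((int s * (int s + 1) - 2 * int i * int s) + int (2 * Suc s) - int (2 * i))"
      unfolding E_def by (intro arg_cong[where f = "\<lambda>k. q powi k"]) (simp add: algebra_simps)
    thus ?thesis using q0 by (simp add: E_def power_int_add power_int_diff del: of_nat_mult of_nat_Suc)
  qed
  have E2: "E r (Suc i) = E r i / q ^ (2 * r)" for r i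
  proof -
    have "E r (Suc i) = q powi ((int r * (int r + 1) - 2 * int i * int r) - int (2 * r))"
      unfolding E_def by (intro arg_cong[where f = "\<lambda>k. q powi k"]) (simp add: algebra_simps)
    thus ?thesis using q0 by (simp add: E_def power_int_diff del: of_nat_mult)
  qed
  have vnz: "1 - q ^ (2 * Suc i) \<noteq> 0" for i
    using pnz[of i] by (simp add: power_mult[symmetric] power_add[symmetric])
  have exps: "q ^ (2 * Suc (s + m + 1)) = q ^ (2 * Suc m) * q ^ (2 * Suc s)" for s m
    by (simp add: power_add[symmetric] add_ac)
  have neg: "(- 1) ^ Suc n = - ((- 1) ^ n :: complex)" for n by simp
  have cases: thesis if "r = 0 \<Longrightarrow> thesis" "r = Suc N \<Longrightarrow> thesis"
    "\<And>s m. \<lbrakk>r = Suc s; N = s + m + 1\<rbrakk> \<Longrightarrow> thesis" "r \<le> Suc N" for r thesis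
  proof (cases r)
    case 0 thus ?thesis by (rule that(1))
  next
    case (Suc s)
    show ?thesis
    proof (cases "s = N")
      case True thus ?thesis using Suc that(2) by blast
    next
      case False
      hence "N = s + (N - s - 1) + 1" using Suc that(4) by simp
      with Suc show ?thesis by (rule that(3))
    qed
  qed
  define D where "D = qpoch x (q\<^sup>2) (Suc (Suc N))"
  have Dnz: "qpoch x (q\<^sup>2) n \<noteq> 0" "qpoch (q\<^sup>2 * x) (q\<^sup>2) n \<noteq> 0" for n
    using Suc.prems(1) nz' by (auto simp: qpoch_eq_0_iff power_mult[symmetric])
  have D1: "1 / qpoch x (q\<^sup>2) (Suc N) = (1 - q ^ (2 * Suc N) * x) / D"
    unfolding D_def qpoch_Suc[of x "q\<^sup>2" "Suc N"] power_mult[symmetric] using Dnz xnz[of "Suc N"]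
    by (simp del: power_Suc mult_Suc_right)
  have D2: "1 / qpoch (q\<^sup>2 * x) (q\<^sup>2) (Suc N) = (1 - x) / D"
    unfolding D_def qpoch_Suc_shift[of x "q\<^sup>2" "Suc N"] using Dnz xnz[of 0] by simp
  have rec: "(1 - q ^ (2 * Suc N)) * x ^ j / D
      = (\<Sum>r\<le>Suc N. (1 - q ^ (2 * Suc N)) * a (Suc N) j r / (1 - q ^ (2 * r) * x))"
  proof (cases j)
    case 0
    have "(1 - q ^ (2 * Suc N)) * x ^ j / D = x ^ 0 / qpoch x (q\<^sup>2) (Suc N)
        - q ^ (2 * Suc N) * ((q\<^sup>2 * x) ^ 0 / qpoch (q\<^sup>2 * x) (q\<^sup>2) (Suc N))"
      using D1 D2 0 by (simp add: diff_divide_distrib[symmetric] algebra_simps)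
    also have "\<dots> = (\<Sum>r\<le>Suc N. (a N 0 r - q ^ (2 * Suc N) * (if r = 0 then 0 else a N 0 (r - 1)))
        / (1 - q ^ (2 * r) * x))"
      unfolding IH1[OF le0] IH2[OF le0] sum_distrib_left sum_subtractf[symmetric]
      by (intro sum.cong refl) (simp add: diff_divide_distrib)
    also have "\<dots> = (\<Sum>r\<le>Suc N. (1 - q ^ (2 * Suc N)) * a (Suc N) j r / (1 - q ^ (2 * r) * x))"
    proof (intro sum.cong refl arg_cong2[where f = divide])
      fix r assume r: "r \<in> {..Suc N}"
      show "a N 0 r - q ^ (2 * Suc N) * (if r = 0 then 0 else a N 0 (r - 1))
          = (1 - q ^ (2 * Suc N)) * a (Suc N) j r"
      proof (rule cases[of r])
        assume r: "r = 0"
        show ?thesis using vnz[of N] Pnz[of N] Pnz[of 0] by (simp add: r a_E E0 PSuc neg del: power_Suc mult_Suc_right)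
      next
        assume r: "r = Suc N"
        show ?thesis using vnz[of N] Pnz[of N] Pnz[of 0]
          by (simp add: r a_E E1 PSuc 0 neg del: power_Suc mult_Suc_right)
      next
        fix s m assume r: "r = Suc s" and N: "N = s + m + 1"
        have h1: "a N 0 r = - ((-1) ^ s * E s 0) * q ^ (2 * Suc s) / (P s * (1 - q ^ (2 * Suc s)) * P m)"
          unfolding N r by (simp add: a_E E1 PSuc neg del: power_Suc mult_Suc_right)
        have h2: "(if r = 0 then 0 else a N 0 (r - 1)) = ((-1) ^ s * E s 0) / (P s * (P m * (1 - q ^ (2 * Suc m))))"
          unfolding N r by (simp add: a_E PSuc neg del: power_Suc mult_Suc_right)
        have h3: "a (Suc N) j r = - ((-1) ^ s * E s 0) * q ^ (2 * Suc s) /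
            (P s * (1 - q ^ (2 * Suc s)) * (P m * (1 - q ^ (2 * Suc m))))"
          unfolding N r 0 by (simp add: a_E E1 PSuc neg del: power_Suc mult_Suc_right)
        have h4: "q ^ (2 * Suc N) = q ^ (2 * Suc m) * q ^ (2 * Suc s)"
          unfolding N by (rule exps)
        show ?thesis unfolding h1 h2 h3 h4 power_mult[symmetric]
          by (rule partial_fractions_coeff(1)[OF vnz vnz])
      qed (use r in simp)
    qed
    finally show ?thesis .
  next
    case (Suc i)
    have iN: "i \<le> N" using Suc Suc.prems by simp
    have "(1 - q ^ (2 * Suc N)) * x ^ j / D = x ^ i / qpoch x (q\<^sup>2) (Suc N)
        - 1 / (q\<^sup>2) ^ i * ((q\<^sup>2 * x) ^ i / qpoch (q\<^sup>2 * x) (q\<^sup>2) (Suc N))"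
    proof -
      have "x ^ i / qpoch x (q\<^sup>2) (Suc N) - 1 / (q\<^sup>2) ^ i * ((q\<^sup>2 * x) ^ i / qpoch (q\<^sup>2 * x) (q\<^sup>2) (Suc N))
          = x ^ i * (1 / qpoch x (q\<^sup>2) (Suc N)) - x ^ i * (1 / qpoch (q\<^sup>2 * x) (q\<^sup>2) (Suc N))"
        using q0 by (simp add: power_mult_distrib)
      also have "\<dots> = (1 - q ^ (2 * Suc N)) * x ^ j / D"
        unfolding D1 D2 Suc by (simp add: diff_divide_distrib[symmetric] algebra_simps)
      finally show ?thesis by simp
    qed
    also have "\<dots> = (\<Sum>r\<le>Suc N. (a N i r - 1 / (q\<^sup>2) ^ i * (if r = 0 then 0 else a N i (r - 1)))
        / (1 - q ^ (2 * r) * x))"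
      unfolding IH1[OF iN] IH2[OF iN] sum_distrib_left sum_subtractf[symmetric]
      by (intro sum.cong refl) (simp add: diff_divide_distrib)
    also have "\<dots> = (\<Sum>r\<le>Suc N. (1 - q ^ (2 * Suc N)) * a (Suc N) j r / (1 - q ^ (2 * r) * x))"
    proof (intro sum.cong refl arg_cong2[where f = divide])
      fix r assume r: "r \<in> {..Suc N}"
      show "a N i r - 1 / (q\<^sup>2) ^ i * (if r = 0 then 0 else a N i (r - 1))
          = (1 - q ^ (2 * Suc N)) * a (Suc N) j r"
      proof (rule cases[of r])
        assume r: "r = 0"
        show ?thesis using vnz[of N] Pnz[of N] Pnz[of 0] by (simp add: r a_E E0 PSuc neg del: power_Suc mult_Suc_right)
      next
        assume r: "r = Suc N"
        show ?thesis using vnz[of N] Pnz[of N] Pnz[of 0] q0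
          by (simp add: r a_E E1 E2 PSuc Suc neg power_mult[symmetric] del: power_Suc mult_Suc_right)
      next
        fix s m assume r: "r = Suc s" and N: "N = s + m + 1"
        have h1: "a N i r = - ((-1) ^ s * E s i) * q ^ (2 * Suc s) / q ^ (2 * i) / (P s * (1 - q ^ (2 * Suc s)) * P m)"
          unfolding N r by (simp add: a_E E1 PSuc neg del: power_Suc mult_Suc_right)
        have h2: "(if r = 0 then 0 else a N i (r - 1)) = ((-1) ^ s * E s i) / (P s * (P m * (1 - q ^ (2 * Suc m))))"
          unfolding N r by (simp add: a_E PSuc neg del: power_Suc mult_Suc_right)
        have h3: "a (Suc N) j r = - ((-1) ^ s * E s i) / q ^ (2 * i) /
            (P s * (1 - q ^ (2 * Suc s)) * (P m * (1 - q ^ (2 * Suc m))))"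
          unfolding N r Suc using q0 by (simp add: a_E E1 E2 PSuc neg del: power_Suc mult_Suc_right)
        have h4: "q ^ (2 * Suc N) = q ^ (2 * Suc m) * q ^ (2 * Suc s)"
          unfolding N by (rule exps)
        show ?thesis unfolding h1 h2 h3 h4 power_mult[symmetric]
          by (rule partial_fractions_coeff(2)[OF vnz vnz])
      qed (use r in simp)
    qed
    finally show ?thesis .
  qed
  have "1 - q ^ (2 * Suc N) \<noteq> 0"
    by (rule vnz)
  moreover have "(1 - q ^ (2 * Suc N)) * (x ^ j / D)
      = (1 - q ^ (2 * Suc N)) * (\<Sum>r\<le>Suc N. a (Suc N) j r / (1 - q ^ (2 * r) * x))"
    using rec unfolding sum_distrib_left times_divide_eq_right .
  ultimately have "x ^ j / D = (\<Sum>r\<le>Suc N. a (Suc N) j r / (1 - q ^ (2 * r) * x))"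
    unfolding mult_cancel_left by blast
  also have "\<dots> = (\<Sum>r\<le>Suc N. (- 1) ^ r * q powi (int r * (int r + 1) - 2 * int j * int r) /
     ((1 - q ^ (2 * r) * x) * (P r * P (Suc N - r))))"
    by (intro sum.cong refl) (simp add: a_def mult_ac)
  finally show ?case unfolding D_def P_def .
qed

lemma norm_power2_less_1: "norm (q\<^sup>2) < 1" if "norm q < 1" for q :: complex
  using that by (simp add: norm_power power_less_one_iff)

text \<open>Here $\sum_{i\le m}i=m(m+1)/2$, a form that avoids division of natural numbers.\<close>

lemma qpoch_shift_down:
  assumes "p \<noteq> 0" "x \<noteq> 0"
  shows "qpoch (x / p ^ m) p m * p ^ (\<Sum>i\<le>m. i) = (- x) ^ m * qpoch (p / x) p m"
proof (induction m)
  case (Suc m)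
  have "qpoch (x / p ^ Suc m) p (Suc m) * p ^ (\<Sum>i\<le>Suc m. i)
      = (1 - x / p ^ Suc m) * p ^ Suc m * (qpoch (x / p ^ m) p m * p ^ (\<Sum>i\<le>m. i))"
    using assms by (simp add: qpoch_Suc_shift power_add)
  also have "(1 - x / p ^ Suc m) * p ^ Suc m = - x * (1 - p ^ m * (p / x))"
    using assms by (simp add: field_simps)
  finally show ?case unfolding Suc by (simp add: qpoch_Suc mult_ac)
qed simp

lemma power_int_neq_1I:
  fixes q x :: complex
  assumes "\<And>i::int. q powi (2 * i) * x \<noteq> 1"
  shows "(q\<^sup>2) ^ i * x \<noteq> 1"
proof -
  have "q powi (2 * int i) = (q\<^sup>2) ^ i"
    by (metis (no_types) of_nat_mult of_nat_numeral power_int_of_nat power_mult)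
  thus ?thesis using assms[of "int i"] by simp
qed

text \<open>The index \<open>k\<close> of the sum stands for the bilateral index $s=k-m\in[-m,n]$.\<close>

lemma partial_fractions_bilateral:
  fixes q x :: complex
  assumes q0: "q \<noteq> 0" and q: "norm q < 1" and x0: "x \<noteq> 0"
    and nz: "\<And>i::int. q powi (2 * i) * x \<noteq> 1"
  shows "1 / (qpoch x (q\<^sup>2) (Suc n) * qpoch (q\<^sup>2 / x) (q\<^sup>2) m) =
    (\<Sum>k\<le>n + m. (- 1) ^ (k + m) * q powi ((int k - int m) * (int k - int m + 1)) /
      ((1 - q powi (2 * (int k - int m)) * x) * (qpoch (q\<^sup>2) (q\<^sup>2) k * qpoch (q\<^sup>2) (q\<^sup>2) (n + m - k))))"
proof -
  define y where "y = x / (q\<^sup>2) ^ m"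
  have qy: "q ^ (2 * i) * y = q powi (2 * (int i - int m)) * x" for i
  proof -
    have "q powi (2 * (int i - int m)) = q powi (int (2 * i) - int (2 * m))"
      by (simp add: right_diff_distrib)
    also have "\<dots> = q ^ (2 * i) / (q\<^sup>2) ^ m"
      using q0 by (subst power_int_diff) (simp_all add: power_mult[symmetric] del: of_nat_mult)
    finally show ?thesis by (simp add: y_def)
  qed
  have nzy: "q ^ (2 * i) * y \<noteq> 1" for i unfolding qy by (rule nz)
  have pf: "y ^ m / qpoch y (q\<^sup>2) (Suc (n + m)) = (\<Sum>r\<le>n + m. (- 1) ^ r * q powi (int r * (int r + 1) - 2 * int m * int r) /
     ((1 - q ^ (2 * r) * y) * (qpoch (q\<^sup>2) (q\<^sup>2) r * qpoch (q\<^sup>2) (q\<^sup>2) (n + m - r))))"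
    by (rule partial_fractions_finite[OF q0 q nzy]) simp
  have sum: "(\<Sum>i\<le>m. i) * 2 = m * (m + 1)" by (induction m) auto
  have "qpoch y (q\<^sup>2) (Suc (n + m)) = qpoch y (q\<^sup>2) m * qpoch x (q\<^sup>2) (Suc n)"
    using qpoch_add[of y "q\<^sup>2" m "Suc n"] q0 by (simp add: y_def add.commute)
  moreover have "qpoch y (q\<^sup>2) m * q ^ (m * (m + 1)) = (- x) ^ m * qpoch (q\<^sup>2 / x) (q\<^sup>2) m"
    using qpoch_shift_down[of "q\<^sup>2" x m] q0 x0 unfolding y_def power_mult[symmetric] sum[symmetric]
    by (simp add: mult.commute)
  ultimately have D: "qpoch y (q\<^sup>2) (Suc (n + m))
      = (- 1) ^ m * x ^ m * (qpoch x (q\<^sup>2) (Suc n) * qpoch (q\<^sup>2 / x) (q\<^sup>2) m) / q ^ (m * (m + 1))"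
    using q0 by (simp add: field_simps power_minus[of x])
  define c where "c = (- 1) ^ m * q ^ (m * (m + 1)) / q ^ (2 * m * m)"
  have c0: "c \<noteq> 0" using q0 by (simp add: c_def)
  have m1: "(- 1) ^ m * (- 1) ^ m = (1 :: complex)" by (simp add: power_add[symmetric])
  have "y ^ m = x ^ m / q ^ (2 * m * m)"
    by (simp add: y_def power_divide power_mult[symmetric] mult_ac)
  hence "y ^ m / qpoch y (q\<^sup>2) (Suc (n + m)) = c * (1 / (qpoch x (q\<^sup>2) (Suc n) * qpoch (q\<^sup>2 / x) (q\<^sup>2) m))"
    unfolding D c_def using x0 q0 m1 by (simp add: divide_simps)
  hence "1 / (qpoch x (q\<^sup>2) (Suc n) * qpoch (q\<^sup>2 / x) (q\<^sup>2) m) = 1 / c * (y ^ m / qpoch y (q\<^sup>2) (Suc (n + m)))"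
    using c0 by simp
  also have "\<dots> = (\<Sum>k\<le>n + m. (- 1) ^ (k + m) * q powi ((int k - int m) * (int k - int m + 1)) /
      ((1 - q powi (2 * (int k - int m)) * x) * (qpoch (q\<^sup>2) (q\<^sup>2) k * qpoch (q\<^sup>2) (q\<^sup>2) (n + m - k))))"
    unfolding pf sum_distrib_left
  proof (rule sum.cong[OF refl])
    fix k
    have "q powi ((int k - int m) * (int k - int m + 1))
      = q powi ((int k * (int k + 1) - 2 * int m * int k) + int (2 * m * m) - int (m * (m + 1)))"
      by (intro arg_cong[where f = "\<lambda>k. q powi k"]) (simp add: algebra_simps)
    also have "\<dots> = q powi (int k * (int k + 1) - 2 * int m * int k) * q ^ (2 * m * m) / q ^ (m * (m + 1))"
      using q0 by (simp add: power_int_add power_int_diff del: of_nat_add of_nat_mult)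
    finally have "(- 1) ^ (k + m) * q powi ((int k - int m) * (int k - int m + 1))
      = 1 / c * ((- 1) ^ k * q powi (int k * (int k + 1) - 2 * int m * int k))"
      unfolding c_def using q0 m1 by (simp add: power_add field_simps)
    thus "1 / c * ((- 1) ^ k * q powi (int k * (int k + 1) - 2 * int m * int k) /
        ((1 - q ^ (2 * k) * y) * (qpoch (q\<^sup>2) (q\<^sup>2) k * qpoch (q\<^sup>2) (q\<^sup>2) (n + m - k)))) =
      (- 1) ^ (k + m) * q powi ((int k - int m) * (int k - int m + 1)) /
        ((1 - q powi (2 * (int k - int m)) * x) * (qpoch (q\<^sup>2) (q\<^sup>2) k * qpoch (q\<^sup>2) (q\<^sup>2) (n + m - k)))"
      unfolding qy by simp
  qed
  finally show ?thesis .
qed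

text \<open>The two halves of the sum are counted outwards from the cut at \<open>a\<close>.\<close>

lemma sum_lessThan_add:
  fixes f :: "nat \<Rightarrow> 'a::comm_monoid_add"
  shows "(\<Sum>k<a + b. f k) = (\<Sum>k<a. f (a - Suc k)) + (\<Sum>k<b. f (a + k))"
proof -
  have "(\<Sum>k<a + b. f k) = (\<Sum>k<a. f k) + (\<Sum>k<b. f (a + k))"
    by (induction b) (simp_all add: add_ac)
  thus ?thesis by (simp only: sum.nat_diff_reindex)
qed

lemma one_minus_norm_le:
  fixes y :: complex
  assumes "norm y \<le> r" "r < 1"
  shows "norm (1 / (1 - y)) \<le> 1 / (1 - r)" "y \<noteq> 1"
proof -
  have "1 - r \<le> norm (1 - y)"
    using norm_triangle_ineq2[of 1 y] assms by simp
  moreover from this show "y \<noteq> 1" using assms(2) by auto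
  ultimately show "norm (1 / (1 - y)) \<le> 1 / (1 - r)"
    using assms by (simp add: norm_divide frac_le)
qed

lemma power_int_neq_1:
  fixes q :: complex
  assumes q0: "q \<noteq> 0" and q: "norm q < 1" and k: "k \<noteq> 0"
  shows "q powi k \<noteq> 1"
proof
  assume "q powi k = 1"
  hence 1: "norm q powi k = 1" by (metis norm_one norm_power_int)
  have "norm q > 0" using q0 by simp
  hence "norm q powi k < norm q powi 0 \<or> norm q powi k > norm q powi 0"
    using power_int_strict_decreasing[of 0 k "norm q"] power_int_strict_decreasing[of k 0 "norm q"] q k
    by linarith
  thus False using 1 by simp
qed

lemma minus_power_int_neq_1:
  fixes q :: complex
  assumes q0: "q \<noteq> 0" and q: "norm q < 1"
  shows "q powi (2 * k) * (- 1) \<noteq> 1"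
proof
  assume a: "q powi (2 * k) * (- 1) = 1"
  have "k \<noteq> 0" using a by auto
  hence "q powi (4 * k) \<noteq> 1" by (intro power_int_neq_1 assms) simp
  moreover have "q powi (4 * k) = (q powi (2 * k)) ^ 2"
    by (simp add: power_int_power')
  moreover have "q powi (2 * k) = -1" using a by (metis minus_minus mult_minus1_right)
  ultimately show False by simp
qed

section \<open>The Bailey pairs\<close>

text \<open>The case $x=q$, $m=n+1$ of the bilateral partial fractions, the poles at $s=r$ and $s=-r-1$ being
  combined.\<close>

lemma bailey_pair_odd:
  fixes q :: complex
  assumes q0: "q \<noteq> 0" and q: "norm q < 1"
  shows "1 / (qpoch q (q\<^sup>2) (Suc n))\<^sup>2 = (\<Sum>r\<le>n. (- 1) ^ r * q ^ (r * (r + 1)) * (1 + q ^ (2 * r + 1)) /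
     (1 - q ^ (2 * r + 1)) / (qpoch (q\<^sup>2) (q\<^sup>2) (n - r) * qpoch (q\<^sup>2) (q\<^sup>2) (Suc (n + r))))"
proof -
  define P where "P = qpoch (q\<^sup>2) (q\<^sup>2)"
  define f where "f k = (- 1) ^ (k + Suc n) * q powi ((int k - int (Suc n)) * (int k - int (Suc n) + 1)) /
      ((1 - q powi (2 * (int k - int (Suc n))) * q) * (P k * P (n + Suc n - k)))" for k
  have nz: "q powi (2 * i) * q \<noteq> 1" for i
  proof -
    have "q powi (2 * i) * q = q powi (2 * i + 1)" using q0 by (simp add: power_int_add)
    also have "\<dots> \<noteq> 1" by (rule power_int_neq_1[OF q0 q]) presburger
    finally show ?thesis .
  qed
  have "1 / (qpoch q (q\<^sup>2) (Suc n))\<^sup>2 = (\<Sum>k\<le>n + Suc n. f k)"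
    using partial_fractions_bilateral[OF q0 q q0 nz, of n "Suc n"] q0
    unfolding f_def P_def by (simp add: power2_eq_square del: sum.atMost_Suc)
  also have "{..n + Suc n} = {..<Suc n + Suc n}" by auto
  also have "sum f \<dots> = (\<Sum>r<Suc n. f (Suc n - Suc r)) + (\<Sum>r<Suc n. f (Suc n + r))"
    by (rule sum_lessThan_add)
  also have "\<dots> = (\<Sum>r\<le>n. f (n - r) + f (Suc n + r))"
    by (simp add: sum.distrib lessThan_Suc_atMost)
  also have "\<dots> = (\<Sum>r\<le>n. (- 1) ^ r * q ^ (r * (r + 1)) * (1 + q ^ (2 * r + 1)) /
     (1 - q ^ (2 * r + 1)) / (P (n - r) * P (Suc (n + r))))"
  proof (rule sum.cong[OF refl])
    fix r assume "r \<in> {..n}"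
    hence r: "r \<le> n" by simp
    define u where "u = q ^ (2 * r + 1)"
    have u: "1 - u \<noteq> 0" "u \<noteq> 0"
      unfolding u_def using power_int_neq_1[OF q0 q, of "int (2 * r + 1)"] q0
      by (simp_all add: power_int_of_nat[symmetric] del: power_int_of_nat)
    have e1: "(int (n - r) - int (Suc n)) * (int (n - r) - int (Suc n) + 1) = int (r * (r + 1))"
      "2 * (int (n - r) - int (Suc n)) = - int (2 * r + 1) - 1"
      using r by (simp_all add: of_nat_diff algebra_simps)
    have e2: "(int (Suc n + r) - int (Suc n)) * (int (Suc n + r) - int (Suc n) + 1) = int (r * (r + 1))"
      "2 * (int (Suc n + r) - int (Suc n)) = int (2 * r)"
      by (simp_all add: algebra_simps)
    have sg: "(- 1) ^ (n - r + Suc n) = - ((- 1) ^ r :: complex)" "(- 1) ^ (Suc n + r + Suc n) = ((- 1) ^ r :: complex)"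
      using r by (simp_all add: minus_one_power_iff)
    have i: "n + Suc n - (n - r) = Suc (n + r)" "n + Suc n - (Suc n + r) = n - r" using r by auto
    have iu: "q powi (- int (2 * r + 1) - 1) * q = 1 / u"
    proof -
      have "q powi (- int (2 * r + 1) - 1) * q = q powi (- int (2 * r + 1))"
        by (rule power_int_minus_mult) (use q0 in simp)
      thus ?thesis unfolding u_def power_int_minus_divide power_int_of_nat .
    qed
    have f1: "f (n - r) = - ((- 1) ^ r) * q ^ (r * (r + 1)) / ((1 - 1 / u) * (P (n - r) * P (Suc (n + r))))"
      unfolding f_def e1 sg i iu power_int_of_nat ..
    have f2: "f (Suc n + r) = (- 1) ^ r * q ^ (r * (r + 1)) / ((1 - u) * (P (n - r) * P (Suc (n + r))))"
      unfolding f_def e2 sg i power_int_of_nat by (simp add: u_def mult_ac)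
    have "- 1 / (1 - 1 / u) + 1 / (1 - u) = (1 + u) / (1 - u)"
      using u by (simp add: divide_simps) (simp add: algebra_simps)
    moreover define X where "X = (- 1) ^ r * q ^ (r * (r + 1))"
    define Y where "Y = P (n - r) * P (Suc (n + r))"
    have "f (n - r) = X / Y * (- 1 / (1 - 1 / u))" "f (Suc n + r) = X / Y * (1 / (1 - u))"
      unfolding f1 f2 Y_def[symmetric] X_def by (simp_all add: mult.commute)
    hence "f (n - r) + f (Suc n + r) = X / Y * (- 1 / (1 - 1 / u) + 1 / (1 - u))"
      unfolding distrib_left by simp
    ultimately show "f (n - r) + f (Suc n + r) = (- 1) ^ r * q ^ (r * (r + 1)) * (1 + q ^ (2 * r + 1)) /
     (1 - q ^ (2 * r + 1)) / (P (n - r) * P (Suc (n + r)))"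
      unfolding X_def[symmetric] Y_def[symmetric] u_def[symmetric] by simp
  qed
  finally show ?thesis unfolding P_def .
qed

text \<open>The case $x=-1$, $m=n$ of the bilateral partial fractions, the poles at $s=r$ and $s=-r$ being
  combined.\<close>

lemma bailey_pair_even:
  fixes q :: complex
  assumes q0: "q \<noteq> 0" and q: "norm q < 1"
  shows "1 / (qpoch (- (q\<^sup>2)) (q\<^sup>2) n)\<^sup>2 = (\<Sum>r\<le>n.
     (if r = 0 then 1 else 4 * (- 1) ^ r * q ^ (r * (r + 1)) / (1 + q ^ (2 * r))) /
     (qpoch (q\<^sup>2) (q\<^sup>2) (n - r) * qpoch (q\<^sup>2) (q\<^sup>2) (n + r)))"
proof -
  define P where "P = qpoch (q\<^sup>2) (q\<^sup>2)"
  define f where "f k = (- 1) ^ (k + n) * q powi ((int k - int n) * (int k - int n + 1)) /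
      ((1 - q powi (2 * (int k - int n)) * (- 1)) * (P k * P (n + n - k)))" for k
  have "1 / (2 * (qpoch (- (q\<^sup>2)) (q\<^sup>2) n)\<^sup>2) = (\<Sum>k\<le>n + n. f k)"
    using partial_fractions_bilateral[OF q0 q _ minus_power_int_neq_1[OF q0 q], of n n]
    unfolding f_def P_def qpoch_Suc_shift by (simp add: power2_eq_square mult.assoc)
  also have "{..n + n} = {..<n + Suc n}" by auto
  also have "sum f \<dots> = (\<Sum>r<n. f (n - Suc r)) + (\<Sum>r<Suc n. f (n + r))"
    by (rule sum_lessThan_add)
  also have "\<dots> = f n + (\<Sum>r<n. f (n - Suc r) + f (n + Suc r))"
    unfolding sum.lessThan_Suc_shift by (simp add: sum.distrib add_ac)
  also have "f n = 1 / 2 * (1 / (P n * P n))"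
    by (simp add: f_def)
  also have "(\<Sum>r<n. f (n - Suc r) + f (n + Suc r)) = (\<Sum>r<n. 1 / 2 * (4 * (- 1) ^ Suc r * q ^ (Suc r * (Suc r + 1)) /
      (1 + q ^ (2 * Suc r)) / (P (n - Suc r) * P (n + Suc r))))"
  proof (rule sum.cong[OF refl])
    fix i assume "i \<in> {..<n}"
    define r where "r = Suc i"
    have r: "r \<le> n" "r > 0" using \<open>i \<in> {..<n}\<close> by (auto simp: r_def)
    define u where "u = q ^ (2 * r)"
    have u: "1 + u \<noteq> 0" "u \<noteq> 0"
    proof -
      show "1 + u \<noteq> 0" using minus_power_int_neq_1[OF q0 q, of "int r"]
        unfolding u_def by (metis add_cancel_right_right add_eq_0_iff eq_neg_iff_add_eq_0 mult_minus1_right of_nat_mult of_nat_numeral power_int_of_nat)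
    qed (use q0 in \<open>simp add: u_def\<close>)
    have e1: "(int (n - r) - int n) * (int (n - r) - int n + 1) = int (r * (r + 1)) - int (2 * r)"
      "2 * (int (n - r) - int n) = - int (2 * r)"
      using r by (simp_all add: of_nat_diff algebra_simps)
    have e2: "(int (n + r) - int n) * (int (n + r) - int n + 1) = int (r * (r + 1))"
      "2 * (int (n + r) - int n) = int (2 * r)"
      by (simp_all add: algebra_simps)
    have sg: "(- 1) ^ (n - r + n) = ((- 1) ^ r :: complex)" "(- 1) ^ (n + r + n) = ((- 1) ^ r :: complex)"
      using r by (simp_all add: minus_one_power_iff)
    have j: "n + n - (n - r) = n + r" "n + n - (n + r) = n - r" using r by auto
    have iu: "q powi (- int (2 * r)) = 1 / u" "q powi (int (r * (r + 1)) - int (2 * r)) = q ^ (r * (r + 1)) / u"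
      unfolding u_def using q0 by (simp_all only: power_int_diff power_int_minus_divide power_int_of_nat simp_thms)
    have f1: "f (n - r) = (- 1) ^ r * (q ^ (r * (r + 1)) / u) / ((1 - 1 / u * (- 1)) * (P (n - r) * P (n + r)))"
      unfolding f_def e1 sg j iu ..
    have f2: "f (n + r) = (- 1) ^ r * q ^ (r * (r + 1)) / ((1 - u * (- 1)) * (P (n - r) * P (n + r)))"
      unfolding f_def e2 sg j power_int_of_nat by (simp add: u_def mult_ac)
    have "1 / u / (1 - 1 / u * (- 1)) + 1 / (1 - u * (- 1)) = 2 / (1 + u)"
      using u by (simp add: divide_simps add.commute)
    hence "(- 1) ^ r * q ^ (r * (r + 1)) / (P (n - r) * P (n + r)) * (1 / u / (1 - 1 / u * (- 1)) + 1 / (1 - u * (- 1)))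
        = (- 1) ^ r * q ^ (r * (r + 1)) / (P (n - r) * P (n + r)) * (2 / (1 + u))" by simp
    thus "f (n - Suc i) + f (n + Suc i) = 1 / 2 * (4 * (- 1) ^ Suc i * q ^ (Suc i * (Suc i + 1)) /
      (1 + q ^ (2 * Suc i)) / (P (n - Suc i) * P (n + Suc i)))"
      unfolding r_def[symmetric] f1 f2 u_def[symmetric] distrib_left by (simp add: mult_ac)
  qed
  also have "1 / 2 * (1 / (P n * P n)) + \<dots> = 1 / 2 * (\<Sum>r\<le>n.
     (if r = 0 then 1 else 4 * (- 1) ^ r * q ^ (r * (r + 1)) / (1 + q ^ (2 * r))) / (P (n - r) * P (n + r)))"
    unfolding sum.atMost_shift sum_distrib_left[symmetric] distrib_left
    by (simp del: power_Suc mult_Suc mult_Suc_right)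
  finally show ?thesis unfolding P_def by simp
qed

section \<open>Eulerian series as Appell-type series\<close>

lemma rpoch_eq_qpoch:
  assumes "b \<noteq> 0"
  shows "rpoch (1 / b) p n = (1 / b) ^ n * qpoch b p n"
proof (induction n)
  case (Suc n)
  have "1 / b - p ^ n = 1 / b * (1 - p ^ n * b)"
    using assms by (simp add: right_diff_distrib)
  thus ?case unfolding rpoch_Suc qpoch_Suc Suc power_Suc by simp
qed simp

lemma rpoch_zero_left: "rpoch 0 (q\<^sup>2) n * q ^ n = (- 1) ^ n * q ^ (n ^ 2)"
proof (induction n)
  case (Suc n)
  have "rpoch 0 (q\<^sup>2) (Suc n) * q ^ Suc n = - ((q\<^sup>2) ^ n) * q * (rpoch 0 (q\<^sup>2) n * q ^ n)"
    by (simp add: rpoch_Suc)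
  also have "\<dots> = (- 1) ^ Suc n * q ^ ((Suc n)\<^sup>2)"
    unfolding Suc by (simp add: power2_eq_square power_add power_mult_distrib mult_2 mult_ac)
  finally show ?case .
qed simp

lemma norm_power_le_norm:
  fixes q :: complex
  assumes "norm q < 1" "k > 0"
  shows "norm (q ^ k) \<le> norm q"
proof -
  have "norm q ^ k \<le> norm q ^ 1"
    using assms by (intro power_decreasing) auto
  thus ?thesis by (simp add: norm_power)
qed

lemma power_neq_1:
  fixes q :: complex
  assumes "norm q < 1" "k > 0"
  shows "q ^ k \<noteq> 1"
  using one_minus_norm_le(2)[OF norm_power_le_norm[OF assms] assms(1)] .

lemma power_neq_minus_1:
  fixes q :: complex
  assumes "norm q < 1" "k > 0"
  shows "1 + q ^ k \<noteq> 0"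
proof -
  have "- (q ^ k) \<noteq> 1"
    by (rule one_minus_norm_le(2)[of _ "norm q"]) (use norm_power_le_norm[OF assms] assms(1) in auto)
  moreover have "- (q ^ k) = 1" if "1 + q ^ k = 0"
    using minus_unique[of "q ^ k" 1] that by (simp add: add.commute)
  ultimately show ?thesis by blast
qed

lemma suminf_cmult_nonzero:
  fixes f :: "nat \<Rightarrow> complex"
  assumes "summable (\<lambda>n. c * f n)" "c \<noteq> 0"
  shows "(\<Sum>n. c * f n) = c * suminf f"
proof -
  have "summable f" using assms by (rule summable_mult_D)
  thus ?thesis by (rule suminf_mult)
qed

text \<open>The weights of the odd Bailey pair, normalised to the base point $a=q^2$.\<close>

definition alpha_odd :: "complex \<Rightarrow> nat \<Rightarrow> complex" where
  "alpha_odd q r = (- 1) ^ r * q ^ (r * (r + 1)) * (1 + q ^ (2 * r + 1)) / (1 - q ^ (2 * r + 1)) / (1 - q\<^sup>2)"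

lemma summable_alpha_odd:
  assumes q: "norm q < 1"
  shows "summable (\<lambda>r. norm (alpha_odd q r))"
proof (rule summable_comparison_test')
  define C where "C = 2 * (1 / (1 - norm q)) * norm (1 / (1 - q\<^sup>2))"
  show "summable (\<lambda>r. C * norm q ^ r)"
    using q by (intro summable_mult summable_geometric) simp
  fix r :: nat
  have "norm q ^ (r * (r + 1)) \<le> norm q ^ r" using q by (intro power_decreasing) auto
  moreover have "norm (1 + q ^ (2 * r + 1)) \<le> 2"
    using norm_triangle_ineq[of 1 "q ^ (2 * r + 1)"] norm_power_le_norm[OF q, of "2 * r + 1"] q by simp
  moreover have "norm (1 / (1 - q ^ (2 * r + 1))) \<le> 1 / (1 - norm q)"
    by (rule one_minus_norm_le(1)[OF norm_power_le_norm[OF q] q]) simp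
  ultimately have "norm q ^ (r * (r + 1)) * (norm (1 + q ^ (2 * r + 1)) * norm (1 / (1 - q ^ (2 * r + 1))) * norm (1 / (1 - q\<^sup>2)))
      \<le> norm q ^ r * (2 * (1 / (1 - norm q)) * norm (1 / (1 - q\<^sup>2)))"
    using q by (intro mult_mono mult_right_mono) auto
  moreover have "norm (alpha_odd q r) = norm q ^ (r * (r + 1)) *
      (norm (1 + q ^ (2 * r + 1)) * norm (1 / (1 - q ^ (2 * r + 1))) * norm (1 / (1 - q\<^sup>2)))"
    by (simp add: alpha_odd_def norm_mult norm_divide norm_power)
  ultimately show "norm (norm (alpha_odd q r)) \<le> C * norm q ^ r"
    by (simp add: C_def mult_ac)
qed

lemma bailey_pair_odd_base:
  assumes q0: "q \<noteq> 0" and q: "norm q < 1"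
  shows "1 / (qpoch q (q\<^sup>2) (Suc n))\<^sup>2
     = (\<Sum>r\<le>n. alpha_odd q r / (qpoch (q\<^sup>2) (q\<^sup>2) (n - r) * qpoch (q ^ 4) (q\<^sup>2) (n + r)))"
  unfolding bailey_pair_odd[OF q0 q]
proof (rule sum.cong[OF refl])
  fix r
  have "qpoch (q\<^sup>2) (q\<^sup>2) (Suc (n + r)) = (1 - q\<^sup>2) * qpoch (q ^ 4) (q\<^sup>2) (n + r)"
    unfolding qpoch_Suc_shift by (simp add: power_add[symmetric])
  thus "(- 1) ^ r * q ^ (r * (r + 1)) * (1 + q ^ (2 * r + 1)) / (1 - q ^ (2 * r + 1)) /
      (qpoch (q\<^sup>2) (q\<^sup>2) (n - r) * qpoch (q\<^sup>2) (q\<^sup>2) (Suc (n + r))) =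
      alpha_odd q r / (qpoch (q\<^sup>2) (q\<^sup>2) (n - r) * qpoch (q ^ 4) (q\<^sup>2) (n + r))"
    by (simp add: alpha_odd_def mult_ac)
qed

lemma qpoch_minus_quotient:
  assumes q: "norm q < 1"
  shows "qpoch (- q) (q\<^sup>2) r / qpoch (- (q ^ 3)) (q\<^sup>2) r = (1 + q) / (1 + q ^ (2 * r + 1))"
    and "qpoch (- (q ^ 3)) (q\<^sup>2) r \<noteq> 0"
proof -
  have "(q\<^sup>2) ^ i * (- (q ^ 3)) \<noteq> 1" for i
    by (rule power_mult_neq_1) (use q in \<open>auto simp: norm_power power_less_one_iff\<close>)
  thus nz: "qpoch (- (q ^ 3)) (q\<^sup>2) r \<noteq> 0" by (auto simp: qpoch_eq_0_iff)
  have "qpoch (- q) (q\<^sup>2) r * (1 + q ^ (2 * r + 1)) = (1 + q) * qpoch (- (q ^ 3)) (q\<^sup>2) r"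
    using qpoch_Suc[of "- q" "q\<^sup>2" r] qpoch_Suc_shift[of "- q" "q\<^sup>2" r]
    unfolding power_mult[symmetric] by (simp add: power3_eq_cube power2_eq_square mult_ac)
  thus "qpoch (- q) (q\<^sup>2) r / qpoch (- (q ^ 3)) (q\<^sup>2) r = (1 + q) / (1 + q ^ (2 * r + 1))"
    using nz power_neq_minus_1[OF q, of "2 * r + 1"] by (simp add: divide_simps)
qed

text \<open>Bailey's lemma for the odd pair with $c=q^4$ and $s=-1/q$, the parameter \<open>t\<close> remaining free:
  $t=-1/q^2$ yields $\phi_R$, and $t=0$ yields $A_2$.\<close>

lemma bailey_odd_sum:
  assumes q0: "q \<noteq> 0" and q: "norm q < 1" and t: "norm (- (q ^ 3) * t) < 1"
    and nzt: "\<And>i. (q\<^sup>2) ^ i * (q ^ 4 * t) \<noteq> 1"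
  shows "(\<lambda>n. q * ((- (q ^ 3)) ^ n * rpoch t (q\<^sup>2) n) * qpoch (- q) (q\<^sup>2) n / (qpoch q (q\<^sup>2) (Suc n))\<^sup>2) sums
    (qpinf (- q) (q\<^sup>2) * qpinf (q ^ 4 * t) (q\<^sup>2) / (qpinf (q\<^sup>2) (q\<^sup>2) * qpinf (- (q ^ 3) * t) (q\<^sup>2)) *
     (\<Sum>r. q ^ ((r + 1) ^ 2 + 2 * r) * rpoch t (q\<^sup>2) r / qpoch (q ^ 4 * t) (q\<^sup>2) r / (1 - q ^ (2 * r + 1))))"
    (is "_ sums (?L * suminf ?X)")
proof -
  have q2: "norm (q\<^sup>2) < 1" by (rule norm_power2_less_1[OF q])
  have n: "norm (q ^ Suc k) < 1" for k
    using norm_power_le_norm[OF q, of "Suc k"] q by simp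
  define c s where "c = q ^ 4" and "s = 1 / (- q)"
  have cs: "c * s = - (q ^ 3)"
    using q0 by (simp add: c_def s_def power_def numeral_eq_Suc)
  have \<delta>: "rpoch s (q\<^sup>2) n * rpoch t (q\<^sup>2) n * c ^ n = (- (q ^ 3)) ^ n * rpoch t (q\<^sup>2) n * qpoch (- q) (q\<^sup>2) n" for n
  proof -
    have "rpoch s (q\<^sup>2) n = s ^ n * qpoch (- q) (q\<^sup>2) n"
      unfolding s_def using q0 by (intro rpoch_eq_qpoch) simp
    thus ?thesis unfolding cs[symmetric] by (simp add: power_mult_distrib mult_ac)
  qed
  note main = bailey_lemma[of "q\<^sup>2" c s t "\<lambda>n. 1 / (qpoch q (q\<^sup>2) (Suc n))\<^sup>2" "alpha_odd q", OF _ q2]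
  have hyps: "q\<^sup>2 \<noteq> 0" "norm (c * s * t) < 1" "\<And>i. (q\<^sup>2) ^ i * c \<noteq> 1"
    "\<And>i. (q\<^sup>2) ^ i * (c * s) \<noteq> 1" "\<And>i. (q\<^sup>2) ^ i * (c * t) \<noteq> 1"
    "\<And>n. 1 / (qpoch q (q\<^sup>2) (Suc n))\<^sup>2
     = (\<Sum>r\<le>n. alpha_odd q r / (qpoch (q\<^sup>2) (q\<^sup>2) (n - r) * qpoch c (q\<^sup>2) (n + r)))"
    "summable (\<lambda>r. norm (alpha_odd q r))"
  proof -
    show "1 / (qpoch q (q\<^sup>2) (Suc n))\<^sup>2
     = (\<Sum>r\<le>n. alpha_odd q r / (qpoch (q\<^sup>2) (q\<^sup>2) (n - r) * qpoch c (q\<^sup>2) (n + r)))" for n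
      unfolding c_def by (rule bailey_pair_odd_base[OF q0 q])
    show "(q\<^sup>2) ^ i * c \<noteq> 1" for i
      unfolding c_def using n[of 3] by (intro power_mult_neq_1 q2) simp
    show "(q\<^sup>2) ^ i * (c * s) \<noteq> 1" for i
      unfolding cs using n[of 2] by (intro power_mult_neq_1 q2) (simp add: numeral_3_eq_3)
    show "(q\<^sup>2) ^ i * (c * t) \<noteq> 1" for i
      unfolding c_def by (rule nzt)
    show "q\<^sup>2 \<noteq> 0" using q0 by simp
    show "norm (c * s * t) < 1" unfolding cs by (rule t)
    show "summable (\<lambda>r. norm (alpha_odd q r))" by (rule summable_alpha_odd[OF q])
  qed
  note main = main[OF hyps]
  define k where "k = (1 + q) / (1 - q\<^sup>2) / q"
  have k: "k \<noteq> 0"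
    using q0 power_neq_1[OF q, of 2] power_neq_minus_1[OF q, of 1] by (simp add: k_def)
  have summand: "rpoch s (q\<^sup>2) r * rpoch t (q\<^sup>2) r * c ^ r / (qpoch (c * s) (q\<^sup>2) r * qpoch (c * t) (q\<^sup>2) r) * alpha_odd q r
      = k * ?X r" for r
  proof -
    have 1: "rpoch s (q\<^sup>2) r * rpoch t (q\<^sup>2) r * c ^ r / (qpoch (c * s) (q\<^sup>2) r * qpoch (c * t) (q\<^sup>2) r)
        = (- (q ^ 3)) ^ r * rpoch t (q\<^sup>2) r / qpoch (c * t) (q\<^sup>2) r * (qpoch (- q) (q\<^sup>2) r / qpoch (- (q ^ 3)) (q\<^sup>2) r)"
      unfolding \<delta> cs by simp
    have "(r + 1) ^ 2 + 2 * r = 1 + (r * (r + 1) + 3 * r)" by (simp add: power2_eq_square)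
    hence "q ^ ((r + 1) ^ 2 + 2 * r) = q * (q ^ (r * (r + 1)) * (q ^ 3) ^ r)"
      by (simp only: power_add power_one_right power_mult)
    hence 2: "q ^ ((r + 1) ^ 2 + 2 * r) = q * (q ^ (r * (r + 1)) * ((- 1) ^ r * (- (q ^ 3)) ^ r))"
      unfolding power_mult_distrib[symmetric] by simp
    have alg: "P * R / D * ((1 + q) / u) * (sg * B * u / v / w) = (1 + q) / w / q * (q * (B * (sg * P)) * R / D / v)"
      if "u \<noteq> 0" for P R D B u v w sg :: complex
      using that q0 by (simp add: mult_ac)
    show ?thesis
      unfolding c_def[symmetric] 1 2 qpoch_minus_quotient(1)[OF q] alpha_odd_def k_def
      by (rule alg[OF power_neq_minus_1[OF q]]) simp
  qed
  have 1: "(\<Sum>r. k * ?X r) = k * suminf ?X"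
    using main(2) k unfolding summand by (intro suminf_cmult_nonzero)
  have "(\<lambda>n. q * (rpoch s (q\<^sup>2) n * rpoch t (q\<^sup>2) n * c ^ n * (1 / (qpoch q (q\<^sup>2) (Suc n))\<^sup>2))) sums
        (q * (qpinf (c * s) (q\<^sup>2) * qpinf (c * t) (q\<^sup>2) / (qpinf c (q\<^sup>2) * qpinf (c * s * t) (q\<^sup>2)) * (k * suminf ?X)))"
    using sums_mult[OF main(1), of q] unfolding summand 1 .
  moreover have "q * (rpoch s (q\<^sup>2) n * rpoch t (q\<^sup>2) n * c ^ n * (1 / (qpoch q (q\<^sup>2) (Suc n))\<^sup>2))
      = q * ((- (q ^ 3)) ^ n * rpoch t (q\<^sup>2) n) * qpoch (- q) (q\<^sup>2) n / (qpoch q (q\<^sup>2) (Suc n))\<^sup>2" for n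
    unfolding \<delta> by simp
  moreover have "q * (qpinf (c * s) (q\<^sup>2) * qpinf (c * t) (q\<^sup>2) / (qpinf c (q\<^sup>2) * qpinf (c * s * t) (q\<^sup>2)) * (k * suminf ?X))
      = ?L * suminf ?X"
  proof -
    have e1: "qpinf (q\<^sup>2) (q\<^sup>2) = (1 - q\<^sup>2) * qpinf (q ^ 4) (q\<^sup>2)"
      using qpinf_Suc[OF q2, of "q\<^sup>2"] by (simp add: power_add[symmetric])
    have e2: "qpinf (- q) (q\<^sup>2) = (1 + q) * qpinf (- (q ^ 3)) (q\<^sup>2)"
      using qpinf_Suc[OF q2, of "- q"] by (simp add: power2_eq_square power3_eq_cube)
    have "q * (A * B / (D * F) * ((1 + q) / v / q * S)) = (1 + q) * A * B / (v * D * F) * S" for A B D F S v :: complex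
      using q0 by (simp add: mult_ac)
    thus ?thesis unfolding e1 e2 cs k_def unfolding c_def .
  qed
  ultimately show ?thesis by (simp only:)
qed

theorem phi_R_eq:
  assumes q0: "q \<noteq> 0" and q: "norm q < 1"
  shows "phi_R q = qpinf (- q) q / qpinf q q * (\<Sum>n. (- 1) ^ n * q ^ ((n + 1) ^ 2) / (1 - q ^ (2 * n + 1)))"
proof -
  have q2: "norm (q\<^sup>2) < 1" by (rule norm_power2_less_1[OF q])
  define t where "t = 1 / (- (q\<^sup>2))"
  have t: "q ^ 4 * t = - (q\<^sup>2)" "- (q ^ 3) * t = q" "q\<^sup>2 * t = - 1"
    using q0 by (simp_all add: t_def power_def numeral_eq_Suc)
  have nzt: "(q\<^sup>2) ^ i * (q ^ 4 * t) \<noteq> 1" for i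
    unfolding t(1) using q2 by (intro power_mult_neq_1 q2) simp
  have rt: "rpoch t (q\<^sup>2) n = t ^ n * qpoch (- (q\<^sup>2)) (q\<^sup>2) n" for n
    unfolding t_def using q0 by (intro rpoch_eq_qpoch) simp
  have "q * ((- (q ^ 3)) ^ n * rpoch t (q\<^sup>2) n) * qpoch (- q) (q\<^sup>2) n / (qpoch q (q\<^sup>2) (Suc n))\<^sup>2
      = q ^ (n + 1) * qpoch (- q) q (2 * n) / (qpoch q (q\<^sup>2) (n + 1))\<^sup>2" for n
  proof -
    have "qpoch (- q) q (2 * n) = qpoch (- q) (q\<^sup>2) n * qpoch (- (q\<^sup>2)) (q\<^sup>2) n"
      using qpoch_double[of "- q" q n] by (simp add: power2_eq_square)
    moreover have "(- (q ^ 3)) ^ n * t ^ n = q ^ n"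
      unfolding power_mult_distrib[symmetric] t(2) ..
    ultimately show ?thesis unfolding rt mult.assoc[symmetric] by (simp add: mult_ac)
  qed
  moreover have "q ^ ((r + 1) ^ 2 + 2 * r) * rpoch t (q\<^sup>2) r / qpoch (q ^ 4 * t) (q\<^sup>2) r / (1 - q ^ (2 * r + 1))
      = (- 1) ^ r * q ^ ((r + 1) ^ 2) / (1 - q ^ (2 * r + 1))" for r
  proof -
    have nz: "qpoch (- (q\<^sup>2)) (q\<^sup>2) r \<noteq> 0"
      using power_mult_neq_1[OF q2, of "- (q\<^sup>2)"] q2 by (auto simp: qpoch_eq_0_iff)
    have "q ^ (2 * r) * t ^ r = (- 1) ^ r"
      unfolding power_mult power_mult_distrib[symmetric] t(3) ..
    thus ?thesis unfolding rt t(1) power_add using nz by (simp add: mult.assoc mult.commute)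
  qed
  moreover have "qpinf (- q) (q\<^sup>2) * qpinf (- (q\<^sup>2)) (q\<^sup>2) / (qpinf (q\<^sup>2) (q\<^sup>2) * qpinf q (q\<^sup>2))
      = qpinf (- q) q / qpinf q q"
    using qpinf_even_odd[OF q, of "- q"] qpinf_even_odd[OF q, of q]
    by (simp add: power2_eq_square mult.commute)
  ultimately show ?thesis
    using bailey_odd_sum[OF q0 q _ nzt] q unfolding phi_R_def t(1,2)
    by (simp only: sums_unique[symmetric])
qed

lemma summable_alpha_even:
  fixes q :: complex
  assumes q: "norm q < 1"
  shows "summable (\<lambda>r. norm (if r = 0 then 1 else 4 * (- 1) ^ r * q ^ (r * (r + 1)) / (1 + q ^ (2 * r))))"
proof (rule summable_comparison_test')
  show "summable (\<lambda>r. (1 + 4 * (1 / (1 - norm q))) * norm q ^ r)"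
    using q by (intro summable_mult summable_geometric) simp
  fix r :: nat
  show "norm (norm (if r = 0 then 1 else 4 * (- 1) ^ r * q ^ (r * (r + 1)) / (1 + q ^ (2 * r))))
      \<le> (1 + 4 * (1 / (1 - norm q))) * norm q ^ r"
  proof (cases "r = 0")
    case False
    have "norm (1 / (1 - (- (q ^ (2 * r))))) \<le> 1 / (1 - norm q)"
      by (rule one_minus_norm_le(1)[OF _ q]) (use norm_power_le_norm[OF q, of "2 * r"] False in simp)
    moreover have "norm q ^ (r * (r + 1)) \<le> norm q ^ r" using q by (intro power_decreasing) auto
    ultimately have "4 * (norm (1 / (1 + q ^ (2 * r))) * norm q ^ (r * (r + 1))) \<le> 4 * (1 / (1 - norm q) * norm q ^ r)"
      using q by (intro mult_left_mono mult_mono) auto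
    also have "\<dots> \<le> (1 + 4 * (1 / (1 - norm q))) * norm q ^ r"
      by (simp add: distrib_right)
    finally show ?thesis using False by (simp add: norm_mult norm_divide norm_power)
  next
    case True
    show ?thesis using True q by simp
  qed
qed

text \<open>Bailey's lemma for the even pair with $c=q^2$, $s=1/q$ and $t=0$.\<close>

theorem mu2_eq:
  assumes q0: "q \<noteq> 0" and q: "norm q < 1"
  shows "mu2 q = qpinf q (q\<^sup>2) / qpinf (q\<^sup>2) (q\<^sup>2) *
     (\<Sum>r. if r = 0 then 1 else 4 * q ^ (r * (2 * r + 1)) / (1 + q ^ (2 * r)))"
proof -
  have q2: "norm (q\<^sup>2) < 1" by (rule norm_power2_less_1[OF q])
  define \<alpha> where "\<alpha> r = (if r = 0 then 1 else 4 * (- 1) ^ r * q ^ (r * (r + 1)) / (1 + q ^ (2 * r)))" for r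
  define c s where "c = q\<^sup>2" and "s = 1 / q"
  have cs: "c * s = q"
    using q0 by (simp add: c_def s_def power2_eq_square)
  note main = bailey_lemma[of "q\<^sup>2" c s 0 "\<lambda>n. 1 / (qpoch (- (q\<^sup>2)) (q\<^sup>2) n)\<^sup>2" \<alpha>, OF _ q2]
  have hyps: "q\<^sup>2 \<noteq> 0" "norm (c * s * 0) < 1" "\<And>i. (q\<^sup>2) ^ i * c \<noteq> 1"
    "\<And>i. (q\<^sup>2) ^ i * (c * s) \<noteq> 1" "\<And>i. (q\<^sup>2) ^ i * (c * 0) \<noteq> 1"
    "\<And>n. 1 / (qpoch (- (q\<^sup>2)) (q\<^sup>2) n)\<^sup>2
     = (\<Sum>r\<le>n. \<alpha> r / (qpoch (q\<^sup>2) (q\<^sup>2) (n - r) * qpoch c (q\<^sup>2) (n + r)))"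
    "summable (\<lambda>r. norm (\<alpha> r))"
  proof -
    show "(q\<^sup>2) ^ i * c \<noteq> 1" for i
      unfolding c_def by (rule power_mult_neq_1[OF q2 q2])
    show "(q\<^sup>2) ^ i * (c * s) \<noteq> 1" for i
      unfolding cs by (rule power_mult_neq_1[OF q2 q])
    show "1 / (qpoch (- (q\<^sup>2)) (q\<^sup>2) n)\<^sup>2
     = (\<Sum>r\<le>n. \<alpha> r / (qpoch (q\<^sup>2) (q\<^sup>2) (n - r) * qpoch c (q\<^sup>2) (n + r)))" for n
      unfolding c_def \<alpha>_def by (rule bailey_pair_even[OF q0 q])
    show "summable (\<lambda>r. norm (\<alpha> r))"
      unfolding \<alpha>_def by (rule summable_alpha_even[OF q])
    show "q\<^sup>2 \<noteq> 0" using q0 by simp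
  qed simp_all
  note main = main[OF hyps]
  have \<delta>: "rpoch s (q\<^sup>2) n * rpoch 0 (q\<^sup>2) n * c ^ n = (- 1) ^ n * q ^ (n ^ 2) * qpoch q (q\<^sup>2) n" for n
  proof -
    have "rpoch s (q\<^sup>2) n * rpoch 0 (q\<^sup>2) n * c ^ n = s ^ n * qpoch q (q\<^sup>2) n * rpoch 0 (q\<^sup>2) n * c ^ n"
      unfolding s_def by (subst rpoch_eq_qpoch[OF q0]) simp
    also have "\<dots> = (c * s) ^ n * rpoch 0 (q\<^sup>2) n * qpoch q (q\<^sup>2) n"
      by (simp add: power_mult_distrib mult_ac)
    also have "\<dots> = (rpoch 0 (q\<^sup>2) n * q ^ n) * qpoch q (q\<^sup>2) n"
      unfolding cs by (simp add: mult_ac)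
    finally show ?thesis unfolding rpoch_zero_left .
  qed
  have summand: "rpoch s (q\<^sup>2) r * rpoch 0 (q\<^sup>2) r * c ^ r / (qpoch (c * s) (q\<^sup>2) r * qpoch (c * 0) (q\<^sup>2) r) * \<alpha> r
      = (if r = 0 then 1 else 4 * q ^ (r * (2 * r + 1)) / (1 + q ^ (2 * r)))" for r
  proof -
    have nz: "qpoch q (q\<^sup>2) r \<noteq> 0"
      using power_mult_neq_1[OF q2 q] by (auto simp: qpoch_eq_0_iff)
    have "r * (2 * r + 1) = r ^ 2 + r * (r + 1)"
      by (simp add: power2_eq_square algebra_simps)
    hence "q ^ (r * (2 * r + 1)) = q ^ (r ^ 2) * q ^ (r * (r + 1))"
      by (simp only: power_add)
    moreover have "(- 1) ^ r * (- 1) ^ r = (1 :: complex)" by (simp add: power_add[symmetric])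
    ultimately show ?thesis
      unfolding \<delta> cs \<alpha>_def using nz by (simp add: mult_ac)
  qed
  have "(\<lambda>n. (- 1) ^ n * q ^ n\<^sup>2 * qpoch q (q\<^sup>2) n / (qpoch (- (q\<^sup>2)) (q\<^sup>2) n)\<^sup>2) sums
      (qpinf q (q\<^sup>2) / qpinf (q\<^sup>2) (q\<^sup>2) *
     (\<Sum>r. if r = 0 then 1 else 4 * q ^ (r * (2 * r + 1)) / (1 + q ^ (2 * r))))"
    using main(1) unfolding summand unfolding \<delta> cs by (simp add: c_def)
  thus ?thesis unfolding mu2_def by (rule sums_unique[symmetric])
qed

section \<open>Fine's transformation\<close>

text \<open>Fine's function $\sum_n(b;p)_nz^n/(c;p)_n$, which is ${}_2\phi_1(b,p;c;p,z)$.\<close>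

definition fine_sum :: "complex \<Rightarrow> complex \<Rightarrow> complex \<Rightarrow> complex \<Rightarrow> complex" where
  "fine_sum p b c z = (\<Sum>n. qpoch b p n / qpoch c p n * z ^ n)"

lemma fine_sum_bound:
  assumes p: "norm p < 1" and nz: "\<And>i. p ^ i * c \<noteq> 1"
  obtains K where "K > 0" "\<And>N n. norm (qpoch b p n / qpoch (p ^ N * c) p n) \<le> K"
proof -
  obtain B1 where B1: "B1 > 0" "\<And>n. norm (qpoch b p n) \<le> B1"
    using qpoch_bounded[OF p] by blast
  obtain B2 where B2: "B2 > 0" "\<And>n. norm (1 / qpoch c p n) \<le> B2"
    using qpoch_inverse_bounded[OF p nz] by blast
  obtain B3 where B3: "B3 > 0" "\<And>n. norm (qpoch c p n) \<le> B3"
    using qpoch_bounded[OF p] by blast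
  have "norm (qpoch b p n / qpoch (p ^ N * c) p n) \<le> B1 * (B2 * B3)" for N n
  proof -
    have "qpoch b p n / qpoch (p ^ N * c) p n = qpoch b p n * (1 / qpoch c p (N + n) * qpoch c p N)"
      using nz by (auto simp: qpoch_add qpoch_eq_0_iff)
    hence "norm (qpoch b p n / qpoch (p ^ N * c) p n)
        = norm (qpoch b p n) * (norm (1 / qpoch c p (N + n)) * norm (qpoch c p N))"
      by (simp only: norm_mult)
    also have "\<dots> \<le> B1 * (B2 * B3)"
      by (intro mult_mono B1 B2 B3) (use B1 B2 B3 in auto)
    finally show ?thesis .
  qed
  thus ?thesis using that[of "B1 * (B2 * B3)"] B1 B2 B3 by simp
qed

lemma fine_sum_summable:
  assumes p: "norm p < 1" and nz: "\<And>i. p ^ i * c \<noteq> 1" and z: "norm z < 1"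
  shows "summable (\<lambda>n. qpoch b p n / qpoch c p n * z ^ n)"
proof -
  obtain K where K: "K > 0" "\<And>N n. norm (qpoch b p n / qpoch (p ^ N * c) p n) \<le> K"
    using fine_sum_bound[OF p nz, where b = b] by blast
  show ?thesis
  proof (rule summable_comparison_test')
    show "summable (\<lambda>n. K * norm z ^ n)"
      using z by (intro summable_mult summable_geometric) simp
    show "norm (qpoch b p n / qpoch c p n * z ^ n) \<le> K * norm z ^ n" for n
      using K(2)[of n 0] by (simp only: norm_mult norm_power) (simp add: mult_right_mono)
  qed
qed

lemma fine_sum_step:
  assumes p: "norm p < 1" and nz: "\<And>i. p ^ i * c \<noteq> 1" and z: "norm z < 1"
  shows "(1 - z) * fine_sum p b c z = 1 - (b - c) * z / (1 - c) * fine_sum p b (p * c) (p * z)"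
proof -
  define t where "t n = qpoch b p n / qpoch c p n" for n
  have nz': "p ^ i * (p * c) \<noteq> 1" for i
    using nz[of "Suc i"] by (simp add: mult_ac)
  have pz: "norm (p * z) < 1"
    using mult_strict_mono[of "norm p" 1 "norm z" 1] p z by (simp add: norm_mult)
  have s: "summable (\<lambda>n. t n * z ^ n)"
    unfolding t_def by (rule fine_sum_summable[OF p nz z])
  have s': "summable (\<lambda>n. t (Suc n) * z ^ Suc n)" "summable (\<lambda>n. t n * z ^ Suc n)"
    using s summable_Suc_iff[of "\<lambda>n. t n * z ^ n"] summable_mult[OF s, of z] by (simp_all add: mult_ac)
  have diff: "t (Suc n) * z ^ Suc n - t n * z ^ Suc n
      = - (b - c) * z / (1 - c) * (qpoch b p n / qpoch (p * c) p n * (p * z) ^ n)" for n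
  proof -
    have nzn: "1 - p ^ n * c \<noteq> 0" "qpoch c p n \<noteq> 0" "1 - c \<noteq> 0" "qpoch (p * c) p n \<noteq> 0"
      using nz[of n] nz[of 0] nz nz' by (auto simp: qpoch_eq_0_iff)
    have "t (Suc n) - t n = qpoch b p n / qpoch c p (Suc n) * ((1 - p ^ n * b) - (1 - p ^ n * c))"
      unfolding t_def qpoch_Suc using nzn by (simp add: field_simps)
    also have "\<dots> = qpoch b p n / ((1 - c) * qpoch (p * c) p n) * (p ^ n * (- (b - c)))"
      unfolding qpoch_Suc_shift by (simp add: algebra_simps)
    finally have "(t (Suc n) - t n) * z ^ Suc n
        = qpoch b p n / ((1 - c) * qpoch (p * c) p n) * (p ^ n * (- (b - c))) * z ^ Suc n" by simp
    also have "\<dots> = - (b - c) * z / (1 - c) * (qpoch b p n / qpoch (p * c) p n * (p * z) ^ n)"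
      by (simp add: power_mult_distrib mult_ac)
    finally show ?thesis by (simp add: left_diff_distrib)
  qed
  have "(1 - z) * fine_sum p b c z = (\<Sum>n. t n * z ^ n) - (\<Sum>n. t n * z ^ Suc n)"
    using suminf_mult[OF s, of z] unfolding fine_sum_def t_def[symmetric]
    by (simp add: left_diff_distrib mult_ac)
  also have "(\<Sum>n. t n * z ^ n) = 1 + (\<Sum>n. t (Suc n) * z ^ Suc n)"
    using suminf_split_head[OF s] by (simp add: t_def)
  also have "1 + (\<Sum>n. t (Suc n) * z ^ Suc n) - (\<Sum>n. t n * z ^ Suc n)
      = 1 + (\<Sum>n. t (Suc n) * z ^ Suc n - t n * z ^ Suc n)"
    using suminf_diff[OF s'] by simp
  also have "(\<Sum>n. t (Suc n) * z ^ Suc n - t n * z ^ Suc n) = - (b - c) * z / (1 - c) * fine_sum p b (p * c) (p * z)"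
    unfolding diff fine_sum_def by (rule suminf_mult[OF fine_sum_summable[OF p nz' pz]])
  finally show ?thesis
    by (simp only: mult_minus_left divide_minus_left add_uminus_conv_diff)
qed

text \<open>Iteration of the previous relation, under which $(c,z)$ becomes $(pc,pz)$ and the remainder
  acquires the factor $-z(b-c)/((1-c)(1-z))$, of size $O(p^N)$ at step \<open>N\<close>.\<close>

theorem fine_transformation:
  assumes p: "norm p < 1" and nz: "\<And>i. p ^ i * c \<noteq> 1" and z: "norm z < 1"
  shows "(\<lambda>n. (\<Prod>i<n. - z * p ^ i * (b - p ^ i * c)) / (qpoch c p n * qpoch z p (Suc n))) sums fine_sum p b c z"
proof -
  define w where "w n = (\<Prod>i<n. - z * p ^ i * (b - p ^ i * c))" for n
  define R where "R N = fine_sum p b (p ^ N * c) (p ^ N * z)" for N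
  have nzN: "p ^ i * (p ^ N * c) \<noteq> 1" for i N
    using nz[of "i + N"] by (simp add: power_add mult.assoc)
  have zN: "norm (p ^ N * z) \<le> norm z" for N
    using p by (simp add: norm_mult norm_power mult_left_le_one_le power_le_one)
  have zN1: "norm (p ^ N * z) < 1" for N using zN[of N] z by simp
  have nzz: "p ^ i * z \<noteq> 1" for i by (rule power_mult_neq_1[OF p z])
  have iter: "fine_sum p b c z = (\<Sum>n<N. w n / (qpoch c p n * qpoch z p (Suc n))) + w N / (qpoch c p N * qpoch z p N) * R N" for N
  proof (induction N)
    case 0
    show ?case by (simp add: w_def R_def)
  next
    case (Suc N)
    have n1: "1 - p ^ N * z \<noteq> 0" "1 - p ^ N * c \<noteq> 0" using nzz[of N] nz[of N] by auto
    have "(1 - p ^ N * z) * R N = 1 - (b - p ^ N * c) * (p ^ N * z) / (1 - p ^ N * c) * R (Suc N)"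
      using fine_sum_step[OF p nzN[of _ N] zN1[of N], where b = b] by (simp add: R_def mult.assoc)
    hence "R N = (1 - (b - p ^ N * c) * (p ^ N * z) / (1 - p ^ N * c) * R (Suc N)) / (1 - p ^ N * z)"
      using n1 by (simp add: eq_divide_eq mult.commute)
    hence RN: "R N = 1 / (1 - p ^ N * z) + (- z * p ^ N * (b - p ^ N * c)) / ((1 - p ^ N * c) * (1 - p ^ N * z)) * R (Suc N)"
      by (simp add: diff_divide_distrib mult_ac)
    have "w N / (qpoch c p N * qpoch z p N) * R N
        = w N / (qpoch c p N * qpoch z p (Suc N)) + w (Suc N) / (qpoch c p (Suc N) * qpoch z p (Suc N)) * R (Suc N)"
      unfolding RN distrib_left by (simp add: w_def qpoch_Suc mult_ac)
    thus ?case unfolding Suc by simp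
  qed
  obtain B1 where B1: "B1 > 0" "\<And>n. norm (1 / qpoch c p n) \<le> B1"
    using qpoch_inverse_bounded[OF p nz] by blast
  obtain B2 where B2: "B2 > 0" "\<And>n. norm (1 / qpoch z p n) \<le> B2"
    using qpoch_inverse_bounded[OF p nzz] by blast
  obtain K where K: "K > 0" "\<And>N n. norm (qpoch b p n / qpoch (p ^ N * c) p n) \<le> K"
    using fine_sum_bound[OF p nz, where b = b] by blast
  have gs: "summable (\<lambda>n. K * norm z ^ n)"
    using z by (intro summable_mult summable_geometric) simp
  have R: "norm (R N) \<le> (\<Sum>n. K * norm z ^ n)" for N
    unfolding R_def fine_sum_def
  proof (rule norm_suminf_le[OF _ gs])
    fix n
    have "norm (p ^ N * z) ^ n \<le> norm z ^ n" by (intro power_mono zN) simp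
    thus "norm (qpoch b p n / qpoch (p ^ N * c) p n * (p ^ N * z) ^ n) \<le> K * norm z ^ n"
      unfolding norm_mult[of "qpoch b p n / qpoch (p ^ N * c) p n"] norm_power
      using K by (intro mult_mono) auto
  qed
  have "summable (\<lambda>n. norm (w n))"
  proof (rule summable_norm_ratio)
    show "(\<lambda>n. - z * p ^ n * (b - p ^ n * c)) \<longlonglongrightarrow> - z * 0 * (b - 0 * c)"
      by (intro tendsto_intros LIMSEQ_power_zero p)
  qed (simp_all add: w_def)
  hence w0: "(\<lambda>n. norm (w n)) \<longlonglongrightarrow> 0" by (rule summable_LIMSEQ_zero)
  define M where "M = B1 * B2 * (\<Sum>n. K * norm z ^ n)"
  have "(\<lambda>N. w N / (qpoch c p N * qpoch z p N) * R N) \<longlonglongrightarrow> 0"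
  proof (rule Lim_null_comparison)
    show "(\<lambda>N. norm (w N) * M) \<longlonglongrightarrow> 0"
      using tendsto_mult_left_zero[OF w0] .
    have "norm (w N / (qpoch c p N * qpoch z p N) * R N) \<le> norm (w N) * M" for N
    proof -
      have "norm (w N / (qpoch c p N * qpoch z p N) * R N)
          = norm (w N) * (norm (1 / qpoch c p N) * norm (1 / qpoch z p N) * norm (R N))"
        by (simp add: norm_mult norm_divide)
      also have "\<dots> \<le> norm (w N) * M"
        unfolding M_def by (intro mult_left_mono mult_mono B1 B2 R) (use B1 B2 in auto)
      finally show ?thesis .
    qed
    thus "eventually (\<lambda>N. norm (w N / (qpoch c p N * qpoch z p N) * R N) \<le> norm (w N) * M) sequentially"
      by simp
  qed
  hence "(\<lambda>N. fine_sum p b c z - w N / (qpoch c p N * qpoch z p N) * R N) \<longlonglongrightarrow> fine_sum p b c z - 0"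
    by (intro tendsto_intros)
  moreover have "fine_sum p b c z - w N / (qpoch c p N * qpoch z p N) * R N = (\<Sum>n<N. w n / (qpoch c p n * qpoch z p (Suc n)))" for N
    using iter[of N] by simp
  ultimately show ?thesis by (simp add: sums_def w_def)
qed

text \<open>The two Eulerian forms of $A_2$ agree: Fine's transformation with base $q^2$, $b=-q^2$, $c=q^3$,
  $z=q$.\<close>

lemma A2_second_form:
  assumes q0: "q \<noteq> 0" and q: "norm q < 1"
  shows "(\<lambda>n. q ^ ((n + 1) ^ 2) * qpoch (- q) (q\<^sup>2) n / (qpoch q (q\<^sup>2) (Suc n))\<^sup>2) sums A2 q"
proof -
  have q2: "norm (q\<^sup>2) < 1" by (rule norm_power2_less_1[OF q])
  have q3: "norm (q ^ 3) < 1" using norm_power_le_norm[OF q, of 3] q by simp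
  have nz: "(q\<^sup>2) ^ i * q ^ 3 \<noteq> 1" for i by (rule power_mult_neq_1[OF q2 q3])
  have q1: "1 - q \<noteq> 0" using power_neq_1[OF q, of 1] by simp
  have den: "qpoch q (q\<^sup>2) (Suc n) = (1 - q) * qpoch (q ^ 3) (q\<^sup>2) n" for n
    by (simp add: qpoch_Suc_shift power3_eq_cube power2_eq_square)
  have w: "(\<Prod>i<n. - q * (q\<^sup>2) ^ i * (- (q\<^sup>2) - (q\<^sup>2) ^ i * q ^ 3)) * q = q ^ ((n + 1) ^ 2) * qpoch (- q) (q\<^sup>2) n" for n
  proof (induction n)
    case (Suc n)
    have "(\<Prod>i<Suc n. - q * (q\<^sup>2) ^ i * (- (q\<^sup>2) - (q\<^sup>2) ^ i * q ^ 3)) * q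
        = (- q * (q\<^sup>2) ^ n * (- (q\<^sup>2) - (q\<^sup>2) ^ n * q ^ 3)) * (q ^ ((n + 1) ^ 2) * qpoch (- q) (q\<^sup>2) n)"
      unfolding Suc[symmetric] by simp
    also have "- q * (q\<^sup>2) ^ n * (- (q\<^sup>2) - (q\<^sup>2) ^ n * q ^ 3) = q ^ (2 * n + 3) * (1 - (q\<^sup>2) ^ n * (- q))"
      by (simp add: power_add power_mult power2_eq_square power3_eq_cube algebra_simps)
    also have "q ^ (2 * n + 3) * (1 - (q\<^sup>2) ^ n * (- q)) * (q ^ ((n + 1) ^ 2) * qpoch (- q) (q\<^sup>2) n)
        = q ^ (2 * n + 3 + (n + 1) ^ 2) * qpoch (- q) (q\<^sup>2) (Suc n)"
      by (simp add: qpoch_Suc power_add mult_ac)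
    also have "2 * n + 3 + (n + 1) ^ 2 = (Suc n + 1) ^ 2" by (simp add: power2_eq_square)
    finally show ?case .
  qed simp
  have "A2 q = q / (1 - q) * fine_sum (q\<^sup>2) (- (q\<^sup>2)) (q ^ 3) q"
    unfolding A2_def fine_sum_def suminf_mult[OF fine_sum_summable[OF q2 nz q], symmetric]
    using q1 by (intro suminf_cong) (simp add: den)
  moreover have "(\<lambda>n. q / (1 - q) * ((\<Prod>i<n. - q * (q\<^sup>2) ^ i * (- (q\<^sup>2) - (q\<^sup>2) ^ i * q ^ 3)) /
        (qpoch (q ^ 3) (q\<^sup>2) n * qpoch q (q\<^sup>2) (Suc n))))
      sums (q / (1 - q) * fine_sum (q\<^sup>2) (- (q\<^sup>2)) (q ^ 3) q)"
    by (intro sums_mult fine_transformation q2 nz q)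
  moreover have "q / (1 - q) * ((\<Prod>i<n. - q * (q\<^sup>2) ^ i * (- (q\<^sup>2) - (q\<^sup>2) ^ i * q ^ 3)) /
        (qpoch (q ^ 3) (q\<^sup>2) n * qpoch q (q\<^sup>2) (Suc n)))
      = q ^ ((n + 1) ^ 2) * qpoch (- q) (q\<^sup>2) n / (qpoch q (q\<^sup>2) (Suc n))\<^sup>2" for n
  proof -
    have "(qpoch q (q\<^sup>2) (Suc n))\<^sup>2 = (1 - q) * qpoch (q ^ 3) (q\<^sup>2) n * qpoch q (q\<^sup>2) (Suc n)"
      unfolding power2_eq_square[of "qpoch q (q\<^sup>2) (Suc n)"] by (subst (1) den) simp
    thus ?thesis unfolding w[symmetric] by (simp add: mult_ac del: prod.lessThan_Suc)
  qed
  ultimately show ?thesis by simp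
qed

theorem A2_eq:
  assumes q0: "q \<noteq> 0" and q: "norm q < 1"
  shows "A2 q = qpinf (- q) (q\<^sup>2) / qpinf (q\<^sup>2) (q\<^sup>2) *
     (\<Sum>n. (- 1) ^ n * q ^ ((n + 1) * (2 * n + 1)) / (1 - q ^ (2 * n + 1)))"
proof -
  have r0: "q ^ n * rpoch 0 (q\<^sup>2) n = (- 1) ^ n * q ^ (n ^ 2)" for n
    using rpoch_zero_left[of q n] by (simp add: mult.commute)
  have 1: "q * ((- (q ^ 3)) ^ n * rpoch 0 (q\<^sup>2) n) = q ^ ((n + 1) ^ 2)" for n
  proof -
    have "(- (q ^ 3)) ^ n = (- 1) ^ n * (q ^ (2 * n) * q ^ n)"
      unfolding power_minus[of "q ^ 3"] power_mult[symmetric] power_add[symmetric] by simp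
    hence "(- (q ^ 3)) ^ n * rpoch 0 (q\<^sup>2) n = (- 1) ^ n * (q ^ (2 * n) * (q ^ n * rpoch 0 (q\<^sup>2) n))"
      by (simp only: mult.assoc)
    also have "\<dots> = ((- 1) ^ n * (- 1) ^ n) * (q ^ (2 * n) * q ^ (n ^ 2))"
      unfolding r0 by (simp only: mult_ac)
    also have "(- 1) ^ n * (- 1) ^ n = (1 :: complex)" by (simp add: power_add[symmetric])
    finally show ?thesis by (simp add: power2_eq_square power_add[symmetric] mult_2 add_ac)
  qed
  have 2: "q ^ ((n + 1) ^ 2 + 2 * n) * rpoch 0 (q\<^sup>2) n = (- 1) ^ n * q ^ ((n + 1) * (2 * n + 1))" for n
  proof -
    have "(n + 1) ^ 2 + 2 * n = ((n + 1) ^ 2 + n) + n" by simp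
    hence "q ^ ((n + 1) ^ 2 + 2 * n) * rpoch 0 (q\<^sup>2) n = q ^ ((n + 1) ^ 2 + n) * ((- 1) ^ n * q ^ (n ^ 2))"
      unfolding r0[symmetric] by (simp only: power_add mult.assoc)
    also have "\<dots> = (- 1) ^ n * q ^ ((n + 1) ^ 2 + n + n ^ 2)" by (simp add: power_add mult_ac)
    also have "(n + 1) ^ 2 + n + n ^ 2 = (n + 1) * (2 * n + 1)" by (simp add: power2_eq_square)
    finally show ?thesis .
  qed
  from bailey_odd_sum[OF q0 q, of 0]
  have "(\<lambda>n. q ^ ((n + 1) ^ 2) * qpoch (- q) (q\<^sup>2) n / (qpoch q (q\<^sup>2) (Suc n))\<^sup>2) sums
     (qpinf (- q) (q\<^sup>2) / qpinf (q\<^sup>2) (q\<^sup>2) *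
     (\<Sum>n. (- 1) ^ n * q ^ ((n + 1) * (2 * n + 1)) / (1 - q ^ (2 * n + 1))))"
    unfolding 1 2 by (simp del: power_Suc)
  with A2_second_form[OF q0 q] show ?thesis by (rule sums_unique2)
qed

section \<open>Bilateral series\<close>

lemma int_UNIV_split: "(UNIV :: int set) = range int \<union> range (\<lambda>n. - 1 - int n)"
proof -
  have "k \<in> range int \<union> range (\<lambda>n. - 1 - int n)" for k :: int
  proof (cases "k \<ge> 0")
    case True thus ?thesis by (metis UnI1 nat_0_le rangeI)
  next
    case False
    hence "k = - 1 - int (nat (- 1 - k))" by simp
    thus ?thesis by blast
  qed
  thus ?thesis by blast
qed

lemma int_split_disjoint: "range int \<inter> range (\<lambda>n. - 1 - int n) = {}"
  by auto

lemma has_sum_int_halves: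
  fixes f :: "int \<Rightarrow> complex"
  assumes "(f has_sum S) UNIV"
  obtains A B where "(\<lambda>n. f (int n)) sums A" "(\<lambda>n. f (- 1 - int n)) sums B" "S = A + B"
proof -
  have inj: "inj int" "inj (\<lambda>n. - 1 - int n)" by (auto simp: inj_on_def)
  have s: "f summable_on UNIV" using assms by (rule has_sum_imp_summable)
  have 1: "f summable_on range int" "f summable_on range (\<lambda>n. - 1 - int n)"
    by (rule summable_on_subset_banach[OF s]; simp)+
  have "(f has_sum (infsum f (range int) + infsum f (range (\<lambda>n. - 1 - int n)))) UNIV"
    unfolding int_UNIV_split
    by (intro has_sum_Un_disjoint has_sum_infsum 1 int_split_disjoint)
  hence S: "S = infsum f (range int) + infsum f (range (\<lambda>n. - 1 - int n))"
    using assms has_sum_unique by blast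
  have "(\<lambda>n. f (int n)) sums infsum f (range int)"
    using has_sum_infsum[OF 1(1)] unfolding has_sum_reindex[OF inj(1)] o_def by (rule has_sum_imp_sums)
  moreover have "(\<lambda>n. f (- 1 - int n)) sums infsum f (range (\<lambda>n. - 1 - int n))"
    using has_sum_infsum[OF 1(2)] unfolding has_sum_reindex[OF inj(2)] o_def by (rule has_sum_imp_sums)
  ultimately show ?thesis using S by (rule that)
qed

lemma has_sum_int_fold:
  fixes f :: "int \<Rightarrow> complex"
  assumes "(f has_sum S) UNIV"
  shows "(\<lambda>n. f (int n) + f (- 1 - int n)) sums S"
proof -
  obtain A B where "(\<lambda>n. f (int n)) sums A" "(\<lambda>n. f (- 1 - int n)) sums B" "S = A + B"
    using has_sum_int_halves[OF assms] .
  thus ?thesis by (simp add: sums_add)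
qed

lemma summable_on_intI:
  fixes f :: "int \<Rightarrow> 'a :: banach"
  assumes "summable (\<lambda>n. norm (f (int n)))" "summable (\<lambda>n. norm (f (- 1 - int n)))"
  shows "f summable_on UNIV"
proof -
  have inj: "inj int" "inj (\<lambda>n. - 1 - int n)" by (auto simp: inj_on_def)
  show ?thesis unfolding int_UNIV_split
    by (intro summable_on_Un_disjoint int_split_disjoint)
       (simp_all add: summable_on_reindex inj o_def assms norm_summable_imp_summable_on)
qed

lemma summable_on_int_geometric:
  fixes r :: real
  assumes "0 \<le> r" "r < 1"
  shows "(\<lambda>n::int. r ^ nat \<bar>n\<bar>) summable_on UNIV"
proof (rule summable_on_intI)
  show "summable (\<lambda>n. norm (r ^ nat \<bar>int n\<bar>))"
    using assms by (simp add: summable_geometric)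
  have "nat \<bar>- 1 - int n\<bar> = Suc n" for n by simp
  thus "summable (\<lambda>n. norm (r ^ nat \<bar>- 1 - int n\<bar>))"
    using assms summable_mult[OF summable_geometric[of r], of r] by simp
qed

lemma summable_on_int_bound:
  fixes f :: "int \<Rightarrow> complex"
  assumes "0 \<le> r" "r < 1" "\<And>n. norm (f n) \<le> C * r ^ nat \<bar>n\<bar>"
  shows "f summable_on UNIV"
proof -
  have "(\<lambda>n::int. C * r ^ nat \<bar>n\<bar>) summable_on UNIV"
    by (intro summable_on_cmult_right summable_on_int_geometric assms)
  hence "(\<lambda>n. norm (f n)) summable_on UNIV"
    by (rule Infinite_Sum.abs_summable_on_comparison_test') (use assms(3) in auto)
  thus ?thesis by (simp add: summable_on_iff_abs_summable_on_complex)
qed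

lemma has_sum_shift_int:
  fixes f :: "int \<Rightarrow> 'a :: {comm_monoid_add, topological_space}"
  shows "((\<lambda>n. f (n + d)) has_sum S) UNIV \<longleftrightarrow> (f has_sum S) UNIV"
  by (rule has_sum_reindex_bij_witness[of _ "\<lambda>n. n - d" "\<lambda>n. n + d"]) auto

lemma has_sum_uminus_int:
  fixes f :: "int \<Rightarrow> 'a :: {comm_monoid_add, topological_space}"
  shows "((\<lambda>n. f (- n)) has_sum S) UNIV \<longleftrightarrow> (f has_sum S) UNIV"
  by (rule has_sum_reindex_bij_witness[of _ uminus uminus]) auto

lemma has_sum_rows:
  fixes f :: "'a \<times> 'b \<Rightarrow> complex"
  assumes f: "f summable_on UNIV" and g: "\<And>x. ((\<lambda>y. f (x, y)) has_sum g x) UNIV"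
  shows "(g has_sum infsum f UNIV) UNIV"
proof -
  have S: "(f has_sum infsum f UNIV) (UNIV \<times> UNIV)"
    using has_sum_infsum[OF f] by simp
  show ?thesis by (rule has_sum_SigmaD[OF S]) (use g in simp)
qed

lemma summable_on_product:
  fixes f :: "'a \<Rightarrow> complex" and g :: "'b \<Rightarrow> complex"
  assumes "f summable_on UNIV" "g summable_on UNIV"
  shows "(\<lambda>(x, y). f x * g y) summable_on UNIV"
  by (rule summable_on_Times_bound[where g = "\<lambda>x. norm (f x)" and h = "\<lambda>y. norm (g y)"])
     (use assms in \<open>auto simp: summable_on_iff_abs_summable_on_complex norm_mult\<close>)

lemma has_sum_product:
  fixes f :: "'a \<Rightarrow> complex" and g :: "'b \<Rightarrow> complex"
  assumes f: "(f has_sum A) UNIV" and g: "(g has_sum B) UNIV"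
  shows "((\<lambda>(x, y). f x * g y) has_sum (A * B)) UNIV"
proof -
  have s: "(\<lambda>(x, y). f x * g y) summable_on UNIV"
    by (rule summable_on_product[OF has_sum_imp_summable[OF f] has_sum_imp_summable[OF g]])
  have "((\<lambda>x. f x * B) has_sum infsum (\<lambda>(x, y). f x * g y) UNIV) UNIV"
    by (rule has_sum_rows[OF s]) (simp add: has_sum_cmult_right[OF g])
  moreover have "((\<lambda>x. f x * B) has_sum A * B) UNIV"
    by (rule has_sum_cmult_left[OF f])
  ultimately have "infsum (\<lambda>(x, y). f x * g y) UNIV = A * B"
    by (rule has_sum_unique)
  thus ?thesis using has_sum_infsum[OF s] by simp
qed

text \<open>Dominated convergence for bilateral series.\<close>

lemma tannery_int:
  fixes f :: "nat \<Rightarrow> int \<Rightarrow> complex" and M :: "int \<Rightarrow> real"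
  assumes lim: "\<And>r. (\<lambda>N. f N r) \<longlonglongrightarrow> g r" and le: "\<And>N r. norm (f N r) \<le> M r"
    and M: "M summable_on UNIV"
  shows "(\<lambda>N. infsum (f N) UNIV) \<longlonglongrightarrow> infsum g UNIV"
proof -
  have gle: "norm (g r) \<le> M r" for r
    by (rule tendsto_upperbound[OF tendsto_norm[OF lim]]) (use le in auto)
  have sm: "h summable_on UNIV" if "\<And>r. norm (h r) \<le> M r" for h :: "int \<Rightarrow> complex"
  proof -
    have "(\<lambda>r. norm (h r)) summable_on UNIV"
      by (rule Infinite_Sum.abs_summable_on_comparison_test'[OF M]) (use that in auto)
    thus ?thesis by (simp add: summable_on_iff_abs_summable_on_complex)
  qed
  have eq: "infsum h UNIV = (\<Sum>n. h (int n) + h (- 1 - int n))" if "\<And>r. norm (h r) \<le> M r" for h :: "int \<Rightarrow> complex"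
    using has_sum_int_fold[OF has_sum_infsum[OF sm[OF that]]] by (simp add: sums_iff)
  have Mc: "(\<lambda>r. complex_of_real (M r)) summable_on UNIV"
    using M by (simp add: summable_on_of_real)
  have "summable (\<lambda>n. complex_of_real (M (int n)) + complex_of_real (M (- 1 - int n)))"
    using has_sum_int_fold[OF has_sum_infsum[OF Mc]] by (rule sums_summable)
  hence Ms: "summable (\<lambda>n. M (int n) + M (- 1 - int n))"
    unfolding of_real_add[symmetric] summable_complex_of_real .
  have "eventually (\<lambda>N. summable (\<lambda>n. norm (f N (int n) + f N (- 1 - int n)))) sequentially \<and>
      summable (\<lambda>n. norm (g (int n) + g (- 1 - int n))) \<and>
      (\<lambda>N. \<Sum>n. f N (int n) + f N (- 1 - int n)) \<longlonglongrightarrow> (\<Sum>n. g (int n) + g (- 1 - int n))"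
  proof (rule tannerys_theorem[OF _ _ Ms])
    show "(\<lambda>N. f N (int n) + f N (- 1 - int n)) \<longlonglongrightarrow> g (int n) + g (- 1 - int n)" for n
      by (intro tendsto_add lim)
    have "norm (f N (int n) + f N (- 1 - int n)) \<le> M (int n) + M (- 1 - int n)" for n N
      by (intro norm_triangle_mono le)
    thus "eventually (\<lambda>(n, N). norm (f N (int n) + f N (- 1 - int n)) \<le> M (int n) + M (- 1 - int n))
        (sequentially \<times>\<^sub>F sequentially)"
      by (auto intro: always_eventually)
  qed simp
  thus ?thesis using eq[OF le] eq[OF gle] by simp
qed

text \<open>A nome \<open>q\<close>; the base of the theta series and of their product expansions is $q^2$.\<close>

locale nome =
  fixes q :: complex
  assumes q0: "q \<noteq> 0" and q1: "norm q < 1"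
begin

lemma q2: "norm (q\<^sup>2) < 1"
  by (rule norm_power2_less_1[OF q1])

lemma nq: "0 < norm q" using q0 by simp

abbreviation P :: "nat \<Rightarrow> complex" where "P \<equiv> qpoch (q\<^sup>2) (q\<^sup>2)"

abbreviation Pinf :: complex where "Pinf \<equiv> qpinf (q\<^sup>2) (q\<^sup>2)"

lemma Pinf_nz: "Pinf \<noteq> 0"
  by (rule qpinf_nonzero[OF q2 power_mult_neq_1[OF q2 q2]])

lemma norm_powi_le:
  fixes y :: complex
  assumes "norm y \<le> B" "norm (1 / y) \<le> B"
  shows "norm (y powi n) \<le> B ^ nat \<bar>n\<bar>"
proof (cases "n \<ge> 0")
  case True
  hence "norm (y powi n) = norm y ^ nat n" by (simp add: power_int_def norm_power)
  also have "\<dots> \<le> B ^ nat n" using assms by (intro power_mono) auto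
  finally show ?thesis using True by simp
next
  case False
  hence "norm (y powi n) = norm (1 / y) ^ nat (- n)"
    by (simp add: power_int_def norm_power norm_divide norm_inverse inverse_eq_divide power_divide)
  also have "\<dots> \<le> B ^ nat (- n)" using assms by (intro power_mono) auto
  finally show ?thesis using False by simp
qed

lemma gauss_bound:
  assumes "B \<ge> 0"
  obtains C where "\<And>n::nat. norm q ^ (n ^ 2) * B ^ n \<le> C * (1 / 2) ^ n"
proof -
  define w where "w n = q ^ (n ^ 2) * complex_of_real (2 * B) ^ n" for n
  have "summable (\<lambda>n. norm (w n))"
  proof (rule summable_norm_ratio)
    show "w (Suc n) = (q\<^sup>2) ^ n * (q * complex_of_real (2 * B)) * w n" for n
      by (simp add: w_def power2_eq_square power_add power_mult_distrib mult_ac)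
    show "(\<lambda>n. (q\<^sup>2) ^ n * (q * complex_of_real (2 * B))) \<longlonglongrightarrow> 0 * (q * complex_of_real (2 * B))"
      by (intro tendsto_intros LIMSEQ_power_zero q2)
  qed simp
  hence "(\<lambda>n. norm (w n)) \<longlonglongrightarrow> 0" by (rule summable_LIMSEQ_zero)
  hence "Bseq (\<lambda>n. norm (w n))" by (intro convergent_imp_Bseq convergentI)
  then obtain C where C: "\<And>n. norm (w n) \<le> C" by (auto simp: Bseq_def)
  have "norm q ^ (n ^ 2) * B ^ n \<le> C * (1 / 2) ^ n" for n
  proof -
    have "norm (w n) = norm q ^ (n ^ 2) * B ^ n * 2 ^ n"
      using assms by (simp add: w_def norm_mult norm_power power_mult_distrib)
    thus ?thesis using C[of n] by (simp add: power_one_over field_simps)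
  qed
  thus ?thesis by (rule that)
qed

text \<open>Gaussian decay beats every exponential.\<close>

lemma gauss_summable:
  fixes f :: "int \<Rightarrow> complex"
  assumes "B \<ge> 0" "K \<ge> 0" "\<And>n. norm (f n) \<le> K * (norm q ^ nat (n * n) * B ^ nat \<bar>n\<bar>)"
  shows "f summable_on UNIV"
proof -
  obtain C where C: "\<And>n::nat. norm q ^ (n ^ 2) * B ^ n \<le> C * (1 / 2) ^ n"
    using gauss_bound[OF assms(1)] by blast
  have "norm (f n) \<le> (K * C) * (1 / 2) ^ nat \<bar>n\<bar>" for n
  proof -
    have "nat (n * n) = (nat \<bar>n\<bar>) ^ 2"
      by (metis abs_mult_self_eq nat_mult_distrib abs_ge_zero power2_eq_square)
    hence "norm (f n) \<le> K * (norm q ^ ((nat \<bar>n\<bar>) ^ 2) * B ^ nat \<bar>n\<bar>)"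
      using assms(3)[of n] by simp
    also have "\<dots> \<le> K * (C * (1 / 2) ^ nat \<bar>n\<bar>)"
      by (intro mult_left_mono C assms)
    finally show ?thesis by (simp add: mult.assoc)
  qed
  thus ?thesis by (rule summable_on_int_bound[rotated 2]) auto
qed

lemma gauss_term_summable:
  fixes g :: "int \<Rightarrow> complex" and y :: complex
  assumes "y \<noteq> 0" "\<And>n. norm (g n) \<le> K"
  shows "(\<lambda>n. q powi (n * n) * y powi n * g n) summable_on UNIV"
proof (rule gauss_summable)
  show "max (norm y) (norm (1 / y)) \<ge> 0" by (simp add: max_def)
  show "K \<ge> 0" using assms(2)[of 0] norm_ge_zero order_trans by blast
  fix n
  have "norm (q powi (n * n)) = norm q ^ nat (n * n)"
    by (simp add: power_int_def norm_power)
  moreover have "norm (y powi n) \<le> max (norm y) (norm (1 / y)) ^ nat \<bar>n\<bar>"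
    by (rule norm_powi_le) auto
  ultimately have "norm (q powi (n * n) * y powi n * g n)
      \<le> (norm q ^ nat (n * n) * max (norm y) (norm (1 / y)) ^ nat \<bar>n\<bar>) * K"
    unfolding norm_mult using assms(2)
    by (intro mult_mono mult_nonneg_nonneg zero_le_power) (auto simp: le_max_iff_disj)
  thus "norm (q powi (n * n) * y powi n * g n)
      \<le> K * (norm q ^ nat (n * n) * max (norm y) (norm (1 / y)) ^ nat \<bar>n\<bar>)"
    by (simp add: mult_ac)
qed

text \<open>The terms $(-1)^rq^{r(r-1)}z^r$ of Jacobi's theta series.\<close>

definition jterm :: "complex \<Rightarrow> int \<Rightarrow> complex" where
  "jterm z r = (- 1) powi r * q powi (r * (r - 1)) * z powi r"

definition jtheta :: "complex \<Rightarrow> complex" where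
  "jtheta z = infsum (jterm z) UNIV"

lemma jterm_summable:
  assumes "z \<noteq> 0"
  shows "jterm z summable_on UNIV"
proof -
  have "jterm z r = q powi (r * r) * (z / q) powi r * (- 1) powi r" for r
  proof -
    have "q powi (r * (r - 1)) = q powi (r * r) / q powi r"
      using q0 by (simp add: right_diff_distrib power_int_diff)
    thus ?thesis by (simp add: jterm_def power_int_divide_distrib mult_ac)
  qed
  hence "jterm z = (\<lambda>r. q powi (r * r) * (z / q) powi r * (- 1) powi r)" by (rule ext)
  moreover have "(\<lambda>r. q powi (r * r) * (z / q) powi r * (- 1) powi r) summable_on UNIV"
    by (rule gauss_term_summable[where K = 1]) (use q0 assms in \<open>auto simp: norm_power_int\<close>)
  ultimately show ?thesis by simp
qed

lemma jterm_has_sum: "z \<noteq> 0 \<Longrightarrow> (jterm z has_sum jtheta z) UNIV"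
  unfolding jtheta_def by (rule has_sum_infsum[OF jterm_summable])

text \<open>The common limit behind Jacobi's triple product and the partial fraction expansion of $1/j(z)$.\<close>

lemma bilateral_limit:
  assumes a: "a summable_on UNIV"
  shows "(\<lambda>N. \<Sum>k\<le>N + N. a (int k - int N) / (P k * P (N + N - k))) \<longlonglongrightarrow> infsum a UNIV / Pinf ^ 2"
proof -
  obtain B where B: "B > 0" "\<And>n. norm (1 / P n) \<le> B"
    using qpoch_inverse_bounded[OF q2 power_mult_neq_1[OF q2 q2]] by blast
  define f where "f N r = (if r \<in> {- int N..int N} then a r * (1 / (P (nat (int N + r)) * P (nat (int N - r)))) else 0)"
    for N r
  have fin: "infsum (f N) UNIV = (\<Sum>k\<le>N + N. a (int k - int N) / (P k * P (N + N - k)))" for N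
  proof -
    have "(f N has_sum (\<Sum>r\<in>{- int N..int N}. f N r)) UNIV"
      by (rule has_sum_finite_neutralI[where B = "{- int N..int N}"]) (auto simp: f_def)
    hence "infsum (f N) UNIV = (\<Sum>r\<in>{- int N..int N}. f N r)" by (rule infsumI)
    also have "\<dots> = (\<Sum>k\<le>N + N. a (int k - int N) / (P k * P (N + N - k)))"
    proof (rule sum.reindex_bij_witness[of _ "\<lambda>k. int k - int N" "\<lambda>r. nat (r + int N)"])
      fix r assume r: "r \<in> {- int N..int N}"
      have "nat (int N - r) = N + N - nat (r + int N)" using r by auto
      thus "a (int (nat (r + int N)) - int N) / (P (nat (r + int N)) * P (N + N - nat (r + int N))) = f N r"
        using r by (simp add: f_def add.commute)
    qed auto
    finally show ?thesis .
  qed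
  have "(\<lambda>N. infsum (f N) UNIV) \<longlonglongrightarrow> infsum (\<lambda>r. a r * (1 / (Pinf * Pinf))) UNIV"
  proof (rule tannery_int[where M = "\<lambda>r. norm (a r) * (B * B)"])
    fix r
    have t: "(\<lambda>N. P (nat (int N + s))) \<longlonglongrightarrow> Pinf" for s
    proof -
      have "filterlim (\<lambda>N. nat (int N + s)) at_top sequentially"
        unfolding filterlim_at_top eventually_sequentially
      proof
        fix Z :: nat
        show "\<exists>N. \<forall>n\<ge>N. Z \<le> nat (int n + s)"
          by (rule exI[of _ "Z + nat \<bar>s\<bar>"]) auto
      qed
      from filterlim_compose[OF qpoch_tendsto[OF q2] this] show ?thesis .
    qed
    have "(\<lambda>N. a r * (1 / (P (nat (int N + r)) * P (nat (int N - r))))) \<longlonglongrightarrow> a r * (1 / (Pinf * Pinf))"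
      using t[of r] t[of "- r"] Pinf_nz by (intro tendsto_intros) auto
    thus "(\<lambda>N. f N r) \<longlonglongrightarrow> a r * (1 / (Pinf * Pinf))"
    proof (rule Lim_transform_eventually)
      show "eventually (\<lambda>N. a r * (1 / (P (nat (int N + r)) * P (nat (int N - r)))) = f N r) sequentially"
        unfolding eventually_sequentially by (rule exI[of _ "nat \<bar>r\<bar>"]) (auto simp: f_def)
    qed
  next
    fix N r
    have "norm (a r * (1 / (P (nat (int N + r)) * P (nat (int N - r)))))
        = norm (a r) * (norm (1 / P (nat (int N + r))) * norm (1 / P (nat (int N - r))))"
      by (simp add: norm_mult norm_divide)
    also have "\<dots> \<le> norm (a r) * (B * B)"
      by (intro mult_left_mono mult_mono B) (use B in auto)
    finally show "norm (f N r) \<le> norm (a r) * (B * B)" using B by (simp add: f_def)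
  next
    show "(\<lambda>r. norm (a r) * (B * B)) summable_on UNIV"
      using a by (intro summable_on_cmult_left) (simp add: summable_on_iff_abs_summable_on_complex)
  qed
  moreover have "infsum (\<lambda>r. a r * (1 / (Pinf * Pinf))) UNIV = infsum a UNIV / Pinf ^ 2"
    using infsumI[OF has_sum_cmult_left[OF has_sum_infsum[OF a], of "1 / (Pinf * Pinf)"]]
    by (simp add: power2_eq_square del: times_divide_eq_right) simp
  ultimately show ?thesis unfolding fin by simp
qed

end

text \<open>Gauss's q-binomial theorem with base $q^2$, divided by $(q^2;q^2)_N$.\<close>

lemma q_binomial:
  fixes q z :: complex
  assumes q: "norm q < 1"
  shows "qpoch z (q\<^sup>2) N / qpoch (q\<^sup>2) (q\<^sup>2) N = (\<Sum>k\<le>N. (- 1) ^ k * q ^ (k * (k - 1)) * z ^ k /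
     (qpoch (q\<^sup>2) (q\<^sup>2) k * qpoch (q\<^sup>2) (q\<^sup>2) (N - k)))"
proof (induction N)
  case (Suc N)
  define P where "P = qpoch (q\<^sup>2) (q\<^sup>2)"
  define e where "e k = (- 1) ^ k * q ^ (k * (k - 1)) * z ^ k" for k
  define a where "a k = (if k \<le> N then e k / (P k * P (N - k)) else 0)" for k
  have q2: "norm (q\<^sup>2) < 1" by (rule norm_power2_less_1[OF q])
  have Pnz: "P r \<noteq> 0" for r using power_mult_neq_1[OF q2 q2] by (auto simp: P_def qpoch_eq_0_iff)
  define v where "v k = q ^ (2 * Suc k)" for k
  have vnz: "1 - v k \<noteq> 0" for k
    unfolding v_def using power_neq_1[OF q, of "2 * Suc k"] by simp
  have PSuc: "P (Suc r) = P r * (1 - v r)" for r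
    by (simp add: P_def qpoch_Suc v_def power_mult[symmetric] power_add[symmetric])
  have e_Suc: "e (Suc k) = - (z * q ^ (2 * k)) * e k" for k
  proof -
    have "Suc k * (Suc k - 1) = 2 * k + k * (k - 1)" by (cases k) auto
    hence "q ^ (Suc k * (Suc k - 1)) = q ^ (2 * k) * q ^ (k * (k - 1))" by (simp only: power_add)
    thus ?thesis unfolding e_def by (simp del: diff_Suc_1)
  qed
  have coeff: "a k - q ^ (2 * N) * (if k = 0 then 0 else z * a (k - 1)) = (1 - v N) * (e k / (P k * P (Suc N - k)))"
    if k: "k \<le> Suc N" for k
  proof (cases k)
    case 0
    show ?thesis using vnz[of N] by (simp add: 0 a_def PSuc)
  next
    case (Suc s)
    show ?thesis
    proof (cases "s = N")
      case True
      show ?thesis using vnz[of N] Pnz by (simp add: Suc True a_def PSuc e_Suc)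
    next
      case False
      define m where "m = N - Suc s"
      have N: "N = s + m + 1" using False Suc k by (simp add: m_def)
      have Nm: "Suc s \<le> N" "s \<le> N" "N - Suc s = m" "N - s = Suc m" "Suc N - Suc s = Suc m"
        using N by auto
      have h1: "a k = - (z * q ^ (2 * s)) * e s / (P s * (1 - v s) * P m)"
        unfolding Suc using Nm by (simp add: a_def PSuc e_Suc)
      have h2: "(if k = 0 then 0 else z * a (k - 1)) = z * (e s / (P s * (P m * (1 - v m))))"
        unfolding Suc using Nm by (simp add: a_def PSuc)
      have h3: "e k / (P k * P (Suc N - k)) = - (z * q ^ (2 * s)) * e s / (P s * (1 - v s) * (P m * (1 - v m)))"
        unfolding Suc Nm(5) by (simp add: PSuc e_Suc)
      have h4: "v N = v m * v s" "q ^ (2 * N) = v m * q ^ (2 * s)"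
        unfolding v_def N by (simp_all add: power_add[symmetric] add_ac)
      have "1 / (1 - v s) + v m / (1 - v m) = (1 - v m * v s) / ((1 - v s) * (1 - v m))"
        using vnz[of s] vnz[of m] by (simp add: add_frac_eq algebra_simps)
      moreover have "a k - q ^ (2 * N) * (if k = 0 then 0 else z * a (k - 1))
          = - (z * q ^ (2 * s)) * e s / (P s * P m) * (1 / (1 - v s) + v m / (1 - v m))"
        unfolding h1 h2 h4(2) distrib_left by (simp add: mult_ac)
      ultimately show ?thesis unfolding h3 h4(1) by (simp add: mult_ac)
    qed
  qed
  have IH: "qpoch z (q\<^sup>2) N / P N = (\<Sum>k\<le>N. a k)"
    using Suc.IH by (simp add: a_def e_def P_def)
  have "(1 - v N) * (qpoch z (q\<^sup>2) (Suc N) / P (Suc N)) = (1 - q ^ (2 * N) * z) * (qpoch z (q\<^sup>2) N / P N)"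
    using vnz[of N] by (simp add: PSuc qpoch_Suc power_mult[symmetric] mult_ac)
  also have "\<dots> = (\<Sum>k\<le>N. a k) - q ^ (2 * N) * (z * (\<Sum>k\<le>N. a k))"
    unfolding IH by (simp add: algebra_simps)
  also have "(\<Sum>k\<le>N. a k) = (\<Sum>k\<le>Suc N. a k)" by (simp add: a_def)
  also have "(\<Sum>k\<le>Suc N. a k) - q ^ (2 * N) * (z * (\<Sum>k\<le>Suc N. a k))
      = (\<Sum>k\<le>Suc N. a k - q ^ (2 * N) * (if k = 0 then 0 else z * a (k - 1)))"
  proof -
    have "z * (\<Sum>k\<le>Suc N. a k) = (\<Sum>k\<le>Suc N. if k = 0 then 0 else z * a (k - 1))"
    proof -
      have "(\<Sum>k\<le>Suc N. if k = 0 then 0 else z * a (k - 1)) = z * (\<Sum>k\<le>N. a k)"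
        unfolding sum.atMost_Suc_shift by (simp add: sum_distrib_left)
      moreover have "(\<Sum>k\<le>Suc N. a k) = (\<Sum>k\<le>N. a k)" by (simp add: a_def)
      ultimately show ?thesis by simp
    qed
    thus ?thesis unfolding sum_subtractf sum_distrib_left[symmetric] by simp
  qed
  also have "\<dots> = (\<Sum>k\<le>Suc N. (1 - v N) * (e k / (P k * P (Suc N - k))))"
    by (intro sum.cong refl coeff) simp
  finally show ?case
    using vnz[of N] unfolding sum_distrib_left[symmetric] mult_cancel_left by (simp add: e_def P_def)
qed simp

lemma minus_one_powi_diff: "(- 1) powi (int k - int m) = ((- 1) ^ (k + m) :: complex)"
proof -
  have "(- 1) powi (int k - int m) = ((- 1) ^ k / (- 1) ^ m :: complex)"
    by (simp add: power_int_diff)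
  also have "\<dots> = (- 1) ^ k * (- 1) ^ m"
    by (simp add: minus_one_power_iff)
  finally show ?thesis by (simp add: power_add)
qed

context nome
begin

text \<open>The q-binomial theorem with $2N$ factors, centred at the middle factor.\<close>

lemma finite_triple_product:
  assumes z: "z \<noteq> 0"
  shows "qpoch z (q\<^sup>2) N * qpoch (q\<^sup>2 / z) (q\<^sup>2) N / P (N + N)
    = (\<Sum>k\<le>N + N. jterm z (int k - int N) / (P k * P (N + N - k)))"
proof -
  define y where "y = z / (q\<^sup>2) ^ N"
  define c where "c = (- z) ^ N / q ^ (N * (N + 1))"
  have c0: "c \<noteq> 0" using z q0 by (simp add: c_def)
  have sum: "(\<Sum>i\<le>N. i) * 2 = N * (N + 1)" by (induction N) auto
  have "qpoch y (q\<^sup>2) (N + N) = qpoch y (q\<^sup>2) N * qpoch z (q\<^sup>2) N"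
    using qpoch_add[of y "q\<^sup>2" N N] q0 by (simp add: y_def)
  moreover have "qpoch y (q\<^sup>2) N * q ^ (N * (N + 1)) = (- z) ^ N * qpoch (q\<^sup>2 / z) (q\<^sup>2) N"
    using qpoch_shift_down[of "q\<^sup>2" z N] q0 z unfolding y_def power_mult[symmetric] sum[symmetric]
    by (simp add: mult.commute)
  hence "qpoch y (q\<^sup>2) N = c * qpoch (q\<^sup>2 / z) (q\<^sup>2) N"
    using q0 by (simp add: c_def field_simps)
  ultimately have D: "qpoch z (q\<^sup>2) N * qpoch (q\<^sup>2 / z) (q\<^sup>2) N = 1 / c * qpoch y (q\<^sup>2) (N + N)"
    using c0 by simp
  have "qpoch z (q\<^sup>2) N * qpoch (q\<^sup>2 / z) (q\<^sup>2) N / P (N + N) = 1 / c * (qpoch y (q\<^sup>2) (N + N) / P (N + N))"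
    unfolding D by simp
  also have "\<dots> = (\<Sum>k\<le>N + N. jterm z (int k - int N) / (P k * P (N + N - k)))"
    unfolding q_binomial[OF q1] sum_distrib_left
  proof (rule sum.cong[OF refl])
    fix k
    have "(int k - int N) * (int k - int N - 1) = int (k * (k - 1)) + int (N * (N + 1)) - int (2 * N * k)"
      by (cases k) (simp_all add: algebra_simps)
    hence qq: "q powi ((int k - int N) * (int k - int N - 1)) = q ^ (k * (k - 1)) * q ^ (N * (N + 1)) / q ^ (2 * N * k)"
      using q0 by (simp add: power_int_add power_int_diff del: of_nat_add of_nat_mult)
    have zz: "z powi (int k - int N) = z ^ k / z ^ N"
      using z by (simp add: power_int_diff)
    have yk: "y ^ k = z ^ k / q ^ (2 * N * k)"
      by (simp add: y_def power_divide power_mult)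
    have sg: "1 / (- z) ^ N = (- 1) ^ N / z ^ N"
      using z by (simp add: power_minus[of z] minus_one_power_iff)
    have "jterm z (int k - int N) = 1 / c * ((- 1) ^ k * q ^ (k * (k - 1)) * y ^ k)"
    proof -
      have "1 / c = q ^ (N * (N + 1)) * (1 / (- z) ^ N)" by (simp add: c_def)
      thus ?thesis
        unfolding jterm_def minus_one_powi_diff qq zz yk sg by (simp add: power_add mult_ac)
    qed
    thus "1 / c * ((- 1) ^ k * q ^ (k * (k - 1)) * y ^ k / (P k * P (N + N - k)))
        = jterm z (int k - int N) / (P k * P (N + N - k))" by simp
  qed
  finally show ?thesis .
qed

lemma P_double_tendsto: "(\<lambda>N. P (N + N)) \<longlonglongrightarrow> Pinf"
proof -
  have "strict_mono (\<lambda>N::nat. N + N)" by (auto simp: strict_mono_def)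
  from LIMSEQ_subseq_LIMSEQ[OF qpoch_tendsto[OF q2] this] show ?thesis by (simp add: o_def)
qed

theorem jacobi_triple_product:
  assumes z: "z \<noteq> 0"
  shows "jtheta z = Pinf * qpinf z (q\<^sup>2) * qpinf (q\<^sup>2 / z) (q\<^sup>2)"
proof -
  have "(\<lambda>N. qpoch z (q\<^sup>2) N * qpoch (q\<^sup>2 / z) (q\<^sup>2) N / P (N + N))
      \<longlonglongrightarrow> qpinf z (q\<^sup>2) * qpinf (q\<^sup>2 / z) (q\<^sup>2) / Pinf"
    by (intro tendsto_intros qpoch_tendsto q2 P_double_tendsto Pinf_nz)
  moreover have "(\<lambda>N. qpoch z (q\<^sup>2) N * qpoch (q\<^sup>2 / z) (q\<^sup>2) N / P (N + N)) \<longlonglongrightarrow> jtheta z / Pinf ^ 2"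
    unfolding finite_triple_product[OF z] jtheta_def by (rule bilateral_limit[OF jterm_summable[OF z]])
  ultimately have "qpinf z (q\<^sup>2) * qpinf (q\<^sup>2 / z) (q\<^sup>2) / Pinf = jtheta z / Pinf ^ 2"
    by (rule LIMSEQ_unique)
  thus ?thesis using Pinf_nz by (simp add: field_simps power2_eq_square)
qed

lemma powi_double: "q powi (2 * int n) = (q\<^sup>2) ^ n" "q powi (2 * (- int n)) = 1 / (q\<^sup>2) ^ n"
proof -
  have 1: "2 * int n = int (2 * n)" "2 * (- int n) = - int (2 * n)" by simp_all
  show "q powi (2 * int n) = (q\<^sup>2) ^ n" unfolding 1 power_int_of_nat power_mult ..
  show "q powi (2 * (- int n)) = 1 / (q\<^sup>2) ^ n"
    unfolding 1 power_int_minus_divide power_int_of_nat power_mult ..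
qed

lemma jtheta_power_eq_0: "jtheta (q powi (2 * n)) = 0"
proof -
  have z: "qpinf (1 / (q\<^sup>2) ^ k) (q\<^sup>2) = 0" for k
  proof -
    have "qpoch (1 / (q\<^sup>2) ^ k) (q\<^sup>2) (Suc k) = 0" using q0 by (simp add: qpoch_Suc)
    thus ?thesis using qpoch_mult_qpinf[OF q2, of "1 / (q\<^sup>2) ^ k" "Suc k"] by simp
  qed
  have nz: "q powi (2 * n) \<noteq> 0" using q0 by simp
  show ?thesis
  proof (cases "n \<le> 0")
    case True
    hence "q powi (2 * n) = q powi (- int (2 * nat (- n)))" by simp
    also have "\<dots> = 1 / (q\<^sup>2) ^ nat (- n)"
      unfolding power_int_minus_divide power_int_of_nat by (simp add: power_mult)
    finally show ?thesis using jacobi_triple_product[OF nz] z by simp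
  next
    case False
    define k where "k = nat (n - 1)"
    have "2 * n = int (2 * Suc k)" using False by (simp add: k_def)
    hence "q powi (2 * n) = q ^ (2 * Suc k)" by (simp only: power_int_of_nat)
    hence "q\<^sup>2 / q powi (2 * n) = 1 / (q\<^sup>2) ^ k"
      unfolding power_mult[symmetric] using q0 by (simp add: power2_eq_square)
    thus ?thesis using jacobi_triple_product[OF nz] z by simp
  qed
qed

section \<open>Simple poles at the powers of the base\<close>

text \<open>The points $z\ne0$ at which no factor $1-q^{2i}z$, $i\in\mathbb{Z}$, vanishes; they are not zeros of $j(z)$.\<close>

definition regular :: "complex \<Rightarrow> bool" where
  "regular z \<longleftrightarrow> z \<noteq> 0 \<and> (\<forall>i::int. q powi (2 * i) * z \<noteq> 1)"

lemma regularD: "regular z \<Longrightarrow> z \<noteq> 0" "regular z \<Longrightarrow> q powi (2 * i) * z \<noteq> 1"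
  by (auto simp: regular_def)

lemma regular_minus_1: "regular (- 1)"
  unfolding regular_def using minus_power_int_neq_1[OF q0 q1] by simp

lemma regular_q: "regular q"
proof -
  have "q powi (2 * i) * q \<noteq> 1" for i
  proof -
    have "q powi (2 * i) * q = q powi (2 * i + 1)" using q0 by (simp add: power_int_add)
    also have "\<dots> \<noteq> 1" by (rule power_int_neq_1[OF q0 q1]) presburger
    finally show ?thesis .
  qed
  thus ?thesis using q0 by (simp add: regular_def)
qed

lemma jtheta_nonzero:
  assumes "regular z"
  shows "jtheta z \<noteq> 0"
proof -
  have "(q\<^sup>2) ^ i * z \<noteq> 1" for i
    using power_int_neq_1I regularD(2)[OF assms] by blast
  moreover have "(q\<^sup>2) ^ i * (q\<^sup>2 / z) \<noteq> 1" for i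
  proof
    assume a: "(q\<^sup>2) ^ i * (q\<^sup>2 / z) = 1"
    have "q powi (2 * (- int (Suc i))) = 1 / (q\<^sup>2) ^ Suc i"
      by (rule powi_double)
    moreover have "z = (q\<^sup>2) ^ Suc i" using a regularD(1)[OF assms] by (simp add: field_simps)
    ultimately have "q powi (2 * (- int (Suc i))) * z = 1" using q0 by simp
    thus False using regularD(2)[OF assms] by blast
  qed
  ultimately show ?thesis
    unfolding jacobi_triple_product[OF regularD(1)[OF assms]]
    using Pinf_nz qpinf_nonzero[OF q2] by simp
qed

text \<open>The second bound records the decay of $1/(1-q^{2r}z)$ as $r\to-\infty$.\<close>

lemma pole_bound:
  assumes z: "regular z"
  shows "\<exists>C>0. \<forall>r. norm (1 / (1 - q powi (2 * r) * z)) \<le> C \<and>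
    norm (1 / (1 - q powi (2 * r) * z)) \<le> C / norm q powi (2 * r)"
proof -
  have p0: "(\<lambda>n. (q\<^sup>2) ^ n) \<longlonglongrightarrow> 0" by (rule LIMSEQ_power_zero[OF q2])
  have "(\<lambda>n. 1 / (1 - (q\<^sup>2) ^ n * z)) \<longlonglongrightarrow> 1 / (1 - 0 * z)"
    by (intro tendsto_intros p0) simp
  from convergent_imp_Bseq[OF convergentI[OF this]] obtain C1
    where C1: "C1 > 0" "\<And>n. norm (1 / (1 - (q\<^sup>2) ^ n * z)) \<le> C1" by (auto simp: Bseq_def)
  have "(\<lambda>n. 1 / (z * ((q\<^sup>2) ^ n / z - 1))) \<longlonglongrightarrow> 1 / (z * (0 / z - 1))"
    using regularD(1)[OF z] by (intro tendsto_intros p0) simp_all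
  from convergent_imp_Bseq[OF convergentI[OF this]] obtain C2
    where C2: "C2 > 0" "\<And>n. norm (1 / (z * ((q\<^sup>2) ^ n / z - 1))) \<le> C2" by (auto simp: Bseq_def)
  define C where "C = max C1 C2"
  have b1: "norm (1 / (1 - q powi (2 * int n) * z)) \<le> C" for n
  proof -
    have "q powi (2 * int n) = (q\<^sup>2) ^ n" by (simp add: power_int_mult)
    thus ?thesis using C1(2)[of n] by (simp add: C_def)
  qed
  have b2: "norm (1 / (1 - q powi (2 * (- int n)) * z)) \<le> C * norm q ^ (2 * n)" for n
  proof -
    define X where "X = (q\<^sup>2) ^ n"
    have nz: "X \<noteq> 0" "z \<noteq> 0" using q0 regularD(1)[OF z] by (simp_all add: X_def)
    have "z * (X / z - 1) = X - z" "1 - 1 / X * z = (X - z) / X"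
      using nz by (simp_all add: right_diff_distrib diff_divide_distrib)
    hence "1 / (1 - q powi (2 * (- int n)) * z) = X * (1 / (z * (X / z - 1)))"
      unfolding powi_double X_def[symmetric] by simp
    hence "norm (1 / (1 - q powi (2 * (- int n)) * z)) = norm q ^ (2 * n) * norm (1 / (z * ((q\<^sup>2) ^ n / z - 1)))"
      unfolding X_def by (simp only: norm_mult norm_power power_mult)
    also have "\<dots> \<le> norm q ^ (2 * n) * C"
      using C2(2)[of n] by (intro mult_left_mono) (auto simp: C_def)
    finally show ?thesis by (simp add: mult.commute)
  qed
  have C0: "C > 0" using C1 by (simp add: C_def)
  have le1: "norm q ^ (2 * n) \<le> 1" for n using q1 by (intro power_le_one) auto
  have "norm (1 / (1 - q powi (2 * r) * z)) \<le> C \<and> norm (1 / (1 - q powi (2 * r) * z)) \<le> C / norm q powi (2 * r)" for r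
  proof (cases "r \<ge> 0")
    case True
    then obtain n where n: "r = int n" using nonneg_int_cases by blast
    have e: "norm q powi (2 * r) = norm q ^ (2 * n)" unfolding n by (simp add: power_int_mult power_mult)
    have "C * norm q ^ (2 * n) \<le> C * 1" using le1[of n] C0 by (intro mult_left_mono) auto
    hence "C \<le> C / norm q powi (2 * r)" unfolding e using nq by (simp add: pos_le_divide_eq)
    thus ?thesis using b1[of n] n by auto
  next
    case False
    define n where "n = nat (- r)"
    have n: "r = - int n" using False by (simp add: n_def)
    have "norm q powi (2 * r) = 1 / norm q ^ (2 * n)"
      unfolding n mult_minus_right power_int_minus_divide power_int_mult by (simp add: power_mult)
    moreover have "C * norm q ^ (2 * n) \<le> C * 1" using le1[of n] C0 by (intro mult_left_mono) auto
    ultimately show ?thesis using b2[of n] n by simp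
  qed
  with C0 show ?thesis by blast
qed

text \<open>For $n\in\mathbb{Z}$ the series below equals $z^n(q^2;q^2)_\infty^3/j(z)$: these are the partial fraction
  expansions of $z^n/j(z)$.\<close>

definition eterm :: "int \<Rightarrow> complex \<Rightarrow> int \<Rightarrow> complex" where
  "eterm n z r = (- 1) powi r * q powi (r * (r + 1) - 2 * n * r) / (1 - q powi (2 * r) * z)"

lemma eterm_summable:
  assumes z: "regular z"
  shows "eterm n z summable_on UNIV"
proof -
  obtain C where C: "C > 0" "\<And>r. norm (1 / (1 - q powi (2 * r) * z)) \<le> C"
    using pole_bound[OF z] by blast
  have "eterm n z r = q powi (r * r) * (q powi (1 - 2 * n)) powi r * ((- 1) powi r * (1 / (1 - q powi (2 * r) * z)))" for r
  proof -
    have "r * (r + 1) - 2 * n * r = r * r + (1 - 2 * n) * r" by (simp add: algebra_simps)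
    moreover have "q powi (r * r + (1 - 2 * n) * r) = q powi (r * r) * q powi ((1 - 2 * n) * r)"
      by (rule power_int_add) (use q0 in simp)
    moreover have "q powi ((1 - 2 * n) * r) = (q powi (1 - 2 * n)) powi r"
      by (rule power_int_mult)
    ultimately have "q powi (r * (r + 1) - 2 * n * r) = q powi (r * r) * (q powi (1 - 2 * n)) powi r"
      by (simp only:)
    thus ?thesis by (simp add: eterm_def mult_ac)
  qed
  hence "eterm n z = (\<lambda>r. q powi (r * r) * (q powi (1 - 2 * n)) powi r * ((- 1) powi r * (1 / (1 - q powi (2 * r) * z))))"
    by (rule ext)
  moreover have "(\<lambda>r. q powi (r * r) * (q powi (1 - 2 * n)) powi r * ((- 1) powi r * (1 / (1 - q powi (2 * r) * z)))) summable_on UNIV"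
  proof (rule gauss_term_summable)
    have "norm ((- 1) powi r * (1 / (1 - q powi (2 * r) * z))) = norm (1 / (1 - q powi (2 * r) * z))" for r
      by (simp only: norm_mult norm_power_int norm_minus_cancel norm_one power_int_1_left mult_1)
    thus "norm ((- 1) powi r * (1 / (1 - q powi (2 * r) * z))) \<le> C" for r
      using C(2)[of r] by (simp only:)
    show "q powi (1 - 2 * n) \<noteq> 0" using q0 by (simp only: power_int_eq_0_iff not_False_eq_True simp_thms)
  qed
  ultimately show ?thesis by (simp only:)
qed

definition E :: "int \<Rightarrow> complex \<Rightarrow> complex" where
  "E n z = infsum (eterm n z) UNIV"

lemma eterm_has_sum: "regular z \<Longrightarrow> (eterm n z has_sum E n z) UNIV"
  unfolding E_def by (rule has_sum_infsum[OF eterm_summable])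

theorem E_0:
  assumes z: "regular z"
  shows "E 0 z = Pinf ^ 3 / jtheta z"
proof -
  have z0: "z \<noteq> 0" by (rule regularD(1)[OF z])
  have pf: "1 / (qpoch z (q\<^sup>2) (Suc N) * qpoch (q\<^sup>2 / z) (q\<^sup>2) N)
      = (\<Sum>k\<le>N + N. eterm 0 z (int k - int N) / (P k * P (N + N - k)))" for N
    unfolding partial_fractions_bilateral[OF q0 q1 z0 regularD(2)[OF z]]
    by (intro sum.cong refl) (simp add: eterm_def minus_one_powi_diff)
  have nz: "qpinf z (q\<^sup>2) \<noteq> 0" "qpinf (q\<^sup>2 / z) (q\<^sup>2) \<noteq> 0"
    using jtheta_nonzero[OF z] unfolding jacobi_triple_product[OF z0] by auto
  have "(\<lambda>N. 1 / (qpoch z (q\<^sup>2) (Suc N) * qpoch (q\<^sup>2 / z) (q\<^sup>2) N))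
      \<longlonglongrightarrow> 1 / (qpinf z (q\<^sup>2) * qpinf (q\<^sup>2 / z) (q\<^sup>2))"
    using nz by (intro tendsto_intros LIMSEQ_Suc qpoch_tendsto q2) auto
  moreover have "(\<lambda>N. 1 / (qpoch z (q\<^sup>2) (Suc N) * qpoch (q\<^sup>2 / z) (q\<^sup>2) N)) \<longlonglongrightarrow> E 0 z / Pinf ^ 2"
    unfolding pf E_def by (rule bilateral_limit[OF eterm_summable[OF z]])
  ultimately have "1 / (qpinf z (q\<^sup>2) * qpinf (q\<^sup>2 / z) (q\<^sup>2)) = E 0 z / Pinf ^ 2"
    by (rule LIMSEQ_unique)
  thus ?thesis
    unfolding jacobi_triple_product[OF z0] using nz Pinf_nz
    by (simp add: field_simps power2_eq_square power3_eq_cube)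
qed

lemma E_nonzero: "regular z \<Longrightarrow> E 0 z \<noteq> 0"
  using Pinf_nz jtheta_nonzero by (simp add: E_0)

text \<open>Clearing the denominator in the difference of both sides leaves $j(q^{-2n})=0$.\<close>

lemma E_step:
  assumes z: "regular z"
  shows "E (n + 1) z = z * E n z"
proof -
  have "eterm (n + 1) z r - z * eterm n z r = jterm (q powi (2 * (- n))) r" for r
  proof -
    have nz: "1 - q powi (2 * r) * z \<noteq> 0" using regularD(2)[OF z] by simp
    define A where "A = q powi (r * (r + 1) - 2 * (n + 1) * r)"
    have "q powi (r * (r + 1) - 2 * n * r) = q powi ((r * (r + 1) - 2 * (n + 1) * r) + 2 * r)"
      by (intro arg_cong[where f = "\<lambda>k. q powi k"]) (simp add: algebra_simps)
    hence B: "q powi (r * (r + 1) - 2 * n * r) = A * q powi (2 * r)"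
      unfolding A_def using q0 by (subst (asm) power_int_add) simp_all
    have "q powi (r * (r - 1)) * (q powi (2 * (- n))) powi r = q powi (r * (r - 1) + 2 * (- n) * r)"
      unfolding power_int_mult[of q "2 * (- n)" r, symmetric] using q0 by (subst power_int_add) simp_all
    also have "r * (r - 1) + 2 * (- n) * r = r * (r + 1) - 2 * (n + 1) * r" by (simp add: algebra_simps)
    finally have J: "jterm (q powi (2 * (- n))) r = (- 1) powi r * A"
      unfolding jterm_def A_def mult.assoc by (rule arg_cong)
    have "eterm (n + 1) z r - z * eterm n z r = (- 1) powi r * A * (1 - q powi (2 * r) * z) / (1 - q powi (2 * r) * z)"
      unfolding eterm_def B unfolding A_def[symmetric] by (simp add: diff_divide_distrib right_diff_distrib mult_ac)
    thus ?thesis unfolding J using nz by simp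
  qed
  moreover have "((\<lambda>r. eterm (n + 1) z r - z * eterm n z r) has_sum (E (n + 1) z - z * E n z)) UNIV"
    using has_sum_add[OF eterm_has_sum[OF z, of "n + 1"] has_sum_cmult_right[OF eterm_has_sum[OF z, of n], of "- z"]]
    by simp
  moreover have "(jterm (q powi (2 * (- n))) has_sum 0) UNIV"
    using jterm_has_sum[of "q powi (2 * (- n))"] jtheta_power_eq_0[of "- n"] q0 by simp
  ultimately have "E (n + 1) z - z * E n z = 0" by (simp only: has_sum_unique)
  thus ?thesis by simp
qed

theorem E_eq:
  assumes z: "regular z"
  shows "E n z = z powi n * E 0 z"
proof (induction n rule: int_induct[where k = 0])
  case base show ?case by simp
next
  case (step1 i)
  thus ?case using E_step[OF z, of i] regularD(1)[OF z] by (simp add: power_int_add_1')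
next
  case (step2 i)
  have "z * E (i - 1) z = z powi i * E 0 z"
    using E_step[OF z, of "i - 1"] step2 by simp
  also have "z powi i = z powi (i - 1) * z"
    using power_int_minus_mult[of z i] regularD(1)[OF z] by simp
  finally have "z * E (i - 1) z = z * (z powi (i - 1) * E 0 z)" by (simp only: mult_ac)
  thus ?case using regularD(1)[OF z] by simp
qed

end

text \<open>Only the limits at both ends survive, each counted \<open>d\<close> times.\<close>

lemma has_sum_telescope_int:
  fixes h :: "int \<Rightarrow> complex"
  assumes s: "(\<lambda>t. h t - h (t + 1)) summable_on UNIV"
    and top: "(\<lambda>n. h (int n)) \<longlonglongrightarrow> A" and bot: "(\<lambda>n. h (- int n)) \<longlonglongrightarrow> B"
  shows "((\<lambda>t. h t - h (t + d)) has_sum (of_int d * (B - A))) UNIV"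
proof -
  define g where "g t = h t - h (t + 1)" for t
  have g: "(g has_sum infsum g UNIV) UNIV"
    using s unfolding g_def by (rule has_sum_infsum)
  have "(\<lambda>n. g (int n) + g (- 1 - int n)) sums infsum g UNIV" by (rule has_sum_int_fold[OF g])
  moreover have "(\<Sum>n<N. g (int n) + g (- 1 - int n)) = h (- int N) - h (int N)" for N
    by (induction N) (simp_all add: g_def algebra_simps)
  moreover have "(\<lambda>N. h (- int N) - h (int N)) \<longlonglongrightarrow> B - A" by (intro tendsto_diff top bot)
  ultimately have "infsum g UNIV = B - A"
    unfolding sums_def using LIMSEQ_unique by simp
  hence 1: "(g has_sum (B - A)) UNIV" using g by simp
  show ?thesis
  proof (induction d rule: int_induct[where k = 0])
    case base show ?case by simp
  next
    case (step1 d)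
    have "((\<lambda>t. (h t - h (t + d)) + g (t + d)) has_sum (of_int d * (B - A) + (B - A))) UNIV"
      by (intro has_sum_add step1 has_sum_shift_int[THEN iffD2, OF 1])
    thus ?case by (simp add: g_def algebra_simps)
  next
    case (step2 d)
    have "((\<lambda>t. (h t - h (t + d)) + (- 1) * g (t + (d - 1))) has_sum (of_int d * (B - A) + (- 1) * (B - A))) UNIV"
      by (intro has_sum_add step2 has_sum_cmult_right has_sum_shift_int[THEN iffD2, OF 1])
    thus ?case by (simp add: g_def algebra_simps)
  qed
qed

context nome
begin

section \<open>Products and squares of partial fraction series\<close>

text \<open>The factor $q^{2t}z$ attached to the index \<open>t\<close>.\<close>

definition w :: "complex \<Rightarrow> int \<Rightarrow> complex" where
  "w z t = q powi (2 * t) * z"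

lemma w_neq_1: "regular z \<Longrightarrow> 1 - w z t \<noteq> 0"
  using regularD(2) by (simp add: w_def)

lemma w_add: "w z (t + d) = q powi (2 * d) * w z t"
  using q0 by (simp add: w_def distrib_left power_int_add mult_ac)

lemma powi_2_neq_1: "d \<noteq> 0 \<Longrightarrow> 1 - q powi (2 * d) \<noteq> 0"
  using power_int_neq_1[OF q0 q1, of "2 * d"] by simp

text \<open>The exponential decay in \<open>t\<close> is bought with a growth in \<open>d\<close> that the Gaussian weights $q^{d(d+1)}$
  absorb.\<close>

lemma double_pole_bound:
  assumes z: "regular z"
  shows "\<exists>C>0. \<forall>t d. norm (w z t / ((1 - w z t) * (1 - w z (t + d))))
     \<le> C * (norm q ^ (2 * nat \<bar>t\<bar>) / norm q ^ (2 * nat \<bar>d\<bar>))"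
proof -
  from pole_bound[OF z] obtain C where C0: "C > 0" and C: "\<And>r. norm (1 / (1 - w z r)) \<le> C"
    and C': "\<And>r. norm (1 / (1 - w z r)) \<le> C / norm q powi (2 * r)"
    unfolding w_def by blast
  define D where "D = max (C * norm z * C) ((C + 1) * C)"
  have D: "C * norm z * C \<le> D" "(C + 1) * C \<le> D" "D > 0"
    using C0 by (auto simp: D_def less_max_iff_disj)
  have pow: "norm q powi (2 * r) = (if r \<ge> 0 then norm q ^ (2 * nat r) else 1 / norm q ^ (2 * nat (- r)))" for r
  proof (cases "r \<ge> 0")
    case True
    hence "2 * r = int (2 * nat r)" by simp
    thus ?thesis using True by (metis power_int_of_nat)
  next
    case False
    hence "2 * r = - int (2 * nat (- r))" by simp
    hence "norm q powi (2 * r) = norm q powi (- int (2 * nat (- r)))" by (rule arg_cong)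
    also have "\<dots> = 1 / norm q ^ (2 * nat (- r))" unfolding power_int_minus_divide power_int_of_nat ..
    finally show ?thesis using False by simp
  qed
  have le1: "norm q ^ n \<le> 1" for n using q1 by (intro power_le_one) auto
  have pos: "norm q ^ n > 0" for n using nq by simp
  have "norm (w z t / ((1 - w z t) * (1 - w z (t + d)))) \<le> D * (norm q ^ (2 * nat \<bar>t\<bar>) / norm q ^ (2 * nat \<bar>d\<bar>))" for t d
  proof (cases "t \<ge> 0")
    case True
    have "norm (w z t / ((1 - w z t) * (1 - w z (t + d)))) = norm (w z t) * (norm (1 / (1 - w z t)) * norm (1 / (1 - w z (t + d))))"
      by (simp add: norm_mult norm_divide)
    also have "\<dots> \<le> norm (w z t) * (C * C)"
      using C0 by (intro mult_left_mono mult_mono C) auto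
    also have "norm (w z t) = norm q ^ (2 * nat \<bar>t\<bar>) * norm z"
      using True by (simp add: w_def norm_mult norm_power_int pow)
    also have "norm q ^ (2 * nat \<bar>t\<bar>) * norm z * (C * C) = norm q ^ (2 * nat \<bar>t\<bar>) * (C * norm z * C)"
      by (simp add: mult_ac)
    also have "\<dots> \<le> norm q ^ (2 * nat \<bar>t\<bar>) * D" by (intro mult_left_mono D) simp
    also have "\<dots> \<le> norm q ^ (2 * nat \<bar>t\<bar>) * D / norm q ^ (2 * nat \<bar>d\<bar>)"
      using le1 pos D(3) by (simp add: pos_le_divide_eq mult_left_le)
    finally show ?thesis by (simp add: mult_ac)
  next
    case False
    have "w z t / (1 - w z t) = 1 / (1 - w z t) - 1"
      using w_neq_1[OF z, of t] by (simp add: field_simps)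
    hence "norm (w z t / (1 - w z t)) \<le> norm (1 / (1 - w z t)) + norm (1 :: complex)"
      by (simp only: norm_triangle_ineq4)
    hence 1: "norm (w z t / (1 - w z t)) \<le> C + 1" using C[of t] by simp
    have "norm (1 / (1 - w z (t + d))) \<le> C / norm q powi (2 * (t + d))" by (rule C')
    also have "\<dots> = C * norm q ^ (2 * nat \<bar>t\<bar>) / norm q powi (2 * d)"
    proof -
      have "norm q powi (2 * (t + d)) = norm q powi (2 * t) * norm q powi (2 * d)"
        using nq by (simp add: distrib_left power_int_add)
      thus ?thesis using False by (simp add: pow[of t])
    qed
    also have "\<dots> \<le> C * norm q ^ (2 * nat \<bar>t\<bar>) / norm q ^ (2 * nat \<bar>d\<bar>)"
    proof (rule divide_left_mono)
      show "norm q ^ (2 * nat \<bar>d\<bar>) \<le> norm q powi (2 * d)"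
      proof (cases "d \<ge> 0")
        case False
        have "norm q ^ (2 * nat (- d)) * norm q ^ (2 * nat (- d)) \<le> 1 * 1"
          by (intro mult_mono le1) auto
        thus ?thesis using False pos by (simp add: pow pos_le_divide_eq)
      qed (simp add: pow)
      show "0 < norm q powi (2 * d) * norm q ^ (2 * nat \<bar>d\<bar>)" using nq by simp
    qed (use C0 in simp)
    finally have 2: "norm (1 / (1 - w z (t + d))) \<le> C * norm q ^ (2 * nat \<bar>t\<bar>) / norm q ^ (2 * nat \<bar>d\<bar>)" .
    have "norm (w z t / ((1 - w z t) * (1 - w z (t + d)))) = norm (w z t / (1 - w z t)) * norm (1 / (1 - w z (t + d)))"
      by (simp add: norm_mult norm_divide)
    also have "\<dots> \<le> (C + 1) * (C * norm q ^ (2 * nat \<bar>t\<bar>) / norm q ^ (2 * nat \<bar>d\<bar>))"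
      using C0 by (intro mult_mono 1 2) auto
    also have "\<dots> = ((C + 1) * C) * (norm q ^ (2 * nat \<bar>t\<bar>) / norm q ^ (2 * nat \<bar>d\<bar>))" by simp
    also have "\<dots> \<le> D * (norm q ^ (2 * nat \<bar>t\<bar>) / norm q ^ (2 * nat \<bar>d\<bar>))"
      using pos by (intro mult_right_mono D) simp
    finally show ?thesis .
  qed
  with D(3) show ?thesis by blast
qed

lemma q_sq_geometric: "(\<lambda>t::int. norm q ^ (2 * nat \<bar>t\<bar>)) summable_on UNIV"
  unfolding power_mult
  by (rule summable_on_int_geometric) (use q1 in \<open>simp_all add: power_less_one_iff\<close>)

lemma double_pole_summable:
  assumes z: "regular z"
  shows "(\<lambda>t. w z t / ((1 - w z t) * (1 - w z (t + d)))) summable_on UNIV"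
proof -
  obtain C where C: "C > 0" "\<And>t d. norm (w z t / ((1 - w z t) * (1 - w z (t + d))))
     \<le> C * (norm q ^ (2 * nat \<bar>t\<bar>) / norm q ^ (2 * nat \<bar>d\<bar>))"
    using double_pole_bound[OF z] by blast
  have "(\<lambda>t. norm (w z t / ((1 - w z t) * (1 - w z (t + d))))) summable_on UNIV"
  proof (rule Infinite_Sum.abs_summable_on_comparison_test')
    show "(\<lambda>t. (C / norm q ^ (2 * nat \<bar>d\<bar>)) * norm q ^ (2 * nat \<bar>t\<bar>)) summable_on UNIV"
      by (intro summable_on_cmult_right q_sq_geometric)
    show "norm (w z t / ((1 - w z t) * (1 - w z (t + d)))) \<le> (C / norm q ^ (2 * nat \<bar>d\<bar>)) * norm q ^ (2 * nat \<bar>t\<bar>)" for t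
      using C(2)[of t d] by simp
  qed
  thus ?thesis by (simp add: summable_on_iff_abs_summable_on_complex)
qed

text \<open>Two distinct simple poles on the same orbit: the product splits into a difference of translates
  and the bilateral sum telescopes.\<close>

lemma double_pole_sum:
  assumes z: "regular z" and d: "d \<noteq> 0"
  shows "((\<lambda>t. w z t / ((1 - w z t) * (1 - w z (t + d)))) has_sum (- of_int d / (1 - q powi (2 * d)))) UNIV"
proof -
  define h where "h t = 1 / (1 - w z t)" for t
  have split: "h t - h (t + e) = (1 - q powi (2 * e)) * (w z t / ((1 - w z t) * (1 - w z (t + e))))" for t e
  proof -
    have "h t - h (t + e) = ((1 - w z (t + e)) - (1 - w z t)) / ((1 - w z t) * (1 - w z (t + e)))"
      unfolding h_def using w_neq_1[OF z] by (simp add: diff_frac_eq)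
    also have "(1 - w z (t + e)) - (1 - w z t) = (1 - q powi (2 * e)) * w z t"
      by (simp add: w_add left_diff_distrib)
    finally show ?thesis by simp
  qed
  have p0: "(\<lambda>n. (q\<^sup>2) ^ n) \<longlonglongrightarrow> 0" by (rule LIMSEQ_power_zero[OF q2])
  have "(\<lambda>n. 1 / (1 - (q\<^sup>2) ^ n * z)) \<longlonglongrightarrow> 1 / (1 - 0 * z)"
    by (intro tendsto_intros p0) simp
  hence top: "(\<lambda>n. h (int n)) \<longlonglongrightarrow> 1"
    unfolding h_def w_def powi_double by simp
  have "(\<lambda>n. (q\<^sup>2) ^ n * (1 / (z * ((q\<^sup>2) ^ n / z - 1)))) \<longlonglongrightarrow> 0 * (1 / (z * (0 / z - 1)))"
    using regularD(1)[OF z] by (intro tendsto_intros p0) simp_all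
  moreover have "(q\<^sup>2) ^ n * (1 / (z * ((q\<^sup>2) ^ n / z - 1))) = h (- int n)" for n
  proof -
    define X where "X = (q\<^sup>2) ^ n"
    have nz: "X \<noteq> 0" "z \<noteq> 0" using q0 regularD(1)[OF z] by (simp_all add: X_def)
    have "z * (X / z - 1) = X - z" "1 - 1 / X * z = (X - z) / X"
      using nz by (simp_all add: right_diff_distrib diff_divide_distrib)
    thus ?thesis
      unfolding h_def w_def powi_double X_def[symmetric] by simp
  qed
  ultimately have bot: "(\<lambda>n. h (- int n)) \<longlonglongrightarrow> 0" by simp
  have "(\<lambda>t. h t - h (t + 1)) summable_on UNIV"
    unfolding split by (intro summable_on_cmult_right double_pole_summable z)
  from has_sum_telescope_int[OF this top bot, of d]
  have "((\<lambda>t. (1 - q powi (2 * d)) * (w z t / ((1 - w z t) * (1 - w z (t + d))))) has_sum (- of_int d)) UNIV"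
    unfolding split by simp
  from has_sum_cmult_right[OF this, of "1 / (1 - q powi (2 * d))"] show ?thesis
    using powi_2_neq_1[OF d] by simp
qed

text \<open>The diagonal case $d=0$, where the two simple poles merge: $\sum_tw_t/(1-w_t)^2$, a Weierstrass
  $\wp$-function in multiplicative notation, up to a factor and an additive constant.\<close>

definition double_pole_sum0 :: "complex \<Rightarrow> complex" where
  "double_pole_sum0 z = (\<Sum>\<^sub>\<infinity>t\<in>UNIV. w z t / (1 - w z t) ^ 2)"

lemma double_pole_sum0_has_sum:
  assumes z: "regular z"
  shows "((\<lambda>t. w z t / ((1 - w z t) * (1 - w z (t + 0)))) has_sum double_pole_sum0 z) UNIV"
  using has_sum_infsum[OF double_pole_summable[OF z, of 0]]
  by (simp add: double_pole_sum0_def power2_eq_square)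

text \<open>Ramanujan's product formula for the Lambert-type series $\sum_n a^n/(1-q^{2n}b)$.\<close>

theorem lambert_product:
  assumes a: "a \<noteq> 0" and b: "regular b" and s: "(\<lambda>n. a powi n / (1 - w b n)) summable_on UNIV"
  shows "jtheta a * (\<Sum>\<^sub>\<infinity>n\<in>UNIV. a powi n / (1 - w b n)) = jtheta (a * b) * E 0 b"
proof -
  define g where "g n = a powi n / (1 - w b n)" for n
  define f where "f = (\<lambda>(r, n). jterm a r * g n)"
  have g: "(g has_sum infsum g UNIV) UNIV"
    using s unfolding g_def by (rule has_sum_infsum)
  have f: "(f has_sum (jtheta a * infsum g UNIV)) UNIV"
    unfolding f_def by (rule has_sum_product[OF jterm_has_sum[OF a] g])
  \<comment> \<open>Collect the terms of equal exponent $N=r+n$ of \<open>a\<close>.\<close>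
  have f': "((\<lambda>(N, n). f (N - n, n)) has_sum (jtheta a * infsum g UNIV)) UNIV"
    by (rule has_sum_reindex_bij_witness[of _ "\<lambda>(r, n). (r + n, n)" "\<lambda>(N, n). (N - n, n)", THEN iffD2, OF _ _ _ _ _ refl f])
       auto
  have "((\<lambda>n. f (N - n, n)) has_sum (jterm (a * b) N * E 0 b)) UNIV" for N
  proof -
    have "f (N - n, n) = jterm a N * eterm N b n" for n
    proof -
      have e: "(N - n) * (N - n - 1) = N * (N - 1) + (n * (n + 1) - 2 * N * n)" by (simp add: algebra_simps)
      have 1: "q powi ((N - n) * (N - n - 1)) = q powi (N * (N - 1)) * q powi (n * (n + 1) - 2 * N * n)"
        unfolding e by (rule power_int_add) (use q0 in simp)
      have 2: "a powi (N - n) * a powi n = a powi N"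
        using power_int_add[of a "N - n" n] a by simp
      have 3: "(- 1 :: complex) powi (N - n) = (- 1) powi N * (- 1) powi n"
        by (simp add: power_int_diff power_int_minus_left)
      have "f (N - n, n) = (- 1) powi (N - n) * q powi ((N - n) * (N - n - 1)) * (a powi (N - n) * a powi n) / (1 - w b n)"
        by (simp add: f_def g_def jterm_def mult_ac)
      thus ?thesis unfolding 1 2 3 by (simp add: jterm_def eterm_def w_def mult_ac)
    qed
    moreover have "((\<lambda>n. jterm a N * eterm N b n) has_sum (jterm a N * E N b)) UNIV"
      by (rule has_sum_cmult_right[OF eterm_has_sum[OF b]])
    moreover have "jterm a N * E N b = jterm (a * b) N * E 0 b"
      unfolding E_eq[OF b, of N] by (simp add: jterm_def power_int_mult_distrib mult_ac)
    ultimately show ?thesis by simp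
  qed
  from has_sum_rows[OF has_sum_imp_summable[OF f'], where g = "\<lambda>N. jterm (a * b) N * E 0 b"] this
  have "((\<lambda>N. jterm (a * b) N * E 0 b) has_sum (jtheta a * infsum g UNIV)) UNIV"
    using infsumI[OF f'] by simp
  moreover have "((\<lambda>N. jterm (a * b) N * E 0 b) has_sum (jtheta (a * b) * E 0 b)) UNIV"
    by (intro has_sum_cmult_left jterm_has_sum) (use a regularD(1)[OF b] in simp)
  ultimately show ?thesis unfolding g_def by (rule has_sum_unique)
qed

section \<open>The Appell series as a sum of double poles\<close>

text \<open>The terms of the Appell series $M(z)=\sum_t(-1)^tq^{t(t+1)}z^{t+1}/(1-q^{2t}z)$.\<close>

definition mterm :: "complex \<Rightarrow> int \<Rightarrow> complex" where
  "mterm z t = (- 1) powi t * q powi (t * (t + 1)) * z powi (t + 1) / (1 - w z t)"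

text \<open>Minus the contribution of all $d\ne0$ to the double series in the next theorem.  The term at
  $d=0$ vanishes, because $0/0=0$.\<close>

definition lambert_const :: complex where
  "lambert_const = (\<Sum>\<^sub>\<infinity>d\<in>UNIV. (- 1) powi d * q powi (d * (d + 1)) * (of_int d / (1 - q powi (2 * d))))"

lemma gauss_weight_summable:
  "(\<lambda>d::int. norm (q powi (d * (d + 1))) / norm q ^ (2 * nat \<bar>d\<bar>)) summable_on UNIV"
proof -
  define F where "F d = q powi (d * d) * q powi d * complex_of_real (1 / norm q ^ (2 * nat \<bar>d\<bar>))" for d :: int
  have "F summable_on UNIV"
  proof (rule gauss_summable[where K = 1 and B = "1 / norm q * (1 / norm q ^ 2)"])
    fix d :: int
    have "norm (q powi (d * d)) = norm q ^ nat (d * d)"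
      by (simp add: power_int_def norm_power)
    moreover have "norm (q powi d) \<le> (1 / norm q) ^ nat \<bar>d\<bar>"
    proof (rule norm_powi_le)
      have "norm q * norm q \<le> 1 * 1" using q1 by (intro mult_mono) auto
      thus "norm q \<le> 1 / norm q" using nq by (simp add: pos_le_divide_eq)
    qed (simp add: norm_divide)
    moreover have "norm (complex_of_real (1 / norm q ^ (2 * nat \<bar>d\<bar>))) = (1 / norm q ^ 2) ^ nat \<bar>d\<bar>"
      unfolding norm_of_real by (simp add: power_mult power_one_over)
    ultimately have "norm (F d) \<le> norm q ^ nat (d * d) * (1 / norm q) ^ nat \<bar>d\<bar> * (1 / norm q ^ 2) ^ nat \<bar>d\<bar>"
      unfolding F_def norm_mult by (intro mult_mono mult_nonneg_nonneg) auto
    thus "norm (F d) \<le> 1 * (norm q ^ nat (d * d) * (1 / norm q * (1 / norm q ^ 2)) ^ nat \<bar>d\<bar>)"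
      by (simp only: power_mult_distrib mult_1 mult.assoc)
  qed simp_all
  hence "(\<lambda>d. norm (F d)) summable_on UNIV"
    by (simp add: summable_on_iff_abs_summable_on_complex)
  moreover have "norm (F d) = norm (q powi (d * (d + 1))) / norm q ^ (2 * nat \<bar>d\<bar>)" for d
  proof -
    have "q powi (d * (d + 1)) = q powi (d * d) * q powi d"
      unfolding distrib_left mult_1_right by (rule power_int_add) (use q0 in simp)
    thus ?thesis unfolding F_def norm_mult norm_of_real by (simp add: norm_mult)
  qed
  ultimately show ?thesis by simp
qed

text \<open>Put $w_t=q^{2t}z$.  Multiply the term \<open>t\<close> of the Appell series by the partial fraction expansion
  belonging to $z^{t+1}$, and subtract a multiple of the vanishing series $\sum_d(-1)^dq^{d(d-1)}$ from each row.
  This gives the absolutely convergent double series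
  $\sum_{t,d}(-1)^dq^{d(d+1)}w_t/((1-w_t)(1-w_{t+d}))$, and
  summation over \<open>t\<close> first leaves only the part with $d=0$ dependent on \<open>z\<close>.\<close>

theorem appell_mult_E:
  assumes z: "regular z"
  shows "((\<lambda>t. mterm z t * E 0 z) has_sum (double_pole_sum0 z - lambert_const)) UNIV"
proof -
  define D where "D t d = w z t / ((1 - w z t) * (1 - w z (t + d)))" for t d
  define f where "f = (\<lambda>(t, d). (- 1) powi d * q powi (d * (d + 1)) * D t d)"
  obtain C where C: "C > 0" "\<And>t d. norm (D t d) \<le> C * (norm q ^ (2 * nat \<bar>t\<bar>) / norm q ^ (2 * nat \<bar>d\<bar>))"
    using double_pole_bound[OF z] unfolding D_def by blast
  have f: "f summable_on UNIV"
  proof (rule summable_on_Times_bound)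
    show "(\<lambda>t. C * norm q ^ (2 * nat \<bar>t\<bar>)) summable_on (UNIV :: int set)"
      by (intro summable_on_cmult_right q_sq_geometric)
    show "(\<lambda>d. norm (q powi (d * (d + 1))) / norm q ^ (2 * nat \<bar>d\<bar>)) summable_on UNIV"
      by (rule gauss_weight_summable)
    fix t d
    have "norm (f (t, d)) = norm (q powi (d * (d + 1))) * norm (D t d)"
      by (simp add: f_def norm_mult norm_power_int)
    also have "\<dots> \<le> norm (q powi (d * (d + 1))) * (C * (norm q ^ (2 * nat \<bar>t\<bar>) / norm q ^ (2 * nat \<bar>d\<bar>)))"
      by (intro mult_left_mono C) simp
    finally show "norm (f (t, d)) \<le> C * norm q ^ (2 * nat \<bar>t\<bar>) * (norm (q powi (d * (d + 1))) / norm q ^ (2 * nat \<bar>d\<bar>))"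
      by (simp add: mult_ac)
  qed (use C in auto)
  have row: "((\<lambda>d. f (t, d)) has_sum (mterm z t * E 0 z)) UNIV" for t
  proof -
    define a where "a = (- 1) powi t * q powi (t * (t + 1))"
    have f_eq: "f (t, d) = 1 / (1 - w z t) * (a * eterm (t + 1) z (d + t) + (- 1) * jterm 1 d)" for d
    proof -
      have nz: "1 - w z t \<noteq> 0" "1 - w z (t + d) \<noteq> 0" by (rule w_neq_1[OF z])+
      have e: "d * (d - 1) = t * (t + 1) + ((d + t) * (d + t + 1) - 2 * (t + 1) * (d + t))"
        by (simp add: algebra_simps)
      have 1: "q powi (d * (d - 1)) = q powi (t * (t + 1)) * q powi ((d + t) * (d + t + 1) - 2 * (t + 1) * (d + t))"
        unfolding e by (rule power_int_add) (use q0 in simp)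
      have 2: "(- 1 :: complex) powi d = (- 1) powi t * (- 1) powi (d + t)"
        by (simp add: power_int_add power_int_minus_left)
      have "a * eterm (t + 1) z (d + t) = ((- 1) powi t * (- 1) powi (d + t)) *
          (q powi (t * (t + 1)) * q powi ((d + t) * (d + t + 1) - 2 * (t + 1) * (d + t))) / (1 - w z (t + d))"
        unfolding a_def eterm_def w_def by (simp add: mult_ac add.commute[of d t])
      hence A: "a * eterm (t + 1) z (d + t) = jterm 1 d / (1 - w z (t + d))"
        unfolding 1[symmetric] 2[symmetric] by (simp add: jterm_def)
      have "d * (d + 1) = d * (d - 1) + 2 * d" by (simp add: algebra_simps)
      hence "q powi (d * (d + 1)) = q powi (d * (d - 1)) * q powi (2 * d)"
        using power_int_add[of q "d * (d - 1)" "2 * d"] q0 by simp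
      hence "f (t, d) = jterm 1 d * w z (t + d) / ((1 - w z t) * (1 - w z (t + d)))"
        unfolding w_add by (simp add: f_def D_def jterm_def w_add mult_ac)
      also have "\<dots> = 1 / (1 - w z t) * (jterm 1 d / (1 - w z (t + d)) + (- 1) * jterm 1 d)"
        using nz by (simp add: divide_simps) (simp add: algebra_simps)
      finally show ?thesis unfolding A .
    qed
    have "((\<lambda>d. eterm (t + 1) z (d + t)) has_sum E (t + 1) z) UNIV"
      unfolding has_sum_shift_int by (rule eterm_has_sum[OF z])
    moreover have "(jterm 1 has_sum 0) UNIV"
      using jterm_has_sum[of 1] jtheta_power_eq_0[of 0] by simp
    ultimately have "((\<lambda>d. f (t, d)) has_sum (1 / (1 - w z t) * (a * E (t + 1) z + (- 1) * 0))) UNIV"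
      unfolding f_eq by (intro has_sum_cmult_right has_sum_add)
    moreover have "1 / (1 - w z t) * (a * E (t + 1) z + (- 1) * 0) = mterm z t * E 0 z"
      unfolding E_eq[OF z, of "t + 1"] by (simp add: a_def mterm_def)
    ultimately show ?thesis by simp
  qed
  define c where "c d = (- 1) powi d * q powi (d * (d + 1)) * (of_int d / (1 - q powi (2 * d)))" for d :: int
  define h where "h d = (if d = 0 then double_pole_sum0 z else 0) + (- 1) * c d" for d :: int
  have col: "((\<lambda>t. f (t, d)) has_sum h d) UNIV" for d
  proof (cases "d = 0")
    case True
    show ?thesis using double_pole_sum0_has_sum[OF z] by (simp add: True f_def D_def h_def c_def)
  next
    case False
    have "((\<lambda>t. f (t, d)) has_sum ((- 1) powi d * q powi (d * (d + 1)) * (- of_int d / (1 - q powi (2 * d))))) UNIV"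
      unfolding f_def D_def prod.case by (intro has_sum_cmult_right double_pole_sum z False)
    thus ?thesis using False by (simp add: h_def c_def)
  qed
  obtain S where S: "((\<lambda>t. mterm z t * E 0 z) has_sum S) UNIV" "(h has_sum S) UNIV"
    using double_has_sum[OF f row col] .
  have z0: "((\<lambda>d. if d = 0 then double_pole_sum0 z else 0) has_sum double_pole_sum0 z) (UNIV :: int set)"
    by (rule has_sum_finite_neutralI[where B = "{0}"]) auto
  have "((\<lambda>d. (if d = 0 then double_pole_sum0 z else 0) + (- 1) * h d) has_sum (double_pole_sum0 z + (- 1) * S)) UNIV"
    by (intro has_sum_add has_sum_cmult_right S z0)
  hence "(c has_sum (double_pole_sum0 z - S)) UNIV"
    by (simp add: h_def)
  hence "lambert_const = double_pole_sum0 z - S"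
    unfolding lambert_const_def c_def by (rule infsumI)
  thus ?thesis using S(1) by simp
qed

corollary appell_has_sum:
  assumes z: "regular z"
  shows "(mterm z has_sum ((double_pole_sum0 z - lambert_const) / E 0 z)) UNIV"
  using has_sum_cmult_left[OF appell_mult_E[OF z], of "1 / E 0 z"] E_nonzero[OF z] by simp

section \<open>Sums of four squares\<close>

text \<open>The terms of $\sum_nq^n/(1+q^{2n})$, by Ramanujan's formula half the theta function of two squares.\<close>

definition uterm :: "int \<Rightarrow> complex" where
  "uterm n = q powi n / (1 - w (- 1) n)"

lemma uterm_summable: "uterm summable_on UNIV"
proof -
  from pole_bound[OF regular_minus_1] obtain C where C0: "C > 0"
    and C: "\<And>r. norm (1 / (1 - w (- 1) r)) \<le> C"
    and C': "\<And>r. norm (1 / (1 - w (- 1) r)) \<le> C / norm q powi (2 * r)"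
    unfolding w_def by blast
  show ?thesis
  proof (rule summable_on_int_bound[where C = C])
    fix n :: int
    have e: "norm (uterm n) = norm q powi n * norm (1 / (1 - w (- 1) n))"
      by (simp add: uterm_def norm_divide norm_power_int)
    show "norm (uterm n) \<le> C * norm q ^ nat \<bar>n\<bar>"
    proof (cases "n \<ge> 0")
      case True
      have "norm q powi n * norm (1 / (1 - w (- 1) n)) \<le> norm q powi n * C"
        using nq by (intro mult_left_mono C) simp
      thus ?thesis unfolding e using True by (simp add: power_int_def mult.commute)
    next
      case False
      have "norm q powi n * norm (1 / (1 - w (- 1) n)) \<le> norm q powi n * (C / norm q powi (2 * n))"
        using nq by (intro mult_left_mono C') simp
      also have "\<dots> = C / norm q powi n"
      proof -
        have "norm q powi (2 * n) = norm q powi n * norm q powi n"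
          unfolding mult_2 by (rule power_int_add) (use nq in simp)
        thus ?thesis using nq by simp
      qed
      also have "\<dots> = C * norm q ^ nat \<bar>n\<bar>"
        using False nq by (simp add: power_int_def field_simps)
      finally show ?thesis unfolding e .
    qed
  qed (use q1 in auto)
qed

lemma uterm_sum_eq:
  "jtheta q * infsum uterm UNIV = jtheta (- q) * E 0 (- 1)"
  using lambert_product[OF q0 regular_minus_1] uterm_summable
  unfolding uterm_def[abs_def] by simp

text \<open>Multiply the series by itself and group by the difference \<open>d\<close> of the two indices: for $d\ne0$ the sum
  telescopes, and $d=0$ gives a sum of double poles.  The summand on the left vanishes at $d=0$.\<close>

lemma uterm_square:
  "((\<lambda>d. q powi d * (of_int d / (1 - q powi (2 * d)))) has_sum
    ((infsum uterm UNIV)\<^sup>2 + double_pole_sum0 (- 1))) UNIV"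
proof -
  define S where "S = infsum uterm UNIV"
  define f where "f = (\<lambda>(n, m). uterm n * uterm m)"
  have u: "(uterm has_sum S) UNIV" unfolding S_def by (rule has_sum_infsum[OF uterm_summable])
  have f: "(f has_sum (S * S)) UNIV" unfolding f_def by (rule has_sum_product[OF u u])
  define f' where "f' = (\<lambda>(d, n). f (n, n + d))"
  have f': "(f' has_sum (S * S)) UNIV"
    unfolding f'_def
    by (rule has_sum_reindex_bij_witness[of _ "\<lambda>(n, m). (m - n, n)" "\<lambda>(d, n). (n, n + d)", THEN iffD2, OF _ _ _ _ _ refl f])
       auto
  define c where "c d = q powi d * (of_int d / (1 - q powi (2 * d)))" for d :: int
  define h where "h d = (if d = 0 then - double_pole_sum0 (- 1) else 0) + c d" for d
  have f'_eq: "f' (d, n) = - (q powi d) * (w (- 1) n / ((1 - w (- 1) n) * (1 - w (- 1) (n + d))))" for d n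
  proof -
    have "q powi n * q powi (n + d) = - (q powi d) * w (- 1) n"
    proof -
      have "q powi (2 * n) = q powi n * q powi n" "q powi (n + d) = q powi n * q powi d"
        unfolding mult_2 by (rule power_int_add, use q0 in simp)+
      thus ?thesis by (simp add: w_def)
    qed
    thus ?thesis by (simp add: f'_def f_def uterm_def)
  qed
  have "((\<lambda>n. f' (d, n)) has_sum h d) UNIV" for d
  proof (cases "d = 0")
    case True
    have "((\<lambda>n. f' (d, n)) has_sum (- (q powi d) * double_pole_sum0 (- 1))) UNIV"
      unfolding f'_eq using double_pole_sum0_has_sum[OF regular_minus_1] True
      by (intro has_sum_cmult_right) simp
    thus ?thesis using True by (simp add: h_def c_def)
  next
    case False
    have "((\<lambda>n. f' (d, n)) has_sum (- (q powi d) * (- of_int d / (1 - q powi (2 * d))))) UNIV"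
      unfolding f'_eq by (intro has_sum_cmult_right double_pole_sum regular_minus_1 False)
    thus ?thesis using False by (simp add: h_def c_def)
  qed
  hence "(h has_sum infsum f' UNIV) UNIV" by (intro has_sum_rows has_sum_imp_summable[OF f'])
  hence h: "(h has_sum (S * S)) UNIV" using infsumI[OF f'] by simp
  have z0: "((\<lambda>d. if d = 0 then double_pole_sum0 (- 1) else 0) has_sum double_pole_sum0 (- 1)) (UNIV :: int set)"
    by (rule has_sum_finite_neutralI[where B = "{0}"]) auto
  have "((\<lambda>d. h d + (if d = 0 then double_pole_sum0 (- 1) else 0)) has_sum (S * S + double_pole_sum0 (- 1))) UNIV"
    by (intro has_sum_add h z0)
  moreover have "h d + (if d = 0 then double_pole_sum0 (- 1) else 0) = c d" for d
    by (simp add: h_def)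
  ultimately show ?thesis unfolding c_def S_def[symmetric] by (simp add: power2_eq_square)
qed

text \<open>The double series $\sum_{t\ge0,n\ge1}nq^{n(2t+1)}$ summed in both orders.\<close>

lemma lambert_swap:
  obtains Y where "(\<lambda>t. q ^ (2 * t + 1) / (1 - q ^ (2 * t + 1)) ^ 2) sums Y"
    "(\<lambda>n. of_nat (Suc n) * q ^ Suc n / (1 - q ^ (2 * Suc n))) sums Y"
proof -
  define f where "f = (\<lambda>(t, n). of_nat (Suc n) * (q ^ (2 * t + 1)) ^ Suc n)"
  have f: "f summable_on UNIV"
  proof (rule summable_on_Times_bound)
    have "summable (\<lambda>t. (norm q ^ 2) ^ t)"
      using q1 by (intro summable_geometric) (simp add: power_less_one_iff)
    thus "(\<lambda>t. norm q ^ (2 * t)) summable_on (UNIV :: nat set)"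
      by (intro norm_summable_imp_summable_on) (simp add: power_mult)
    have "summable (\<lambda>n. of_nat (Suc n) * norm q ^ n)"
      using geometric_deriv_sums[of "norm q"] q1 sums_summable by fastforce
    hence "summable (\<lambda>n. norm q * (of_nat (Suc n) * norm q ^ n))" by (rule summable_mult)
    hence "summable (\<lambda>n. norm (real (Suc n) * norm q ^ Suc n))" by (simp add: mult_ac)
    thus "(\<lambda>n. real (Suc n) * norm q ^ Suc n) summable_on UNIV"
      by (rule norm_summable_imp_summable_on)
    fix t n :: nat
    have "norm (f (t, n)) = real (Suc n) * norm q ^ ((2 * t + 1) * Suc n)"
      unfolding f_def by (simp only: prod.case norm_mult norm_power norm_of_nat power_mult)
    also have "\<dots> \<le> real (Suc n) * norm q ^ (2 * t + Suc n)"
      using q1 by (intro mult_left_mono power_decreasing) auto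
    finally show "norm (f (t, n)) \<le> norm q ^ (2 * t) * (real (Suc n) * norm q ^ Suc n)"
      by (simp only: power_add mult_ac)
  qed auto
  have row: "((\<lambda>n. f (t, n)) has_sum (q ^ (2 * t + 1) / (1 - q ^ (2 * t + 1)) ^ 2)) UNIV" for t
  proof (rule sums_imp_has_sum[OF summable_on_row[OF f]])
    have "norm (q ^ (2 * t + 1)) < 1"
      using norm_power_le_norm[OF q1, of "2 * t + 1"] q1 by simp
    from sums_mult[OF geometric_deriv_sums[OF this], of "q ^ (2 * t + 1)"]
    show "(\<lambda>n. f (t, n)) sums (q ^ (2 * t + 1) / (1 - q ^ (2 * t + 1)) ^ 2)"
      by (simp add: f_def mult_ac)
  qed
  have col: "((\<lambda>t. f (t, n)) has_sum (of_nat (Suc n) * q ^ Suc n / (1 - q ^ (2 * Suc n)))) UNIV" for n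
  proof (rule sums_imp_has_sum[OF summable_on_column[OF f]])
    have "norm (q ^ (2 * Suc n)) < 1"
      using norm_power_le_norm[OF q1, of "2 * Suc n"] q1 by simp
    from sums_mult[OF geometric_sums[OF this], of "of_nat (Suc n) * q ^ Suc n"]
    have "(\<lambda>t. of_nat (Suc n) * q ^ Suc n * (q ^ (2 * Suc n)) ^ t) sums (of_nat (Suc n) * q ^ Suc n / (1 - q ^ (2 * Suc n)))"
      by simp
    moreover have "f (t, n) = of_nat (Suc n) * q ^ Suc n * (q ^ (2 * Suc n)) ^ t" for t
    proof -
      have "(2 * t + 1) * Suc n = Suc n + 2 * Suc n * t" by (simp add: algebra_simps)
      hence "(q ^ (2 * t + 1)) ^ Suc n = q ^ Suc n * (q ^ (2 * Suc n)) ^ t"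
        using power_mult[of q "2 * t + 1" "Suc n"] power_mult[of q "2 * Suc n" t] power_add[of q "Suc n" "2 * Suc n * t"]
        by (simp only:)
      thus ?thesis by (simp only: f_def prod.case mult.assoc)
    qed
    ultimately show "(\<lambda>t. f (t, n)) sums (of_nat (Suc n) * q ^ Suc n / (1 - q ^ (2 * Suc n)))" by simp
  qed
  obtain S where "((\<lambda>t. q ^ (2 * t + 1) / (1 - q ^ (2 * t + 1)) ^ 2) has_sum S) UNIV"
    "((\<lambda>n. of_nat (Suc n) * q ^ Suc n / (1 - q ^ (2 * Suc n))) has_sum S) UNIV"
    using double_has_sum[OF f row col] .
  thus ?thesis using that has_sum_imp_sums by blast
qed

lemma w_q_reflect: "w q (- 1 - t) = 1 / w q t"
proof -
  have "2 * (- 1 - t) = - (2 * t) - 1 - 1" by simp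
  hence "w q (- 1 - t) = q powi (- (2 * t) - 1 - 1) * q" by (simp only: w_def)
  also have "\<dots> = q powi (- (2 * t) - 1)" by (rule power_int_minus_mult) (use q0 in simp)
  also have "\<dots> = 1 / w q t"
    using q0 by (simp add: w_def power_int_diff power_int_minus divide_inverse)
  finally show ?thesis .
qed

text \<open>In substance Jacobi's four square theorem: the right hand side is $\frac14\left(\sum_nq^{n^2}\right)^4$.\<close>

theorem double_pole_sum0_q: "double_pole_sum0 q - double_pole_sum0 (- 1) = (infsum uterm UNIV)\<^sup>2"
proof -
  obtain Y where Y: "(\<lambda>t. q ^ (2 * t + 1) / (1 - q ^ (2 * t + 1)) ^ 2) sums Y"
    "(\<lambda>n. of_nat (Suc n) * q ^ Suc n / (1 - q ^ (2 * Suc n))) sums Y"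
    using lambert_swap .
  define g where "g t = w q t / (1 - w q t) ^ 2" for t
  have g1: "g (int t) = q ^ (2 * t + 1) / (1 - q ^ (2 * t + 1)) ^ 2" for t
    unfolding g_def w_def powi_double power_mult[symmetric] by (simp add: mult.commute)
  have g2: "g (- 1 - int t) = g (int t)" for t
  proof -
    define x where "x = w q (int t)"
    have wx: "w q (- 1 - int t) = 1 / x" unfolding x_def by (rule w_q_reflect)
    have x: "x \<noteq> 0" "1 - x \<noteq> 0" using q0 w_neq_1[OF regular_q, of "int t"] by (simp_all add: x_def w_def)
    have "1 / x / (1 - 1 / x) ^ 2 = x / (1 - x) ^ 2"
    proof -
      have "1 - 1 / x = - (1 - x) / x" using x by (simp add: field_simps)
      thus ?thesis using x by (simp add: power_divide power2_eq_square) (simp add: algebra_simps)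
    qed
    thus ?thesis unfolding g_def wx x_def[symmetric] .
  qed
  have "(g has_sum double_pole_sum0 q) UNIV"
    using double_pole_sum0_has_sum[OF regular_q] unfolding g_def[abs_def] by (simp add: power2_eq_square)
  from has_sum_int_fold[OF this] have "(\<lambda>t. g (int t) + g (int t)) sums double_pole_sum0 q"
    unfolding g2 .
  moreover have "(\<lambda>t. g (int t) + g (int t)) sums (Y + Y)"
    unfolding g1 by (intro sums_add Y)
  ultimately have 1: "double_pole_sum0 q = Y + Y" by (rule sums_unique2)
  define c where "c d = q powi d * (of_int d / (1 - q powi (2 * d)))" for d :: int
  have c1: "c (int (Suc n)) = of_nat (Suc n) * q ^ Suc n / (1 - q ^ (2 * Suc n))" for n
    unfolding c_def powi_double power_int_of_nat of_int_of_nat_eq power_mult by simp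
  have c2: "c (- 1 - int n) = c (int (Suc n))" for n
  proof -
    define x where "x = q ^ Suc n"
    have px: "(q\<^sup>2) ^ Suc n = x ^ 2"
      unfolding x_def power_mult[symmetric] by (simp only: mult.commute)
    have x: "x \<noteq> 0" "1 - x ^ 2 \<noteq> 0"
      using q0 powi_2_neq_1[of "int (Suc n)"] unfolding powi_double px by (simp_all add: x_def)
    have s: "- 1 - int n = - int (Suc n)" by simp
    have "c (- int (Suc n)) = 1 / x * (- of_nat (Suc n) / (1 - 1 / x ^ 2))"
      unfolding c_def powi_double px power_int_minus_divide power_int_of_nat x_def[symmetric] by simp
    also have "\<dots> = x * (of_nat (Suc n) / (1 - x ^ 2))"
    proof -
      have "1 - 1 / x ^ 2 = - (1 - x ^ 2) / x ^ 2" using x by (simp add: field_simps)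
      moreover have "1 / x * (- N / (- D / x ^ 2)) = x * (N / D)" for N D
        using x by (simp add: power2_eq_square)
      ultimately show ?thesis by (simp only:)
    qed
    also have "\<dots> = c (int (Suc n))"
      unfolding c_def powi_double px power_int_of_nat x_def[symmetric] by simp
    finally show ?thesis unfolding s .
  qed
  obtain A B where AB: "(\<lambda>n. c (int n)) sums A" "(\<lambda>n. c (- 1 - int n)) sums B"
    "(infsum uterm UNIV)\<^sup>2 + double_pole_sum0 (- 1) = A + B"
    using has_sum_int_halves[OF uterm_square] unfolding c_def by blast
  have "B = Y" using AB(2) Y(2) unfolding c2 c1 by (rule sums_unique2)
  moreover have "A = Y"
  proof (rule sums_unique2[OF AB(1)])
    have "(\<lambda>n. c (int (Suc n))) sums Y" unfolding c1 by (rule Y)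
    hence "(\<lambda>n. c (int n)) sums (Y + c (int 0))" by (rule sums_Suc)
    thus "(\<lambda>n. c (int n)) sums Y" by (simp add: c_def)
  qed
  ultimately show ?thesis using AB(3) 1 by (simp add: algebra_simps)
qed

section \<open>Theta quotients\<close>

lemma Theta_nonzero:
  assumes "m > 0"
  shows "Theta q m \<noteq> 0"
proof -
  have "norm (q ^ m) < 1" using norm_power_le_norm[OF q1 assms] q1 by simp
  thus ?thesis unfolding Theta_eq_qpinf by (intro qpinf_nonzero power_mult_neq_1)
qed

lemma Pinf_eq_Theta: "Pinf = Theta q 2"
  by (simp add: Theta_eq_qpinf)

lemma qpinf_minus_base: "qpinf (- (q\<^sup>2)) (q\<^sup>2) = Theta q 4 / Theta q 2"
  using qpinf_mult_minus[OF q2, of "q\<^sup>2"] Theta_nonzero[of 2]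
  by (simp add: Theta_eq_qpinf power_mult[symmetric] field_simps)

lemma qpinf_half: "qpinf q (q\<^sup>2) = Theta q 1 / Theta q 2"
  using qpinf_even_odd[OF q1, of q] Theta_nonzero[of 2]
  by (simp add: Theta_eq_qpinf power2_eq_square[symmetric] field_simps)

lemma jtheta_q: "jtheta q = Theta q 1 ^ 2 / Theta q 2"
  unfolding jacobi_triple_product[OF q0] using q0 Theta_nonzero[of 2]
  by (simp add: power2_eq_square[of q] qpinf_half[unfolded power2_eq_square] Pinf_eq_Theta[unfolded power2_eq_square])
     (simp add: power2_eq_square)

lemma jtheta_minus_1: "jtheta (- 1) = 2 * Theta q 4 ^ 2 / Theta q 2"
proof -
  have "qpinf (- 1) (q\<^sup>2) = 2 * qpinf (- (q\<^sup>2)) (q\<^sup>2)"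
    using qpinf_Suc[OF q2, of "- 1"] by simp
  moreover have "jtheta (- 1) = Pinf * qpinf (- 1) (q\<^sup>2) * qpinf (- (q\<^sup>2)) (q\<^sup>2)"
    using jacobi_triple_product[of "- 1"] by simp
  ultimately have "jtheta (- 1) = Theta q 2 * (2 * (Theta q 4 / Theta q 2)) * (Theta q 4 / Theta q 2)"
    unfolding qpinf_minus_base Pinf_eq_Theta by simp
  thus ?thesis using Theta_nonzero[of 2] by (simp add: power2_eq_square)
qed

lemma qpinf_odd_base: "qpinf (q\<^sup>2) (q ^ 4) = Theta q 2 / Theta q 4"
  using qpinf_even_odd[OF q2, of "q\<^sup>2"] Theta_nonzero[of 4]
  by (simp add: Theta_eq_qpinf power_mult[symmetric] power_add[symmetric] field_simps)

lemma qpinf_minus_half: "qpinf (- q) (q\<^sup>2) = Theta q 2 ^ 2 / (Theta q 1 * Theta q 4)"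
proof -
  have "qpinf q (q\<^sup>2) * qpinf (- q) (q\<^sup>2) = qpinf (q\<^sup>2) (q ^ 4)"
    using qpinf_mult_minus[OF q2, of q] by (simp add: power_mult[symmetric])
  thus ?thesis unfolding qpinf_half qpinf_odd_base
    using Theta_nonzero[of 1] Theta_nonzero[of 2] Theta_nonzero[of 4] by (simp add: field_simps power2_eq_square)
qed

lemma jtheta_minus_q: "jtheta (- q) = Theta q 2 ^ 5 / (Theta q 1 ^ 2 * Theta q 4 ^ 2)"
proof -
  have e: "q\<^sup>2 / - q = - q" using q0 by (simp add: power2_eq_square)
  have "jtheta (- q) = Pinf * qpinf (- q) (q\<^sup>2) * qpinf (q\<^sup>2 / - q) (q\<^sup>2)"
    by (rule jacobi_triple_product) (use q0 in simp)
  hence "jtheta (- q) = Theta q 2 * (Theta q 2 ^ 2 / (Theta q 1 * Theta q 4)) * (Theta q 2 ^ 2 / (Theta q 1 * Theta q 4))"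
    unfolding e qpinf_minus_half Pinf_eq_Theta .
  also have "\<dots> = Theta q 2 ^ 5 / (Theta q 1 ^ 2 * Theta q 4 ^ 2)"
    by (simp add: power2_eq_square power_def numeral_eq_Suc mult_ac)
  finally show ?thesis .
qed

lemma jterm_minus_q: "jterm (- q) r = q powi (r * r)"
proof -
  have "(- q) powi r = (- 1) powi r * q powi r"
    using power_int_mult_distrib[of "- 1" q r] by simp
  moreover have "(- 1 :: complex) powi r * (- 1) powi r = 1"
    by (simp add: power_int_minus_left)
  moreover have "q powi (r * (r - 1)) * q powi r = q powi (r * r)"
    using power_int_add[of q "r * (r - 1)" r] q0 by (simp add: right_diff_distrib)
  ultimately show ?thesis by (simp add: jterm_def mult_ac)
qed

text \<open>Split $\sum_{m,n}q^{m^2+n^2}$ by the parity of $m+n$ and rotate the lattice.\<close>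

lemma jtheta_minus_q_square:
  "jtheta (- q) ^ 2 = nome.jtheta (q\<^sup>2) (- (q\<^sup>2)) ^ 2 + q * nome.jtheta (q\<^sup>2) (- 1) ^ 2"
proof -
  interpret N: nome "q\<^sup>2"
    by unfold_locales (use q0 q2 in auto)
  define f where "f = (\<lambda>(m, n). q powi (m * m) * q powi (n * n))"
  have q': "- q \<noteq> 0" "- (q\<^sup>2) \<noteq> 0" using q0 by simp_all
  have "((\<lambda>m. q powi (m * m)) has_sum jtheta (- q)) UNIV"
    using jterm_has_sum[OF q'(1)] unfolding jterm_minus_q[abs_def] .
  hence f: "(f has_sum (jtheta (- q) * jtheta (- q))) UNIV"
    unfolding f_def by (intro has_sum_product)
  define Ev where "Ev = {(m, n). even (m + n :: int)}"
  define Od where "Od = {(m, n). odd (m + n :: int)}"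
  have s: "f summable_on A" for A
    by (rule summable_on_subset_banach[OF has_sum_imp_summable[OF f]]) simp
  have "(f has_sum (infsum f Ev + infsum f Od)) (Ev \<union> Od)"
    by (intro has_sum_Un_disjoint has_sum_infsum s) (auto simp: Ev_def Od_def)
  moreover have "Ev \<union> Od = UNIV" by (auto simp: Ev_def Od_def)
  ultimately have split: "jtheta (- q) * jtheta (- q) = infsum f Ev + infsum f Od"
    using f has_sum_unique by metis
  have "((\<lambda>a. (q\<^sup>2) powi (a * a)) has_sum N.jtheta (- (q\<^sup>2))) UNIV"
    using N.jterm_has_sum[OF q'(2)] unfolding N.jterm_minus_q[abs_def] .
  hence "((\<lambda>(a, b). (q\<^sup>2) powi (a * a) * (q\<^sup>2) powi (b * b)) has_sum (N.jtheta (- (q\<^sup>2)) * N.jtheta (- (q\<^sup>2)))) UNIV"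
    by (intro has_sum_product)
  also have "?this \<longleftrightarrow> (f has_sum (N.jtheta (- (q\<^sup>2)) * N.jtheta (- (q\<^sup>2)))) Ev"
  proof (rule has_sum_reindex_bij_witness[of _ "\<lambda>(m, n). ((m + n) div 2, (m - n) div 2)" "\<lambda>(a, b). (a + b, a - b)"])
    fix x :: "int \<times> int"
    obtain a b where x: "x = (a, b)" by (cases x)
    have "q powi ((a + b) * (a + b)) * q powi ((a - b) * (a - b)) = q powi (2 * (a * a) + 2 * (b * b))"
      using q0 by (subst power_int_add[symmetric]) (simp_all add: algebra_simps)
    also have "\<dots> = q powi (2 * (a * a)) * q powi (2 * (b * b))"
      by (rule power_int_add) (use q0 in simp)
    finally show "f (case x of (a, b) \<Rightarrow> (a + b, a - b)) = (case x of (a, b) \<Rightarrow> (q\<^sup>2) powi (a * a) * (q\<^sup>2) powi (b * b))"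
      unfolding x f_def power_int_mult by simp
  qed (auto simp: Ev_def, presburger+)
  finally have E: "infsum f Ev = N.jtheta (- (q\<^sup>2)) * N.jtheta (- (q\<^sup>2))" by (rule infsumI)
  have j1: "((\<lambda>a. (q\<^sup>2) powi (a * (a + 1))) has_sum N.jtheta (- 1)) UNIV"
  proof -
    have "(N.jterm (- 1) has_sum N.jtheta (- 1)) UNIV" by (rule N.jterm_has_sum) simp
    hence "((\<lambda>a. N.jterm (- 1) (- a)) has_sum N.jtheta (- 1)) UNIV" by (simp only: has_sum_uminus_int)
    moreover have "N.jterm (- 1) (- a) = (q\<^sup>2) powi (a * (a + 1))" for a
    proof -
      have "(- a) * (- a - 1) = a * (a + 1)" by (simp add: algebra_simps)
      moreover have "(- 1 :: complex) powi (- a) * (- 1) powi (- a) = 1"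
        by (simp add: power_int_minus_left)
      ultimately show ?thesis by (simp add: N.jterm_def mult_ac)
    qed
    ultimately show ?thesis by simp
  qed
  have "((\<lambda>(a, b). (q\<^sup>2) powi (a * (a + 1)) * (q\<^sup>2) powi (b * (b + 1))) has_sum (N.jtheta (- 1) * N.jtheta (- 1))) UNIV"
    by (intro has_sum_product j1)
  hence "((\<lambda>x. q * (case x of (a, b) \<Rightarrow> (q\<^sup>2) powi (a * (a + 1)) * (q\<^sup>2) powi (b * (b + 1)))) has_sum (q * (N.jtheta (- 1) * N.jtheta (- 1)))) UNIV"
    by (rule has_sum_cmult_right)
  also have "?this \<longleftrightarrow> (f has_sum (q * (N.jtheta (- 1) * N.jtheta (- 1)))) Od"
  proof (rule has_sum_reindex_bij_witness[of _ "\<lambda>(m, n). ((m + n - 1) div 2, (m - n - 1) div 2)" "\<lambda>(a, b). (a + b + 1, a - b)"])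
    fix x :: "int \<times> int"
    obtain a b where x: "x = (a, b)" by (cases x)
    have "q powi ((a + b + 1) * (a + b + 1)) * q powi ((a - b) * (a - b)) = q powi ((2 * (a * (a + 1)) + 2 * (b * (b + 1))) + 1)"
      using q0 by (subst power_int_add[symmetric]) (simp_all add: algebra_simps)
    also have "\<dots> = q powi (2 * (a * (a + 1)) + 2 * (b * (b + 1))) * q powi 1"
      by (rule power_int_add) (use q0 in simp)
    also have "q powi (2 * (a * (a + 1)) + 2 * (b * (b + 1))) = q powi (2 * (a * (a + 1))) * q powi (2 * (b * (b + 1)))"
      by (rule power_int_add) (use q0 in simp)
    finally show "f (case x of (a, b) \<Rightarrow> (a + b + 1, a - b)) = q * (case x of (a, b) \<Rightarrow> (q\<^sup>2) powi (a * (a + 1)) * (q\<^sup>2) powi (b * (b + 1)))"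
      unfolding x f_def power_int_mult by (simp add: mult_ac)
  qed (auto simp: Od_def, presburger+)
  finally have O: "infsum f Od = q * (N.jtheta (- 1) * N.jtheta (- 1))" by (rule infsumI)
  show ?thesis using split unfolding E O by (simp add: power2_eq_square)
qed

section \<open>The mock theta functions as values of the Appell series\<close>

text \<open>The value $M(z)$ of the Appell series, for regular \<open>z\<close>.\<close>

definition appell :: "complex \<Rightarrow> complex" where
  "appell z = (double_pole_sum0 z - lambert_const) / E 0 z"

lemma phi_R_appell: "phi_R q = appell q / (2 * jtheta q)"
proof -
  define X where "X n = (- 1) ^ n * q ^ ((n + 1) ^ 2) / (1 - q ^ (2 * n + 1))" for n
  have m1: "mterm q (int n) = X n" for n
  proof -
    have "q powi (int n * (int n + 1)) * q powi (int n + 1) = q powi (int n * (int n + 1) + (int n + 1))"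
      by (rule power_int_add[symmetric]) (use q0 in simp)
    also have "int n * (int n + 1) + (int n + 1) = int ((n + 1) ^ 2)"
      by (simp add: power2_eq_square algebra_simps)
    finally have "q powi (int n * (int n + 1)) * q powi (int n + 1) = q ^ ((n + 1) ^ 2)"
      by (simp only: power_int_of_nat)
    moreover have "w q (int n) = q ^ (2 * n + 1)"
      unfolding w_def powi_double by (simp add: power_mult)
    ultimately show ?thesis by (simp add: mterm_def X_def mult.assoc)
  qed
  have m2: "mterm q (- 1 - int n) = mterm q (int n)" for n
  proof -
    define t where "t = int n"
    define x where "x = w q t"
    have x: "x \<noteq> 0" "1 - x \<noteq> 0" using q0 w_neq_1[OF regular_q, of t] by (simp_all add: x_def w_def)
    have e: "(- 1 - t) * (- t) = t * (t + 1)" "- 1 - t + 1 = - t" by (simp_all add: algebra_simps)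
    have sg: "(- 1 :: complex) powi (- 1 - t) = - ((- 1) powi t)"
      by (simp add: power_int_minus_left)
    have "t + 1 = - t + (2 * t + 1)" by simp
    hence "q powi (t + 1) = q powi (- t) * q powi (2 * t + 1)"
      using power_int_add[of q "- t" "2 * t + 1"] q0 by simp
    also have "q powi (2 * t + 1) = x" using q0 by (simp add: x_def w_def power_int_add)
    finally have p: "q powi (t + 1) = q powi (- t) * x" .
    have "1 - 1 / x = - (1 - x) / x" using x by (simp add: field_simps)
    hence "mterm q (- 1 - t) = - ((- 1) powi t) * q powi (t * (t + 1)) * q powi (- t) / (- (1 - x) / x)"
      unfolding mterm_def w_q_reflect e sg x_def[symmetric] by (simp only:)
    also have "\<dots> = (- 1) powi t * q powi (t * (t + 1)) * q powi (t + 1) / (1 - x)"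
    proof -
      have "- a * b * c / (- d / x) = a * b * (c * x) / d" for a b c d by (simp add: mult_ac)
      thus ?thesis unfolding p .
    qed
    also have "\<dots> = mterm q t" by (simp only: mterm_def x_def)
    finally show ?thesis unfolding t_def .
  qed
  have "(\<lambda>n. X n + X n) sums appell q"
    using has_sum_int_fold[OF appell_has_sum[OF regular_q]] unfolding m2 m1 appell_def .
  hence "(\<lambda>n. (X n + X n) * (1 / 2)) sums (appell q * (1 / 2))" by (rule sums_mult2)
  hence s: "suminf X = appell q / 2" by (simp add: sums_iff)
  have pre: "qpinf (- q) q / qpinf q q = 1 / jtheta q"
  proof -
    have "qpinf q q = Theta q 1" by (simp add: Theta_eq_qpinf)
    moreover have "qpinf q q * qpinf (- q) q = Theta q 2"
      using qpinf_mult_minus[OF q1, of q] by (simp add: Theta_eq_qpinf)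
    ultimately show ?thesis unfolding jtheta_q using Theta_nonzero[of 1] Theta_nonzero[of 2]
      by (simp add: field_simps power2_eq_square)
  qed
  have "phi_R q = qpinf (- q) q / qpinf q q * suminf X"
    unfolding X_def by (rule phi_R_eq[OF q0 q1])
  thus ?thesis unfolding s pre by simp
qed

text \<open>Up to sign, the terms of both $M(-1)$ and the partial fraction series at $z=-1$: these are
  $-\sum_nv_n$ and $\sum_n(-1)^nv_n$.  The even indices carry $\mu_2(q^2)$ and the odd ones $A_2(-q^2)$.\<close>

definition vterm :: "int \<Rightarrow> complex" where
  "vterm n = q powi (n * (n + 1)) / (1 - w (- 1) n)"

lemma vterm_uminus: "vterm (- n) = vterm n"
proof -
  define x where "x = w (- 1) n"
  have x: "x \<noteq> 0" "1 - x \<noteq> 0"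
    using q0 w_neq_1[OF regular_minus_1, of n] by (simp_all add: x_def w_def)
  have wx: "w (- 1) (- n) = 1 / x"
    by (simp add: x_def w_def power_int_minus divide_inverse)
  have "n * (n + 1) = - n * (- n + 1) + 2 * n" by (simp add: algebra_simps)
  hence "q powi (n * (n + 1)) = q powi (- n * (- n + 1)) * q powi (2 * n)"
    using power_int_add[of q "- n * (- n + 1)" "2 * n"] q0 by simp
  also have "q powi (2 * n) = - x" by (simp add: x_def w_def)
  finally have p: "q powi (n * (n + 1)) = q powi (- n * (- n + 1)) * (- x)" .
  have "1 - 1 / x = - (1 - x) / x" using x by (simp add: field_simps)
  moreover have "a / (- b / x) = a * (- x) / b" for a b by simp
  ultimately show ?thesis unfolding vterm_def wx p x_def[symmetric] by (simp only:)
qed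

lemma vterm_has_sum: "(vterm has_sum (- appell (- 1))) UNIV"
proof -
  have "mterm (- 1) n = - vterm n" for n
  proof -
    have "(- 1 :: complex) powi n * (- 1) powi (n + 1) = - 1"
      by (simp add: power_int_minus_left)
    moreover have "mterm (- 1) n = ((- 1) powi n * (- 1) powi (n + 1)) * vterm n"
      by (simp add: mterm_def vterm_def mult_ac)
    ultimately show ?thesis by simp
  qed
  hence "((\<lambda>n. - vterm n) has_sum appell (- 1)) UNIV"
    using appell_has_sum[OF regular_minus_1] unfolding appell_def[symmetric] by (simp cong: has_sum_cong)
  from has_sum_cmult_right[OF this, of "- 1"] show ?thesis by simp
qed

lemma vterm_alternating_has_sum: "((\<lambda>n. (- 1) powi n * vterm n) has_sum E 0 (- 1)) UNIV"
proof -
  have "eterm 0 (- 1) n = (- 1) powi n * vterm n" for n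
    by (simp add: eterm_def vterm_def w_def)
  thus ?thesis using eterm_has_sum[OF regular_minus_1, of 0] by (simp cong: has_sum_cong)
qed

lemma vterm_parity:
  "((\<lambda>n. vterm (2 * n)) has_sum ((- appell (- 1) + E 0 (- 1)) / 2)) UNIV"
  "((\<lambda>n. vterm (2 * n + 1)) has_sum ((- appell (- 1) - E 0 (- 1)) / 2)) UNIV"
proof -
  have "((\<lambda>n. (vterm n + (- 1) powi n * vterm n) * (1 / 2)) has_sum ((- appell (- 1) + E 0 (- 1)) * (1 / 2))) UNIV"
    by (intro has_sum_cmult_left has_sum_add vterm_has_sum vterm_alternating_has_sum)
  also have "?this \<longleftrightarrow> (vterm has_sum ((- appell (- 1) + E 0 (- 1)) * (1 / 2))) (range (\<lambda>n. 2 * n))"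
    by (rule has_sum_cong_neutral) (auto simp: power_int_minus_left image_iff elim!: evenE)
  also have "\<dots> \<longleftrightarrow> ((\<lambda>n. vterm (2 * n)) has_sum ((- appell (- 1) + E 0 (- 1)) * (1 / 2))) UNIV"
    by (subst has_sum_reindex) (auto simp: inj_on_def o_def)
  finally show "((\<lambda>n. vterm (2 * n)) has_sum ((- appell (- 1) + E 0 (- 1)) / 2)) UNIV" by simp
  have "((\<lambda>n. (vterm n + (- 1) * ((- 1) powi n * vterm n)) * (1 / 2)) has_sum ((- appell (- 1) + (- 1) * E 0 (- 1)) * (1 / 2))) UNIV"
    by (intro has_sum_cmult_left has_sum_add has_sum_cmult_right vterm_has_sum vterm_alternating_has_sum)
  also have "?this \<longleftrightarrow> (vterm has_sum ((- appell (- 1) + (- 1) * E 0 (- 1)) * (1 / 2))) (range (\<lambda>n. 2 * n + 1))"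
    by (rule has_sum_cong_neutral) (auto simp: power_int_minus_left image_iff elim!: oddE)
  also have "\<dots> \<longleftrightarrow> ((\<lambda>n. vterm (2 * n + 1)) has_sum ((- appell (- 1) + (- 1) * E 0 (- 1)) * (1 / 2))) UNIV"
    by (subst has_sum_reindex) (auto simp: inj_on_def o_def)
  finally show "((\<lambda>n. vterm (2 * n + 1)) has_sum ((- appell (- 1) - E 0 (- 1)) / 2)) UNIV" by simp
qed

lemma psi_prefactor: "qpinf (q\<^sup>2) ((q\<^sup>2)\<^sup>2) / qpinf ((q\<^sup>2)\<^sup>2) ((q\<^sup>2)\<^sup>2) = 2 / jtheta (- 1)"
proof -
  have p: "(q\<^sup>2)\<^sup>2 = q ^ 4" by (simp add: power_mult[symmetric])
  have "qpinf (q ^ 4) (q ^ 4) = Theta q 4" by (simp add: Theta_eq_qpinf)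
  thus ?thesis unfolding p qpinf_odd_base jtheta_minus_1 by (simp add: power2_eq_square)
qed

lemma mu2_appell: "mu2 (q\<^sup>2) = 2 * (- appell (- 1) + E 0 (- 1)) / jtheta (- 1)"
proof -
  define g where "g n = vterm (2 * int n)" for n
  have g0: "g 0 = 1 / 2" by (simp add: g_def vterm_def w_def)
  have g: "g n = (q\<^sup>2) ^ (n * (2 * n + 1)) / (1 + (q\<^sup>2) ^ (2 * n))" for n
  proof -
    have "2 * int n * (2 * int n + 1) = int (2 * (n * (2 * n + 1)))" by (simp add: algebra_simps)
    hence "q powi (2 * int n * (2 * int n + 1)) = (q\<^sup>2) ^ (n * (2 * n + 1))"
      by (simp only: power_int_of_nat power_mult)
    moreover have "w (- 1) (2 * int n) = - ((q\<^sup>2) ^ (2 * n))"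
      using powi_double(1)[of "2 * n"] by (simp add: w_def)
    ultimately show ?thesis by (simp add: g_def vterm_def)
  qed
  obtain A B where AB: "(\<lambda>n. vterm (2 * int n)) sums A" "(\<lambda>n. vterm (2 * (- 1 - int n))) sums B"
    "(- appell (- 1) + E 0 (- 1)) / 2 = A + B"
    using has_sum_int_halves[OF vterm_parity(1)] .
  have A: "g sums A" using AB(1) unfolding g_def[abs_def] .
  have "vterm (2 * (- 1 - int n)) = g (Suc n)" for n
    using vterm_uminus[of "2 * int (Suc n)"] by (simp add: g_def)
  hence "(\<lambda>n. g (Suc n)) sums B" using AB(2) by simp
  hence "g sums (B + g 0)" by (rule sums_Suc)
  hence AB': "A = B + 1 / 2" using A sums_unique2 g0 by auto
  have "(\<lambda>n. 4 * g n - (if n = 0 then 1 else 0)) sums (4 * A - 1)"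
    by (intro sums_diff sums_mult A sums_single)
  moreover have "4 * g n - (if n = 0 then 1 else 0)
      = (if n = 0 then 1 else 4 * (q\<^sup>2) ^ (n * (2 * n + 1)) / (1 + (q\<^sup>2) ^ (2 * n)))" for n
    using g0 g[of n] by auto
  ultimately have S: "(\<Sum>n. if n = 0 then 1 else 4 * (q\<^sup>2) ^ (n * (2 * n + 1)) / (1 + (q\<^sup>2) ^ (2 * n))) = 4 * A - 1"
    by (simp add: sums_iff)
  have "4 * A - 1 = 2 * (A + B)" using AB' by simp
  hence "4 * A - 1 = 2 * (- appell (- 1) + E 0 (- 1)) / 2" unfolding AB(3)[symmetric] by simp
  moreover have "mu2 (q\<^sup>2) = 2 / jtheta (- 1) * (4 * A - 1)"
    using mu2_eq[OF _ q2] q0 unfolding S psi_prefactor by simp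
  ultimately show ?thesis by simp
qed

lemma A2_appell: "A2 (- (q\<^sup>2)) = - ((- appell (- 1) - E 0 (- 1)) / 2) / jtheta (- 1)"
proof -
  define g where "g n = vterm (2 * int n + 1)" for n
  have g: "(- 1) ^ n * (- (q\<^sup>2)) ^ ((n + 1) * (2 * n + 1)) / (1 - (- (q\<^sup>2)) ^ (2 * n + 1)) = - g n" for n
  proof -
    have "(2 * int n + 1) * (2 * int n + 1 + 1) = int (2 * ((n + 1) * (2 * n + 1)))" by (simp add: algebra_simps)
    hence "q powi ((2 * int n + 1) * (2 * int n + 1 + 1)) = (q\<^sup>2) ^ ((n + 1) * (2 * n + 1))"
      by (simp only: power_int_of_nat power_mult)
    moreover have "w (- 1) (2 * int n + 1) = - ((q\<^sup>2) ^ (2 * n + 1))"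
    proof -
      have e: "2 * int n + 1 = int (2 * n + 1)" by simp
      show ?thesis unfolding e w_def powi_double by simp
    qed
    moreover have "(- (q\<^sup>2)) ^ ((n + 1) * (2 * n + 1)) = (- 1) ^ ((n + 1) * (2 * n + 1)) * (q\<^sup>2) ^ ((n + 1) * (2 * n + 1))"
      "(- (q\<^sup>2)) ^ (2 * n + 1) = - ((q\<^sup>2) ^ (2 * n + 1))"
      by (rule power_minus) simp
    moreover have "(- 1) ^ n * (- 1 :: complex) ^ ((n + 1) * (2 * n + 1)) = - 1"
      by (simp add: minus_one_power_iff)
    ultimately show ?thesis by (simp only: g_def vterm_def mult.assoc[symmetric]) simp
  qed
  obtain A B where AB: "(\<lambda>n. vterm (2 * int n + 1)) sums A" "(\<lambda>n. vterm (2 * (- 1 - int n) + 1)) sums B"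
    "(- appell (- 1) - E 0 (- 1)) / 2 = A + B"
    using has_sum_int_halves[OF vterm_parity(2)] .
  have A: "g sums A" using AB(1) unfolding g_def[abs_def] .
  have "vterm (2 * (- 1 - int n) + 1) = g n" for n
  proof -
    have e: "2 * (- 1 - int n) + 1 = - (2 * int n + 1)" by simp
    show ?thesis unfolding e vterm_uminus g_def ..
  qed
  hence "g sums B" using AB(2) by simp
  hence "B = A" using A by (rule sums_unique2)
  moreover have "(\<Sum>n. (- 1) ^ n * (- (q\<^sup>2)) ^ ((n + 1) * (2 * n + 1)) / (1 - (- (q\<^sup>2)) ^ (2 * n + 1))) = - A"
    unfolding g using sums_minus[OF A] by (rule sums_unique[symmetric])
  moreover have "A2 (- (q\<^sup>2)) = qpinf (q\<^sup>2) ((q\<^sup>2)\<^sup>2) / qpinf ((q\<^sup>2)\<^sup>2) ((q\<^sup>2)\<^sup>2) *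
      (\<Sum>n. (- 1) ^ n * (- (q\<^sup>2)) ^ ((n + 1) * (2 * n + 1)) / (1 - (- (q\<^sup>2)) ^ (2 * n + 1)))"
  proof -
    have "norm (- (q\<^sup>2)) < 1" "- (q\<^sup>2) \<noteq> 0" using q2 q0 by simp_all
    from A2_eq[OF this(2,1)] show ?thesis by (simp only: minus_minus power2_minus)
  qed
  ultimately have "A2 (- (q\<^sup>2)) = 2 / jtheta (- 1) * (- A)" "(- appell (- 1) - E 0 (- 1)) / 2 = A + A"
    unfolding psi_prefactor AB(3) by (simp_all only:)
  thus ?thesis by simp
qed

section \<open>The three identities\<close>

text \<open>The exponents $r(r-1)$ are even, so the theta series depends on the nome only through its square.\<close>

lemma jtheta_minus_nome: "nome.jtheta (- q) q = jtheta q"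
proof -
  interpret M: nome "- q" by unfold_locales (use q0 q1 in auto)
  have "M.jterm q r = jterm q r" for r
  proof -
    have "even (r * (r - 1))" by simp
    hence "(- q) powi (r * (r - 1)) = q powi (r * (r - 1))" by (rule power_int_minus_left_even)
    thus ?thesis by (simp add: M.jterm_def jterm_def)
  qed
  hence "M.jterm q = jterm q" by (rule ext)
  thus ?thesis by (simp add: M.jtheta_def jtheta_def)
qed

lemma jtheta_q_square:
  "jtheta q ^ 2 = nome.jtheta (q\<^sup>2) (- (q\<^sup>2)) ^ 2 - q * nome.jtheta (q\<^sup>2) (- 1) ^ 2"
proof -
  interpret M: nome "- q" by unfold_locales (use q0 q1 in auto)
  show ?thesis using M.jtheta_minus_q_square jtheta_minus_nome by simp
qed

text \<open>The constant in $M(z)/j(z)$ does not depend on \<open>z\<close> and cancels, which leaves the sum of four squares.\<close>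

lemma mock_theta_combination:
  "2 * phi_R q + 1 / 4 * mu2 (q\<^sup>2) - A2 (- (q\<^sup>2)) = Pinf ^ 3 / jtheta (- 1) ^ 2 * (jtheta (- q) ^ 2 / jtheta q ^ 2)"
proof -
  have nz: "jtheta q \<noteq> 0" "jtheta (- 1) \<noteq> 0" "Pinf \<noteq> 0"
    using jtheta_nonzero[OF regular_q] jtheta_nonzero[OF regular_minus_1] Pinf_nz by auto
  have ap: "appell z / jtheta z = (double_pole_sum0 z - lambert_const) / Pinf ^ 3" if "regular z" for z
    unfolding appell_def E_0[OF that] using jtheta_nonzero[OF that] nz(3) by simp
  have S: "infsum uterm UNIV = jtheta (- q) * (Pinf ^ 3 / jtheta (- 1)) / jtheta q"
  proof -
    have "infsum uterm UNIV = jtheta q * infsum uterm UNIV / jtheta q" using nz by simp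
    thus ?thesis unfolding uterm_sum_eq E_0[OF regular_minus_1] .
  qed
  have "2 * phi_R q + 1 / 4 * mu2 (q\<^sup>2) - A2 (- (q\<^sup>2)) = appell q / jtheta q - appell (- 1) / jtheta (- 1)"
    unfolding phi_R_appell mu2_appell A2_appell using nz by (simp add: field_simps)
  also have "\<dots> = (double_pole_sum0 q - double_pole_sum0 (- 1)) / Pinf ^ 3"
    unfolding ap[OF regular_q] ap[OF regular_minus_1] by (simp add: diff_divide_distrib)
  also have "\<dots> = (jtheta (- q) * (Pinf ^ 3 / jtheta (- 1)) / jtheta q) ^ 2 / Pinf ^ 3"
    unfolding double_pole_sum0_q S ..
  also have "\<dots> = Pinf ^ 3 / jtheta (- 1) ^ 2 * (jtheta (- q) ^ 2 / jtheta q ^ 2)"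
  proof -
    have "(m * (X / j) / k) ^ 2 / X = X / j ^ 2 * (m ^ 2 / k ^ 2)" if "X \<noteq> 0" for m X j k :: complex
      using that by (simp add: power2_eq_square mult_ac)
    thus ?thesis using nz(3) by simp
  qed
  finally show ?thesis .
qed

lemma mock_theta_mu2_A2: "1 / 4 * mu2 (q\<^sup>2) + A2 (- (q\<^sup>2)) = Pinf ^ 3 / jtheta (- 1) ^ 2"
proof -
  have "1 / 4 * mu2 (q\<^sup>2) + A2 (- (q\<^sup>2)) = E 0 (- 1) / jtheta (- 1)"
    unfolding mu2_appell A2_appell using jtheta_nonzero[OF regular_minus_1] by (simp add: field_simps)
  thus ?thesis unfolding E_0[OF regular_minus_1] by (simp add: power2_eq_square)
qed

text \<open>The third identity is a product formula already.  The first and the second are its difference from,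
  and its sum with, $\frac14\mu_2(q^2)+A_2(-q^2)$; there the squares of $\sum_nq^{n^2}$ and
  $\sum_n(-1)^nq^{n^2}$ have to be subtracted and added.\<close>

theorem mock_theta_identities:
  "2 * phi_R q - 2 * A2 (- (q ^ 2))
     = 2 * q * (Theta q 2 ^ 7 * Theta q 8 ^ 4 / (Theta q 1 ^ 4 * Theta q 4 ^ 6))"
  "2 * phi_R q + 1 / 2 * mu2 (q ^ 2)
     = 1 / 2 * (Theta q 2 ^ 3 * Theta q 4 ^ 6 / (Theta q 1 ^ 4 * Theta q 8 ^ 4))"
  "2 * phi_R q + 1 / 4 * mu2 (q ^ 2) - A2 (- (q ^ 2))
     = 1 / 4 * (Theta q 2 ^ 17 / (Theta q 1 ^ 8 * Theta q 4 ^ 8))"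
proof -
  interpret N: nome "q\<^sup>2"
    by unfold_locales (use q0 q2 in auto)
  define a b c d where "a = Theta q 1" and "b = Theta q 2" and "c = Theta q 4" and "d = Theta q 8"
  have nz: "a \<noteq> 0" "b \<noteq> 0" "c \<noteq> 0" "d \<noteq> 0"
    unfolding a_def b_def c_def d_def by (intro Theta_nonzero; simp)+
  have Th: "Theta (q\<^sup>2) m = Theta q (2 * m)" for m
    by (simp add: Theta_eq_qpinf power_mult)
  have \<phi>: "N.jtheta (- (q\<^sup>2)) = c ^ 5 / (b ^ 2 * d ^ 2)"
    using N.jtheta_minus_q by (simp add: Th b_def c_def d_def)
  have \<psi>: "N.jtheta (- 1) = 2 * d ^ 2 / c"
    using N.jtheta_minus_1 by (simp add: Th c_def d_def)
  have jq: "jtheta q = a ^ 2 / b" and jm: "jtheta (- q) = b ^ 5 / (a ^ 2 * c ^ 2)"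
    and j1: "jtheta (- 1) = 2 * c ^ 2 / b" and J: "Pinf = b"
    unfolding a_def b_def c_def by (rule jtheta_q jtheta_minus_q jtheta_minus_1 Pinf_eq_Theta)+
  define X Y where "X = 2 * phi_R q + 1 / 4 * mu2 (q ^ 2) - A2 (- (q ^ 2))"
    and "Y = 1 / 4 * mu2 (q ^ 2) + A2 (- (q ^ 2))"
  have K: "Pinf ^ 3 / jtheta (- 1) ^ 2 = b ^ 5 / (4 * c ^ 4)"
    unfolding J j1 using nz by (simp add: field_simps eval_nat_numeral)
  have X: "X = b ^ 5 / (4 * c ^ 4) * (jtheta (- q) ^ 2 / jtheta q ^ 2)"
    unfolding X_def mock_theta_combination K ..
  have Y: "Y = b ^ 5 / (4 * c ^ 4)"
    unfolding Y_def mock_theta_mu2_A2 K ..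
  have jq0: "jtheta q ^ 2 \<noteq> 0" unfolding jq using nz by simp
  have sum: "jtheta (- q) ^ 2 + jtheta q ^ 2 = 2 * (c ^ 5 / (b ^ 2 * d ^ 2)) ^ 2"
    and diff: "jtheta (- q) ^ 2 - jtheta q ^ 2 = 2 * q * (2 * d ^ 2 / c) ^ 2"
    unfolding jtheta_minus_q_square jtheta_q_square \<phi> \<psi> by simp_all
  have "X = b ^ 5 / (4 * c ^ 4) * ((b ^ 5 / (a ^ 2 * c ^ 2)) ^ 2 / (a ^ 2 / b) ^ 2)"
    unfolding X jq jm ..
  also have "\<dots> = 1 / 4 * (b ^ 17 / (a ^ 8 * c ^ 8))"
    using nz by (simp add: field_simps eval_nat_numeral)
  finally show "2 * phi_R q + 1 / 4 * mu2 (q ^ 2) - A2 (- (q ^ 2))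
     = 1 / 4 * (Theta q 2 ^ 17 / (Theta q 1 ^ 8 * Theta q 4 ^ 8))"
    unfolding X_def a_def b_def c_def .
  have "2 * phi_R q - 2 * A2 (- (q ^ 2)) = X - Y"
    by (simp add: X_def Y_def)
  also have "\<dots> = b ^ 5 / (4 * c ^ 4) * ((jtheta (- q) ^ 2 - jtheta q ^ 2) / jtheta q ^ 2)"
    unfolding X Y using jq0 by (simp add: diff_divide_distrib right_diff_distrib)
  also have "\<dots> = b ^ 5 / (4 * c ^ 4) * ((2 * q * (2 * d ^ 2 / c) ^ 2) / (a ^ 2 / b) ^ 2)"
    unfolding diff unfolding jq ..
  also have "\<dots> = 2 * q * (b ^ 7 * d ^ 4 / (a ^ 4 * c ^ 6))"
    using nz by (simp add: field_simps eval_nat_numeral)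
  finally show "2 * phi_R q - 2 * A2 (- (q ^ 2))
     = 2 * q * (Theta q 2 ^ 7 * Theta q 8 ^ 4 / (Theta q 1 ^ 4 * Theta q 4 ^ 6))"
    unfolding a_def b_def c_def d_def .
  have "2 * phi_R q + 1 / 2 * mu2 (q ^ 2) = X + Y"
    by (simp add: X_def Y_def)
  also have "\<dots> = b ^ 5 / (4 * c ^ 4) * ((jtheta (- q) ^ 2 + jtheta q ^ 2) / jtheta q ^ 2)"
    unfolding X Y using jq0 by (simp add: add_divide_distrib distrib_left)
  also have "\<dots> = b ^ 5 / (4 * c ^ 4) * ((2 * (c ^ 5 / (b ^ 2 * d ^ 2)) ^ 2) / (a ^ 2 / b) ^ 2)"
    unfolding sum unfolding jq ..
  also have "\<dots> = 1 / 2 * (b ^ 3 * c ^ 6 / (a ^ 4 * d ^ 4))"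
    using nz by (simp add: field_simps eval_nat_numeral)
  finally show "2 * phi_R q + 1 / 2 * mu2 (q ^ 2)
     = 1 / 2 * (Theta q 2 ^ 3 * Theta q 4 ^ 6 / (Theta q 1 ^ 4 * Theta q 8 ^ 4))"
    unfolding a_def b_def c_def d_def .
qed

end

theorem theorem2p4:
  fixes \<tau> q :: complex
  assumes "Im \<tau> > 0"
    and "q = exp (2 * of_real pi * \<i> * \<tau>)"
  shows "2 * phi_R q - 2 * A2 (- (q ^ 2))
           = 2 * q * (Theta q 2 ^ 7 * Theta q 8 ^ 4 / (Theta q 1 ^ 4 * Theta q 4 ^ 6)) \<and>
         2 * phi_R q + 1 / 2 * mu2 (q ^ 2)
           = 1 / 2 * (Theta q 2 ^ 3 * Theta q 4 ^ 6 / (Theta q 1 ^ 4 * Theta q 8 ^ 4)) \<and>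
         2 * phi_R q + 1 / 4 * mu2 (q ^ 2) - A2 (- (q ^ 2))
           = 1 / 4 * (Theta q 2 ^ 17 / (Theta q 1 ^ 8 * Theta q 4 ^ 8))"
proof -
  have "norm q = exp (- (2 * pi * Im \<tau>))"
    unfolding assms(2) by (simp add: norm_exp_eq_Re)
  hence "norm q < 1" using assms(1) by simp
  moreover have "q \<noteq> 0" unfolding assms(2) by simp
  ultimately interpret nome q by unfold_locales
  show ?thesis using mock_theta_identities by simp
qed

end
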